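(* The multiplication maps $\nabla:\mathcal{M}_{n'}(G')\otimes\mathcal{M}_{n''}(G'')\to\mathcal{M}_{n'+n''}(G)$ induce a multiplication $$\nabla:\mathcal{M}_{n'}(\mathbf{Q}/\mathbf{Z})\otimes\mathcal{M}_{n''}(\mathbf{Q}/\mathbf{Z})\to\mathcal{M}_{n'+n''}(\mathbf{Q}/\mathbf{Z}),$$ which is given by $$\nabla(\langle a\rangle,\langle b\rangle)=\langle\rho_\ell(a),b\rangle\qquad\text{for }\langle b\rangle\in\mathcal{M}_{n''}(\mathbf{Z}/\ell\mathbf{Z}).$$ The comultiplication maps $\Delta:\mathcal{M}_n(G)\to\mathcal{M}_{n'}(G')\otimes\mathcal{M}^-_{n''}(G'')$ induce a comultiplication $$\Delta:\mathcal{M}_n(\mathbf{Q}/\mathbf{Z})\to\bigoplus_{n'+n''=n}\mathcal{M}_{n'}(\mathbf{Q}/\mathbf{Z})\otimes\mathcal{M}_{n''}(\mathbf{Q}/\mathbf{Z})^-$$ given by $$\Delta\langle a\rangle=\oplus\,\langle\sigma_\ell(a_{I'})\rangle\otimes\langle a_{I''}\rangle^-,$$ where for $\langle a\rangle\in\mathcal{M}_n(G_N)$ the sum is over $\ell\mid N$ and over all partitions $I'\sqcup I''=\{1,\ldots,n\}$ (with $n'=\#I'$, $n''=\#I''$) with $\langle a_{I''}\rangle$ in $\mathcal{M}_{n''}(\mathrm{Ker}(\sigma_\ell))$.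
   Context: For a finite abelian group $G$ with character group $A=G^\vee=\mathrm{Hom}(G,\mathbf{C}^* )$ (written additively) and $n\ge1$, $\mathcal{M}_n(G)$ is the $\mathbf{Z}$-module generated by symbols $\langle a_1,\ldots,a_n\rangle$ with $a_i\in A$ such that $a_1,\ldots,a_n$ generate $A$, with relations: (1) $\langle a_{\sigma(1)},\ldots,a_{\sigma(n)}\rangle=\langle a_1,\ldots,a_n\rangle$ for all $\sigma\in S_n$; (2) for all $2\le m\le n$ and all $a_1,\ldots,a_m,b_1,\ldots,b_{n-m}\in A$ with $\sum_i\mathbf{Z}a_i+\sum_j\mathbf{Z}b_j=A$, $$\langle a_1,\ldots,a_m,b_1,\ldots,b_{n-m}\rangle=\sum_{1\le i\le m}\langle a_1-a_i,\ldots,a_i,\ldots,a_m-a_i,b_1,\ldots,b_{n-m}\rangle,$$ with $a_i$ in the $i$-th place. $\mathcal{M}_n^-(G)$ is the quotient of $\mathcal{M}_n(G)$ by the further relation $\langle -a_1,a_2,\ldots,a_n\rangle=-\langle a_1,\ldots,a_n\rangle$; the class of a symbol there is written $\langle\cdot\rangle^-$. Multiplication (Kontsevich–Pestun–Tschinkel): for $n=n'+n''$ and an exact sequence of finite abelian groups $0\to G'\to G\to G''\to0$ with $G',G''$ nontrivial and dual sequence $0\to A''\to A\to A'\to0$, $\nabla:\mathcal{M}_{n'}(G')\otimes\mathcal{M}_{n''}(G'')\to\mathcal{M}_n(G)$ is the $\mathbf{Z}$-bilinear map $$\langle a_1,\ldots,a_{n'}\rangle\otimes\langle b_1,\ldots,b_{n''}\rangle\mapsto\sum\langle\tilde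 a_1,\ldots,\tilde a_{n'},\tilde b_1,\ldots,\tilde b_{n''}\rangle,$$ the sum being over all lifts $\tilde a_i\in A$ of the $a_i$, with $\tilde b_j$ the image of $b_j$ under $A''\to A$. Comultiplication (Kontsevich–Pestun–Tschinkel): for $n=n'+n''$ and such a sequence with $G''$ nontrivial, $\Delta:\mathcal{M}_n(G)\to\mathcal{M}_{n'}(G')\otimes\mathcal{M}^-_{n''}(G'')$ is $$\langle a_1,\ldots,a_n\rangle\mapsto\sum\langle a_{I'}\bmod A''\rangle\otimes\langle a_{I''}\rangle^-,$$ the sum being over $\{1,\ldots,n\}=I'\sqcup I''$ with $\#I'=n'$, $\#I''=n''$, such that all $a_j$, $j\in I''$, lie in $A''\hookrightarrow A$ (and $\langle a_{I''}\rangle$ is a symbol for $A''$). Here $a_{I}$ denotes the tuple $(a_i)_{i\in I}$. Write $G_N=\mathbf{Z}/N\mathbf{Z}$ and $A_N$ for its character group, identified with the $N$-th roots of unity, so $A_M\subset A_N$ for $M\mid N$. For $N=M\ell$, $\sigma_\ell:A_N\to A_M$ is $\zeta\mapsto\zeta^\ell$ (multiplication by $\ell$ additively), with kernel $A_\ell$; the exact sequences used are the $0\to A_\ell\to A_{M\ell}\xrightarrow{\sigma_\ell}A_M\to0$, and $\mathcal{M}_{n''}(\mathrm{Ker}(\sigma_\ell))$ means the module of symbols with entries generating $\mathrm{Ker}(\sigma_\ell)=A_\ell$, i.e. $\mathcal{M}_{n''}(G_\ell)$. $\mathcal{M}_n(\mathbf{Q}/\mathbf{Z})$ (resp. $\mathcal{M}_n(\mathbf{Q}/\mathbf{Z})^-$)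 is the $\mathbf{Z}$-module spanned by the $\mathcal{M}_n(G_N)$ (resp. $\mathcal{M}_n^-(G_N)$) for all $N$ (direct sum). For $\langle a\rangle=\langle a_1,\ldots,a_{n'}\rangle\in\mathcal{M}_{n'}(G_M)$ and $\langle b\rangle\in\mathcal{M}_{n''}(G_\ell)$, the notation $\langle\rho_\ell(a),b\rangle$ means $\sum\langle\tilde a_1,\ldots,\tilde a_{n'},b_1,\ldots,b_{n''}\rangle\in\mathcal{M}_{n'+n''}(G_{M\ell})$, the sum being over all tuples $(\tilde a_i)\in A_{M\ell}^{n'}$ with $\sigma_\ell(\tilde a_i)=a_i$, and $b_j\in A_\ell\subset A_{M\ell}$. Also $\langle\sigma_\ell(a_{I'})\rangle=\langle\sigma_\ell(a_i)\rangle_{i\in I'}\in\mathcal{M}_{n'}(G_{N/\ell})$. *)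

theory Defs
  imports "HOL-Algebra.Algebra" "HOL-Combinatorics.Permutations" Complex_Main
begin

section \<open>Character groups\<close>

text \<open>Abelian groups are HOL-Algebra groups and hence written multiplicatively: the additive
  expressions \<open>a - b\<close>, \<open>-a\<close>, \<open>0\<close> and finite sums become
  \<open>a \<otimes> inv b\<close>, \<open>inv a\<close>, \<open>\<one>\<close> and \<^const>\<open>finprod\<close>.\<close>

definition Cstar :: "complex monoid" where
  "Cstar = \<lparr>carrier = - {0}, monoid.mult = (*), one = 1\<rparr>"

definition character_group :: "('a, 'r) monoid_scheme \<Rightarrow> ('a \<Rightarrow> complex) monoid" where
  "character_group G =
     \<lparr>carrier = hom G Cstar \<inter> extensional (carrier G),
      monoid.mult = (\<lambda>\<chi> \<psi>. \<lambda>g\<in>carrier G. \<chi> g * \<psi> g),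
      one = (\<lambda>g\<in>carrier G. 1)\<rparr>"

text \<open>\<open>root_group N\<close> is \<open>A\<^sub>N\<close>, the character group of \<open>\<int>/N\<int>\<close> identified with the \<open>N\<close>-th
  roots of unity; with this identification \<open>A\<^sub>M \<subseteq> A\<^sub>N\<close> for \<open>M dvd N\<close>.\<close>

definition root_group :: "nat \<Rightarrow> complex monoid" where
  "root_group N = \<lparr>carrier = {z. z ^ N = 1}, monoid.mult = (*), one = 1\<rparr>"

definition sigma :: "nat \<Rightarrow> complex \<Rightarrow> complex" where
  "sigma l z = z ^ l"

lemma character_group_integer_mod_group:
  assumes "N > 0"
  shows "(\<lambda>\<chi>. \<chi> (1 mod int N)) \<in> iso (character_group (integer_mod_group N)) (root_group N)"
proof -
  let ?Z = "integer_mod_group N" and ?u = "1 mod int N"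
  let ?r = "\<lambda>\<chi> :: int \<Rightarrow> complex. \<chi> ?u"
  have carZ: "carrier ?Z = {0..<int N}"
    using assms by (simp add: carrier_integer_mod_group)
  have u: "?u \<in> carrier ?Z"
    using assms by (simp add: carZ)
  have car: "\<chi> \<in> carrier (character_group ?Z) \<longleftrightarrow>
      \<chi> \<in> extensional {0..<int N} \<and> (\<forall>x\<in>{0..<int N}. \<chi> x \<noteq> 0) \<and>
      (\<forall>x\<in>{0..<int N}. \<forall>y\<in>{0..<int N}. \<chi> ((x + y) mod int N) = \<chi> x * \<chi> y)" for \<chi>
    by (auto simp: character_group_def hom_def Cstar_def carZ Pi_iff)
  have pow: "\<chi> (int k mod int N) = ?r \<chi> ^ k" if \<chi>: "\<chi> \<in> carrier (character_group ?Z)" for \<chi> k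
  proof (induction k)
    case 0
    have "0 \<in> {0..<int N}" using assms by simp
    then have "\<chi> ((0 + 0) mod int N) = \<chi> 0 * \<chi> 0" "\<chi> 0 \<noteq> 0"
      using \<chi> unfolding car by blast+
    then show ?case by simp
  next
    case (Suc k)
    have "int (Suc k) mod int N = (int k mod int N + ?u) mod int N"
      by (metis add.commute mod_add_eq of_nat_Suc)
    moreover have "int k mod int N \<in> {0..<int N}" "?u \<in> {0..<int N}"
      using assms by simp_all
    ultimately show ?case using Suc \<chi> unfolding car by simp
  qed
  have hom: "?r \<in> hom (character_group ?Z) (root_group N)"
  proof (rule homI)
    fix \<chi> assume "\<chi> \<in> carrier (character_group ?Z)"
    from pow[OF this, of N] pow[OF this, of 0] show "?r \<chi> \<in> carrier (root_group N)"
      by (simp add: root_group_def)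
  next
    fix \<chi> \<psi>
    show "?r (\<chi> \<otimes>\<^bsub>character_group ?Z\<^esub> \<psi>) = ?r \<chi> \<otimes>\<^bsub>root_group N\<^esub> ?r \<psi>"
      using u by (simp add: character_group_def root_group_def)
  qed
  have "inj_on ?r (carrier (character_group ?Z))"
  proof (rule inj_onI)
    fix \<chi> \<psi>
    assume \<chi>: "\<chi> \<in> carrier (character_group ?Z)" and \<psi>: "\<psi> \<in> carrier (character_group ?Z)"
      and eq: "?r \<chi> = ?r \<psi>"
    show "\<chi> = \<psi>"
    proof (rule extensionalityI[of _ "{0..<int N}"])
      fix x assume "x \<in> {0..<int N}"
      then have "x = int (nat x) mod int N" by simp
      then show "\<chi> x = \<psi> x" using pow[OF \<chi>, of "nat x"] pow[OF \<psi>, of "nat x"] eq by metis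
    qed (use \<chi> \<psi> car in blast)+
  qed
  moreover have "?r ` carrier (character_group ?Z) = carrier (root_group N)"
  proof
    show "?r ` carrier (character_group ?Z) \<subseteq> carrier (root_group N)"
      using hom by (auto simp: hom_def)
    show "carrier (root_group N) \<subseteq> ?r ` carrier (character_group ?Z)"
    proof
      fix z assume "z \<in> carrier (root_group N)"
      then have z: "z ^ N = 1" by (simp add: root_group_def)
      then have z0: "z \<noteq> 0" using assms by (auto simp: power_0_left)
      have zmod: "z ^ (k mod N) = z ^ k" for k
      proof -
        have "z ^ k = z ^ (N * (k div N) + k mod N)" by simp
        also have "\<dots> = z ^ (k mod N)" by (simp only: power_add power_mult z power_one mult_1)
        finally show ?thesis by simp
      qed
      let ?c = "\<lambda>x\<in>{0..<int N}. z ^ nat x"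
      have "?c \<in> carrier (character_group ?Z)"
        unfolding car using assms z0
        by (auto simp: nat_mod_distrib nat_add_distrib zmod power_add)
      moreover have "?r ?c = z"
        using assms zmod[of 1] by (simp add: nat_mod_distrib)
      ultimately show "z \<in> ?r ` carrier (character_group ?Z)" by (metis imageI)
    qed
  qed
  ultimately show ?thesis
    using hom by (simp add: iso_def bij_betw_def)
qed

lemma short_exact_root_group:
  assumes "M > 0" "l > 0"
  shows "short_exact_sequence (root_group M) (root_group (M * l)) (root_group l) (sigma l) id"
proof -
  have grp: "group (root_group N)" if "N > 0" for N
  proof (rule groupI)
    fix x assume "x \<in> carrier (root_group N)"
    then have "x ^ N = 1" by (simp add: root_group_def)
    moreover from this have "x \<noteq> 0" using that by (auto simp: power_0_left)
    ultimately show "\<exists>y\<in>carrier (root_group N). y \<otimes>\<^bsub>root_group N\<^esub> x = \<one>\<^bsub>root_group N\<^esub>"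
      by (intro bexI[of _ "inverse x"]) (simp_all add: root_group_def power_inverse)
  qed (auto simp: root_group_def power_mult_distrib)
  have sig: "sigma l \<in> hom (root_group (M * l)) (root_group M)"
    by (rule homI)
      (auto simp: root_group_def sigma_def power_mult_distrib simp flip: power_mult, simp add: mult.commute)
  have inc: "id \<in> hom (root_group l) (root_group (M * l))"
    by (rule homI) (auto simp: root_group_def power_mult mult.commute[of M])
  have "sigma l ` carrier (root_group (M * l)) = carrier (root_group M)"
  proof
    show "sigma l ` carrier (root_group (M * l)) \<subseteq> carrier (root_group M)"
      using sig by (auto simp: hom_def)
    show "carrier (root_group M) \<subseteq> sigma l ` carrier (root_group (M * l))"
    proof
      fix z assume "z \<in> carrier (root_group M)"
      then have z: "z ^ M = 1" by (simp add: root_group_def)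
      define w where "w = rcis (root l (cmod z)) (Arg z / l)"
      have w: "w ^ l = z"
        using assms by (simp add: w_def DeMoivre2 rcis_cmod_Arg)
      moreover from this have "w ^ (M * l) = 1"
        using z by (simp add: mult.commute[of M] power_mult)
      ultimately show "z \<in> sigma l ` carrier (root_group (M * l))"
        by (auto simp: root_group_def sigma_def)
    qed
  qed
  moreover have "kernel (root_group (M * l)) (root_group M) (sigma l) = id ` carrier (root_group l)"
    by (auto simp: kernel_def root_group_def sigma_def power_mult mult.commute[of M])
  ultimately show ?thesis
    using sig inc grp assms
    by (auto simp: short_exact_sequence_iff group_hom_def group_hom_axioms_def epi_def mon_def)
qed


section \<open>Abelian groups by generators and relations\<close>

definition presented :: "'a set \<Rightarrow> ('a \<Rightarrow>\<^sub>0 int) set \<Rightarrow> ('a \<Rightarrow>\<^sub>0 int) set monoid" where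
  "presented S R = free_Abelian_group S Mod generate (free_Abelian_group S) R"

definition presented_gen :: "'a set \<Rightarrow> ('a \<Rightarrow>\<^sub>0 int) set \<Rightarrow> 'a \<Rightarrow> ('a \<Rightarrow>\<^sub>0 int) set" where
  "presented_gen S R x =
     generate (free_Abelian_group S) R #>\<^bsub>free_Abelian_group S\<^esub> frag_of x"

definition bilinear_rels ::
  "('a, 'r) monoid_scheme \<Rightarrow> ('b, 's) monoid_scheme \<Rightarrow> ('a \<times> 'b \<Rightarrow>\<^sub>0 int) set" where
  "bilinear_rels G H =
     {frag_of (x \<otimes>\<^bsub>G\<^esub> x', y) - frag_of (x, y) - frag_of (x', y) | x x' y.
        x \<in> carrier G \<and> x' \<in> carrier G \<and> y \<in> carrier H} \<union>
     {frag_of (x, y \<otimes>\<^bsub>H\<^esub> y') - frag_of (x, y) - frag_of (x, y') | x y y'.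
        x \<in> carrier G \<and> y \<in> carrier H \<and> y' \<in> carrier H}"

definition tensor ::
  "('a, 'r) monoid_scheme \<Rightarrow> ('b, 's) monoid_scheme \<Rightarrow> ('a \<times> 'b \<Rightarrow>\<^sub>0 int) set monoid" where
  "tensor G H = presented (carrier G \<times> carrier H) (bilinear_rels G H)"

definition tens ::
  "('a, 'r) monoid_scheme \<Rightarrow> ('b, 's) monoid_scheme \<Rightarrow> 'a \<Rightarrow> 'b \<Rightarrow> ('a \<times> 'b \<Rightarrow>\<^sub>0 int) set" where
  "tens G H x y = presented_gen (carrier G \<times> carrier H) (bilinear_rels G H) (x, y)"

text \<open>A homomorphism is made unique as a HOL function by requiring it to be \<^const>\<open>undefined\<close>
  outside the carrier of its domain.\<close>

definition ext_hom :: "('a, 'r) monoid_scheme \<Rightarrow> ('b, 's) monoid_scheme \<Rightarrow> ('a \<Rightarrow> 'b) set" where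
  "ext_hom G H = hom G H \<inter> extensional (carrier G)"

definition tensor_map where
  "tensor_map G H G' H' f g =
     (THE h. h \<in> ext_hom (tensor G H) (tensor G' H') \<and>
        (\<forall>x\<in>carrier G. \<forall>y\<in>carrier H. h (tens G H x y) = tens G' H' (f x) (g y)))"

definition sum_incl ::
  "'i set \<Rightarrow> ('i \<Rightarrow> ('a, 'r) monoid_scheme) \<Rightarrow> 'i \<Rightarrow> 'a \<Rightarrow> 'i \<Rightarrow> 'a" where
  "sum_incl I G i x = (\<lambda>j\<in>I. if j = i then x else \<one>\<^bsub>G j\<^esub>)"


section \<open>The modules of symbols\<close>

text \<open>\<open>\<M>\<^sub>n(G)\<close> and \<open>\<M>\<^sub>n\<^sup>-(G)\<close> depend on \<open>G\<close> only through its character group, which is the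
  argument \<open>A\<close> below.\<close>

definition symbols :: "nat \<Rightarrow> ('a, 'r) monoid_scheme \<Rightarrow> 'a list set" where
  "symbols n A =
     {as. length as = n \<and> set as \<subseteq> carrier A \<and> generate A (set as) = carrier A}"

definition perm_rels :: "nat \<Rightarrow> ('a, 'r) monoid_scheme \<Rightarrow> ('a list \<Rightarrow>\<^sub>0 int) set" where
  "perm_rels n A =
     {frag_of (permute_list p as) - frag_of as | p as. as \<in> symbols n A \<and> p permutes {..<n}}"

definition blowup_entries :: "('a, 'r) monoid_scheme \<Rightarrow> 'a list \<Rightarrow> nat \<Rightarrow> 'a list" where
  "blowup_entries A as i =
     map (\<lambda>j. if j = i then as ! i else as ! j \<otimes>\<^bsub>A\<^esub> inv\<^bsub>A\<^esub> (as ! i)) [0..<length as]"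

definition blowup_rels :: "nat \<Rightarrow> ('a, 'r) monoid_scheme \<Rightarrow> ('a list \<Rightarrow>\<^sub>0 int) set" where
  "blowup_rels n A =
     {frag_of (as @ bs) - (\<Sum>i<length as. frag_of (blowup_entries A as i @ bs)) | as bs.
        2 \<le> length as \<and> as @ bs \<in> symbols n A}"

definition anti_rels :: "nat \<Rightarrow> ('a, 'r) monoid_scheme \<Rightarrow> ('a list \<Rightarrow>\<^sub>0 int) set" where
  "anti_rels n A =
     {frag_of (inv\<^bsub>A\<^esub> a # as) + frag_of (a # as) | a as. a # as \<in> symbols n A}"

definition symbol_module :: "nat \<Rightarrow> ('a, 'r) monoid_scheme \<Rightarrow> ('a list \<Rightarrow>\<^sub>0 int) set monoid" where
  "symbol_module n A = presented (symbols n A) (perm_rels n A \<union> blowup_rels n A)"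

definition symbol :: "nat \<Rightarrow> ('a, 'r) monoid_scheme \<Rightarrow> 'a list \<Rightarrow> ('a list \<Rightarrow>\<^sub>0 int) set" where
  "symbol n A as = presented_gen (symbols n A) (perm_rels n A \<union> blowup_rels n A) as"

definition symbol_module_minus ::
  "nat \<Rightarrow> ('a, 'r) monoid_scheme \<Rightarrow> ('a list \<Rightarrow>\<^sub>0 int) set monoid" where
  "symbol_module_minus n A =
     presented (symbols n A) (perm_rels n A \<union> blowup_rels n A \<union> anti_rels n A)"

definition symbol_minus ::
  "nat \<Rightarrow> ('a, 'r) monoid_scheme \<Rightarrow> 'a list \<Rightarrow> ('a list \<Rightarrow>\<^sub>0 int) set" where
  "symbol_minus n A as =
     presented_gen (symbols n A) (perm_rels n A \<union> blowup_rels n A \<union> anti_rels n A) as"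


section \<open>Multiplication and comultiplication for finite groups\<close>

text \<open>Throughout, \<open>0 \<rightarrow> A'' \<rightarrow> A \<rightarrow> A' \<rightarrow> 0\<close> is the sequence of character groups dual to
  \<open>0 \<rightarrow> G' \<rightarrow> G \<rightarrow> G'' \<rightarrow> 0\<close>, with maps \<open>\<iota> : A'' \<rightarrow> A\<close> and \<open>\<pi> : A \<rightarrow> A'\<close>.\<close>

definition lifts :: "('a, 'r) monoid_scheme \<Rightarrow> ('a \<Rightarrow> 'b) \<Rightarrow> 'b list \<Rightarrow> 'a list set" where
  "lifts A \<pi> as = {cs. set cs \<subseteq> carrier A \<and> map \<pi> cs = as}"

definition nabla where
  "nabla n' n'' A'' A A' \<iota> \<pi> =
     (THE f. f \<in> ext_hom (tensor (symbol_module n' A') (symbol_module n'' A''))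
                        (symbol_module (n' + n'') A) \<and>
        (\<forall>as\<in>symbols n' A'. \<forall>bs\<in>symbols n'' A''.
           f (tens (symbol_module n' A') (symbol_module n'' A'')
                (symbol n' A' as) (symbol n'' A'' bs)) =
           (\<Otimes>\<^bsub>symbol_module (n' + n'') A\<^esub> cs\<in>lifts A \<pi> as.
              symbol (n' + n'') A (cs @ map \<iota> bs))))"

text \<open>Indices are \<open>0, \<dots>, n - 1\<close>, and \<open>a\<^sub>I\<close> is \<^term>\<open>nths a I\<close>.  The component \<open>bs\<close> of a splitting
  is \<open>a\<^sub>I\<^sub>'\<^sub>'\<close> regarded as a tuple in \<open>A''\<close>; as \<open>\<iota>\<close> is injective, it exists exactly when all entries
  of \<open>a\<^sub>I\<^sub>'\<^sub>'\<close> lie in \<open>A''\<close>, and then it is unique.\<close>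

definition splittings ::
  "nat \<Rightarrow> nat \<Rightarrow> ('b, 'r) monoid_scheme \<Rightarrow> ('b \<Rightarrow> 'a) \<Rightarrow> 'a list \<Rightarrow> (nat set \<times> nat set \<times> 'b list) set"
  where
  "splittings n' n'' A'' \<iota> as =
     {(I', I'', bs). I' \<union> I'' = {..<length as} \<and> I' \<inter> I'' = {} \<and> card I' = n' \<and> card I'' = n'' \<and>
        bs \<in> symbols n'' A'' \<and> map \<iota> bs = nths as I''}"

definition Delta where
  "Delta n' n'' A'' A A' \<iota> \<pi> =
     (THE f. f \<in> ext_hom (symbol_module (n' + n'') A)
                        (tensor (symbol_module n' A') (symbol_module_minus n'' A'')) \<and>
        (\<forall>as\<in>symbols (n' + n'') A.
           f (symbol (n' + n'') A as) =
           finprod (tensor (symbol_module n' A') (symbol_module_minus n'' A''))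
             (\<lambda>(I', I'', bs). tens (symbol_module n' A') (symbol_module_minus n'' A'')
                (symbol n' A' (map \<pi> (nths as I'))) (symbol_minus n'' A'' bs))
             (splittings n' n'' A'' \<iota> as)))"


section \<open>The modules for \<open>\<rat>/\<int>\<close>\<close>

definition QZ_module :: "nat \<Rightarrow> (nat \<Rightarrow> (complex list \<Rightarrow>\<^sub>0 int) set) monoid" where
  "QZ_module n = sum_group {0<..} (\<lambda>N. symbol_module n (root_group N))"

definition QZ_module_minus :: "nat \<Rightarrow> (nat \<Rightarrow> (complex list \<Rightarrow>\<^sub>0 int) set) monoid" where
  "QZ_module_minus n = sum_group {0<..} (\<lambda>N. symbol_module_minus n (root_group N))"

definition QZ_incl where
  "QZ_incl n N = sum_incl {0<..} (\<lambda>N. symbol_module n (root_group N)) N"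

definition QZ_incl_minus where
  "QZ_incl_minus n N = sum_incl {0<..} (\<lambda>N. symbol_module_minus n (root_group N)) N"

definition degree_pairs :: "nat \<Rightarrow> (nat \<times> nat) set" where
  "degree_pairs n = {(n', n''). 1 \<le> n' \<and> 1 \<le> n'' \<and> n' + n'' = n}"

definition QZ_tensor where
  "QZ_tensor = (\<lambda>(n', n''). tensor (QZ_module n') (QZ_module_minus n''))"

definition QZ_tensor_sum where
  "QZ_tensor_sum n = sum_group (degree_pairs n) QZ_tensor"

definition induced_nabla where
  "induced_nabla n' n'' f \<longleftrightarrow>
     f \<in> ext_hom (tensor (QZ_module n') (QZ_module n'')) (QZ_module (n' + n'')) \<and>
     (\<forall>M>0. \<forall>l>0.
        \<forall>x\<in>carrier (symbol_module n' (root_group M)).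
        \<forall>y\<in>carrier (symbol_module n'' (root_group l)).
          f (tens (QZ_module n') (QZ_module n'') (QZ_incl n' M x) (QZ_incl n'' l y)) =
          QZ_incl (n' + n'') (M * l)
            (nabla n' n'' (root_group l) (root_group (M * l)) (root_group M) id (sigma l)
              (tens (symbol_module n' (root_group M)) (symbol_module n'' (root_group l)) x y)))"

definition induced_Delta where
  "induced_Delta n f \<longleftrightarrow>
     f \<in> ext_hom (QZ_module n) (QZ_tensor_sum n) \<and>
     (\<forall>N>0. \<forall>x\<in>carrier (symbol_module n (root_group N)). \<forall>(n', n'')\<in>degree_pairs n.
        f (QZ_incl n N x) (n', n'') =
        (\<Otimes>\<^bsub>QZ_tensor (n', n'')\<^esub> l\<in>{l. l dvd N}.
           tensor_map
             (symbol_module n' (root_group (N div l))) (symbol_module_minus n'' (root_group l))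
             (QZ_module n') (QZ_module_minus n'')
             (QZ_incl n' (N div l)) (QZ_incl_minus n'' l)
             (Delta n' n'' (root_group l) (root_group N) (root_group (N div l)) id (sigma l) x)))"

text \<open>\<open>\<langle>\<rho>\<^sub>l(a), b\<rangle>\<close> for \<open>\<langle>a\<rangle> \<in> \<M>\<^sub>n\<^sub>'(G\<^sub>M)\<close> and \<open>\<langle>b\<rangle> \<in> \<M>\<^sub>n\<^sub>'\<^sub>'(G\<^sub>l)\<close>.\<close>

definition rho_symbol where
  "rho_symbol n M l as bs =
     (\<Otimes>\<^bsub>symbol_module n (root_group (M * l))\<^esub> cs\<in>lifts (root_group (M * l)) (sigma l) as.
        symbol n (root_group (M * l)) (cs @ bs))"

definition QZ_splittings :: "nat \<Rightarrow> complex list \<Rightarrow> (nat \<times> nat set \<times> nat set) set" where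
  "QZ_splittings N as =
     {(l, I', I''). l dvd N \<and> I' \<union> I'' = {..<length as} \<and> I' \<inter> I'' = {} \<and> I' \<noteq> {} \<and> I'' \<noteq> {} \<and>
        nths as I'' \<in> symbols (card I'') (root_group l)}"

end

theory Submission
  imports Defs
begin

text \<open>Both operations are given by formulas on symbols, and symbols generate all the modules involved.
  So uniqueness is immediate, and the content of the theorem is that the formulas respect the
  relations between symbols; they then extend along the universal properties of presented groups,
  tensor products and direct sums.  A function on tuples that respects the relations of
  \<open>\<M>\<^sub>n\<close>, with values in any abelian group, is called a \<^emph>\<open>modular symbol\<close> below.  Additive notation
  is used in all comments, and the \<^emph>\<open>blow-up\<close> of a tuple \<open>a\<close> at \<open>i\<close> is the tuple
  \<open>(a\<^sub>1 - a\<^sub>i, \<dots>, a\<^sub>i, \<dots>, a\<^sub>m - a\<^sub>i)\<close>, so that the main relation says that a symbol is the sum of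
  its blow-ups.

  \<^emph>\<open>Multiplication.\<close>  The blow-ups at \<open>i\<close> of the lifts of \<open>a\<close> are exactly the lifts of the blow-up
  of \<open>a\<close> at \<open>i\<close> (\<open>lifts_blowup\<close>).  Hence the sum of \<open>\<langle>c, b\<rangle>\<close> over the lifts \<open>c\<close> of \<open>a\<close> inherits the
  blow-up relation in \<open>a\<close> from its summands; in \<open>b\<close> each summand satisfies it separately
  (\<open>modular_lift_sum_left\<close>, \<open>modular_lift_sum_right\<close>).

  \<^emph>\<open>Comultiplication.\<close>  Let \<open>J\<close> be the set of indices at which the tuple \<open>a\<close> is blown up.  The
  coproduct of the sum of the blow-ups is a sum over pairs \<open>(S, i)\<close>, where \<open>i \<in> J\<close> and \<open>S\<close> is the
  set of indices that go to the second factor.  A pair contributes only if the entries of the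
  blow-up at \<open>i\<close> that are indexed by \<open>S\<close> generate \<open>A''\<close>.  There are three kinds of such pairs.
  \<^item> If \<open>i \<in> S\<close>, then \<open>a\<^sub>i\<close> lies in \<open>A''\<close>, so blowing up does not change the first factor, and the
    second factors add up to \<open>\<langle>a\<^sub>S\<rangle>\<close> by the relation in \<open>\<M>\<^sup>-(A'')\<close> (\<open>split_terms_inside\<close>).
  \<^item> If \<open>S\<close> is disjoint from \<open>J\<close>, the second factor is unchanged and the first factors add up by the
    relation in \<open>\<M>(A')\<close> (\<open>split_terms_outside\<close>).
  \<^item> Otherwise \<open>i \<notin> S\<close> but \<open>S\<close> meets \<open>J\<close>.  Put \<open>C = S \<union> {i}\<close>.  The entries \<open>a\<^sub>j\<close> with
    \<open>j \<in> C \<inter> J\<close> differ by elements of \<open>A''\<close>, so for a given \<open>C\<close> the first factor is independent of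
    \<open>i\<close>.  Fix \<open>k \<in> C \<inter> J\<close> and let \<open>c\<^sub>j = a\<^sub>j - a\<^sub>k\<close>.  The second factor is \<open>\<langle>c\<rangle>\<close> for \<open>i = k\<close>, and for
    the other \<open>i\<close> it is the blow-up of \<open>c\<close> at \<open>i\<close> with its entry \<open>c\<^sub>i\<close> replaced by \<open>- c\<^sub>i\<close>, that is,
    minus that blow-up in \<open>\<M>\<^sup>-\<close>.  So these terms cancel (\<open>odd_symbol_cancellation\<close>,
    \<open>split_terms_cancel\<close>).

  The first two kinds together give the coproduct of \<open>\<langle>a\<rangle>\<close>.

  For \<open>\<rat>/\<int>\<close>, a bilinear map on a product of direct sums is the same as a family of bilinear maps
  on the products of summands, which yields the multiplication; the comultiplication on the summand
  \<open>\<M>\<^sub>n(G\<^sub>N)\<close> is the sum of the coproducts for the finitely many sequences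
  \<open>0 \<rightarrow> A\<^sub>l \<rightarrow> A\<^sub>N \<rightarrow> A\<^bsub>N/l\<^esub> \<rightarrow> 0\<close> with \<open>l\<close> a divisor of \<open>N\<close>.\<close>

section \<open>Finite products in commutative groups\<close>

lemma (in comm_monoid) finprod_swap:
  assumes "finite A" "finite B" "\<And>x y. x \<in> A \<Longrightarrow> y \<in> B \<Longrightarrow> g x y \<in> carrier G"
  shows "(\<Otimes>x\<in>A. \<Otimes>y\<in>B. g x y) = (\<Otimes>y\<in>B. \<Otimes>x\<in>A. g x y)"
  using assms
proof (induction A)
  case (insert a A)
  have "(\<Otimes>x\<in>insert a A. \<Otimes>y\<in>B. g x y) = (\<Otimes>y\<in>B. g a y) \<otimes> (\<Otimes>y\<in>B. \<Otimes>x\<in>A. g x y)"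
    using insert by (subst finprod_insert) (auto intro!: finprod_closed)
  also have "\<dots> = (\<Otimes>y\<in>B. g a y \<otimes> (\<Otimes>x\<in>A. g x y))"
    using insert by (subst finprod_multf) (auto intro!: finprod_closed)
  also have "\<dots> = (\<Otimes>y\<in>B. \<Otimes>x\<in>insert a A. g x y)"
    using insert by (intro finprod_cong') (auto intro!: finprod_closed)
  finally show ?case .
qed simp

lemma (in comm_monoid) finprod_bij:
  assumes "bij_betw h A B" "\<And>y. y \<in> B \<Longrightarrow> f y \<in> carrier G"
  shows "(\<Otimes>x\<in>A. f (h x)) = (\<Otimes>y\<in>B. f y)"
  using assms finprod_reindex[of f h A] by (auto simp: bij_betw_def)

lemma (in comm_monoid) finprod_Sigma:
  assumes "finite I" "\<And>i. i \<in> I \<Longrightarrow> finite (A i)"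
    "\<And>i x. i \<in> I \<Longrightarrow> x \<in> A i \<Longrightarrow> g i x \<in> carrier G"
  shows "(\<Otimes>p\<in>Sigma I A. g (fst p) (snd p)) = (\<Otimes>i\<in>I. \<Otimes>x\<in>A i. g i x)"
proof -
  have "(\<Otimes>p\<in>(\<Union>i\<in>I. Pair i ` A i). g (fst p) (snd p)) = (\<Otimes>i\<in>I. \<Otimes>p\<in>Pair i ` A i. g (fst p) (snd p))"
    using assms by (intro finprod_UN_disjoint) (auto simp: pairwise_def disjnt_def)
  also have "\<dots> = (\<Otimes>i\<in>I. \<Otimes>x\<in>A i. g i x)"
  proof (rule finprod_cong')
    show "(\<Otimes>p\<in>Pair i ` A i. g (fst p) (snd p)) = (\<Otimes>x\<in>A i. g i x)" if "i \<in> I" for i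
      using assms that by (subst finprod_reindex) (auto simp: inj_on_def)
  qed (use assms in \<open>auto intro!: finprod_closed\<close>)
  also have "(\<Union>i\<in>I. Pair i ` A i) = Sigma I A" by auto
  finally show ?thesis .
qed

lemma (in comm_group) diff_diff_eq_one_iff:
  assumes "u \<in> carrier G" "v \<in> carrier G" "w \<in> carrier G"
  shows "u \<otimes> inv v \<otimes> inv w = \<one> \<longleftrightarrow> u = v \<otimes> w"
proof -
  have "u \<otimes> inv v \<otimes> inv w = u \<otimes> inv (v \<otimes> w)"
    using assms by (simp add: inv_mult m_assoc)
  also have "\<dots> = \<one> \<longleftrightarrow> u = v \<otimes> w"
    using assms inv_solve_right'[of \<one> u "v \<otimes> w"] by auto
  finally show ?thesis .
qed

lemma hom_finprod:
  assumes "comm_group G" "comm_group H" "h \<in> hom G H" "\<And>x. x \<in> A \<Longrightarrow> f x \<in> carrier G"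
  shows "h (finprod G f A) = (\<Otimes>\<^bsub>H\<^esub>x\<in>A. h (f x))"
proof -
  interpret G: comm_group G by fact
  interpret H: comm_group H by fact
  interpret group_hom G H h
    using assms by (simp add: group_hom_def group_hom_axioms_def G.is_group H.is_group)
  show ?thesis using assms(4)
  proof (induction A rule: infinite_finite_induct)
    case (insert a A)
    then show ?case by (subst G.finprod_insert) (auto simp: Pi_iff)
  qed auto
qed

lemma finprod_hom_in_hom:
  assumes "comm_group H" "\<And>i. i \<in> A \<Longrightarrow> f i \<in> hom G H"
  shows "(\<lambda>x. \<Otimes>\<^bsub>H\<^esub>i\<in>A. f i x) \<in> hom G H"
proof -
  interpret H: comm_group H by fact
  show ?thesis
  proof (rule homI)
    fix x y assume "x \<in> carrier G" "y \<in> carrier G"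
    then have "(\<Otimes>\<^bsub>H\<^esub>i\<in>A. f i (x \<otimes>\<^bsub>G\<^esub> y)) = (\<Otimes>\<^bsub>H\<^esub>i\<in>A. f i x \<otimes>\<^bsub>H\<^esub> f i y)"
      using assms(2) by (intro H.finprod_cong') (auto simp: hom_def Pi_iff)
    also have "\<dots> = (\<Otimes>\<^bsub>H\<^esub>i\<in>A. f i x) \<otimes>\<^bsub>H\<^esub> (\<Otimes>\<^bsub>H\<^esub>i\<in>A. f i y)"
      using assms(2) \<open>x \<in> _\<close> \<open>y \<in> _\<close> by (intro H.finprod_multf) (auto simp: hom_def Pi_iff)
    finally show "(\<Otimes>\<^bsub>H\<^esub>i\<in>A. f i (x \<otimes>\<^bsub>G\<^esub> y)) =
      (\<Otimes>\<^bsub>H\<^esub>i\<in>A. f i x) \<otimes>\<^bsub>H\<^esub> (\<Otimes>\<^bsub>H\<^esub>i\<in>A. f i y)" .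
  qed (use assms(2) in \<open>auto simp: hom_def Pi_iff intro!: H.finprod_closed\<close>)
qed

section \<open>Generators and relations\<close>

lemma restrict_ext_hom:
  assumes "group G" "h \<in> hom G H"
  shows "restrict h (carrier G) \<in> ext_hom G H"
  using assms by (auto simp: ext_hom_def hom_def group.is_monoid monoid.m_closed)

lemma ext_homD: "h \<in> ext_hom G H \<Longrightarrow> h \<in> hom G H"
  by (simp add: ext_hom_def)

lemma ext_hom_eqI:
  assumes "f \<in> ext_hom G H" "g \<in> ext_hom G H" "\<And>x. x \<in> carrier G \<Longrightarrow> f x = g x"
  shows "f = g"
  using assms by (auto simp: ext_hom_def intro: extensionalityI)

lemma finprod_free_Abelian_group:
  assumes "\<And>x. x \<in> A \<Longrightarrow> f x \<in> carrier (free_Abelian_group S)"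
  shows "finprod (free_Abelian_group S) f A = sum f A"
proof -
  interpret comm_group "free_Abelian_group S" by (rule abelian_free_Abelian_group)
  show ?thesis using assms
  proof (induction A rule: infinite_finite_induct)
    case (insert a A)
    then show ?case by (subst finprod_insert) (auto simp: Pi_iff)
  qed auto
qed

lemma hom_free_Abelian_group_diff:
  assumes "group H" "k \<in> hom (free_Abelian_group S) H"
    "x \<in> carrier (free_Abelian_group S)" "y \<in> carrier (free_Abelian_group S)"
  shows "k (x - y) = k x \<otimes>\<^bsub>H\<^esub> inv\<^bsub>H\<^esub> (k y)"
proof -
  interpret group_hom "free_Abelian_group S" H k
    using assms by (simp add: group_hom_def group_hom_axioms_def)
  have "k (x - y) = k (x \<otimes>\<^bsub>free_Abelian_group S\<^esub> inv\<^bsub>free_Abelian_group S\<^esub> y)"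
    using assms by simp
  also have "\<dots> = k x \<otimes>\<^bsub>H\<^esub> inv\<^bsub>H\<^esub> (k y)"
    using assms by (simp only: hom_mult hom_inv G.inv_closed)
  finally show ?thesis .
qed

lemma hom_free_Abelian_group_sum:
  assumes "comm_group H" "k \<in> hom (free_Abelian_group S) H"
    "\<And>x. x \<in> A \<Longrightarrow> f x \<in> carrier (free_Abelian_group S)"
  shows "k (sum f A) = (\<Otimes>\<^bsub>H\<^esub>x\<in>A. k (f x))"
  using hom_finprod[OF abelian_free_Abelian_group assms(1,2), of A f] assms(3)
    finprod_free_Abelian_group[of A f S] by simp

text \<open>A relation is tested on every homomorphism \<open>k\<close> from the free group that extends \<open>\<phi>\<close>.  All
  such \<open>k\<close> agree on the free group, and one exists by its universal property; quantifying over them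
  avoids an explicit formula for the extension.\<close>

definition respects_relations ::
  "'a set \<Rightarrow> ('a \<Rightarrow>\<^sub>0 int) set \<Rightarrow> ('b, 'r) monoid_scheme \<Rightarrow> ('a \<Rightarrow> 'b) \<Rightarrow> bool" where
  "respects_relations S R H \<phi> \<longleftrightarrow> \<phi> \<in> S \<rightarrow> carrier H \<and>
     (\<forall>k\<in>hom (free_Abelian_group S) H. (\<forall>x\<in>S. k (frag_of x) = \<phi> x) \<longrightarrow> (\<forall>r\<in>R. k r = \<one>\<^bsub>H\<^esub>))"

locale presentation =
  fixes S :: "'a set" and R :: "('a \<Rightarrow>\<^sub>0 int) set"
  assumes relations: "R \<subseteq> carrier (free_Abelian_group S)"
begin

abbreviation "F \<equiv> free_Abelian_group S"
abbreviation "K \<equiv> generate F R"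
abbreviation "P \<equiv> presented S R"

sublocale F: comm_group F by (rule abelian_free_Abelian_group)

lemma subgroup_relations: "subgroup K F"
  using relations by (rule F.generate_is_subgroup)

sublocale K: normal K F
  using subgroup_relations F.normal_iff_subgroup by blast

sublocale P: comm_group P
  unfolding presented_def using subgroup_relations by (rule F.abelian_FactGroup)

lemma quotient_hom: "(\<lambda>c. K #>\<^bsub>F\<^esub> c) \<in> hom F P"
  unfolding presented_def by (rule K.r_coset_hom_Mod)

lemma presented_gen_closed: "x \<in> S \<Longrightarrow> presented_gen S R x \<in> carrier P"
  using hom_in_carrier[OF quotient_hom, of "frag_of x"] by (simp add: presented_gen_def)

lemma quotient_relation: "r \<in> R \<Longrightarrow> K #>\<^bsub>F\<^esub> r = \<one>\<^bsub>P\<^esub>"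
  by (simp add: presented_def K.rcos_const[OF F.is_group] generate.incl)

lemma presented_hom_eqI:
  assumes "group H" "f \<in> hom P H" "g \<in> hom P H"
    "\<And>x. x \<in> S \<Longrightarrow> f (presented_gen S R x) = g (presented_gen S R x)" "z \<in> carrier P"
  shows "f z = g z"
proof -
  obtain c where c: "c \<in> carrier F" "z = K #>\<^bsub>F\<^esub> c"
    using assms(5) by (auto simp: presented_def carrier_FactGroup)
  have homs: "(\<lambda>c. f (K #>\<^bsub>F\<^esub> c)) \<in> hom F H" "(\<lambda>c. g (K #>\<^bsub>F\<^esub> c)) \<in> hom F H"
    using hom_compose[OF quotient_hom assms(2)] hom_compose[OF quotient_hom assms(3)]
    by (simp_all add: comp_def)
  have "f (K #>\<^bsub>F\<^esub> c) = g (K #>\<^bsub>F\<^esub> c)"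
  proof (rule free_Abelian_group_induct[of c S])
    show "f (K #>\<^bsub>F\<^esub> 0) = g (K #>\<^bsub>F\<^esub> 0)"
      using hom_one[OF homs(1) F.is_group assms(1)] hom_one[OF homs(2) F.is_group assms(1)] by simp
  next
    fix x y assume "Poly_Mapping.keys x \<subseteq> S" "Poly_Mapping.keys y \<subseteq> S"
      "f (K #>\<^bsub>F\<^esub> x) = g (K #>\<^bsub>F\<^esub> x)" "f (K #>\<^bsub>F\<^esub> y) = g (K #>\<^bsub>F\<^esub> y)"
    then show "f (K #>\<^bsub>F\<^esub> (x - y)) = g (K #>\<^bsub>F\<^esub> (x - y))"
      using hom_free_Abelian_group_diff[OF assms(1) homs(1), of x y]
        hom_free_Abelian_group_diff[OF assms(1) homs(2), of x y] by simp
  qed (use c assms(4) in \<open>auto simp: presented_gen_def\<close>)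
  with c show ?thesis by simp
qed

lemma presented_universal:
  assumes "comm_group H" "respects_relations S R H \<phi>"
  obtains h where "h \<in> ext_hom P H" "\<And>x. x \<in> S \<Longrightarrow> h (presented_gen S R x) = \<phi> x"
proof -
  interpret H: comm_group H by fact
  obtain k where k: "k \<in> hom F H" "\<And>x. x \<in> S \<Longrightarrow> k (frag_of x) = \<phi> x"
    using H.free_Abelian_group_universal[of \<phi> S] assms(2)
    by (auto simp: respects_relations_def image_subset_iff_funcset)
  interpret k: group_hom F H k
    using k by (simp add: group_hom_def group_hom_axioms_def H.is_group)
  have R: "R \<subseteq> kernel F H k"
    using k assms(2) relations unfolding respects_relations_def kernel_def by blast
  have ker: "k c = \<one>\<^bsub>H\<^esub>" if "c \<in> K" for c
    using F.generate_subgroup_incl[OF R k.subgroup_kernel] that by (auto simp: kernel_def)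
  have "k x = k y" if "x \<in> carrier F" "y \<in> carrier F" "K #>\<^bsub>F\<^esub> x = K #>\<^bsub>F\<^esub> y" for x y
  proof -
    have "x \<in> K #>\<^bsub>F\<^esub> y"
      using that F.rcos_self[OF _ subgroup_relations, of x] by simp
    then obtain c where "c \<in> K" "x = c \<otimes>\<^bsub>F\<^esub> y"
      by (auto simp: r_coset_def)
    then show ?thesis
      using ker that by (metis H.l_one K.mem_carrier k.hom_closed k.hom_mult)
  qed
  then obtain h where h: "h \<in> hom P H" "\<And>c. c \<in> carrier F \<Longrightarrow> h (K #>\<^bsub>F\<^esub> c) = k c"
    using FactGroup_universal[OF k(1) K.normal_axioms] unfolding presented_def by metis
  show ?thesis
  proof
    show "restrict h (carrier P) \<in> ext_hom P H"
      using h(1) by (rule restrict_ext_hom[OF P.is_group])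
    show "restrict h (carrier P) (presented_gen S R x) = \<phi> x" if "x \<in> S" for x
      using that h(2)[of "frag_of x"] k(2) presented_gen_closed[OF that]
      by (simp add: presented_gen_def)
  qed
qed

end

section \<open>Tensor products and bilinear maps\<close>

definition bilinear_map ::
  "('a, 'r) monoid_scheme \<Rightarrow> ('b, 's) monoid_scheme \<Rightarrow> ('c, 't) monoid_scheme \<Rightarrow> ('a \<Rightarrow> 'b \<Rightarrow> 'c) \<Rightarrow> bool"
  where
  "bilinear_map G H L \<beta> \<longleftrightarrow>
     (\<forall>y\<in>carrier H. (\<lambda>x. \<beta> x y) \<in> hom G L) \<and> (\<forall>x\<in>carrier G. \<beta> x \<in> hom H L)"

lemma bilinear_map_closed:
  "bilinear_map G H L \<beta> \<Longrightarrow> x \<in> carrier G \<Longrightarrow> y \<in> carrier H \<Longrightarrow> \<beta> x y \<in> carrier L"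
  by (auto simp: bilinear_map_def hom_def)

lemma bilinear_map_finprod_left:
  assumes "comm_group G" "comm_group L" "bilinear_map G H L \<beta>"
    "\<And>i. i \<in> A \<Longrightarrow> f i \<in> carrier G" "y \<in> carrier H"
  shows "\<beta> (finprod G f A) y = (\<Otimes>\<^bsub>L\<^esub>i\<in>A. \<beta> (f i) y)"
  using hom_finprod[of G L "\<lambda>x. \<beta> x y" A f] assms by (auto simp: bilinear_map_def)

lemma bilinear_map_finprod_right:
  assumes "comm_group H" "comm_group L" "bilinear_map G H L \<beta>"
    "\<And>i. i \<in> A \<Longrightarrow> f i \<in> carrier H" "x \<in> carrier G"
  shows "\<beta> x (finprod H f A) = (\<Otimes>\<^bsub>L\<^esub>i\<in>A. \<beta> x (f i))"
  using hom_finprod[of H L "\<beta> x" A f] assms by (auto simp: bilinear_map_def)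

lemma bilinear_map_comp:
  assumes "bilinear_map G H L \<beta>" "f \<in> hom G' G" "g \<in> hom H' H"
  shows "bilinear_map G' H' L (\<lambda>x y. \<beta> (f x) (g y))"
  unfolding bilinear_map_def
proof (intro conjI ballI)
  fix y assume "y \<in> carrier H'"
  then have "(\<lambda>x. \<beta> x (g y)) \<in> hom G L"
    using assms by (auto simp: bilinear_map_def hom_in_carrier)
  from hom_compose[OF assms(2) this] show "(\<lambda>x. \<beta> (f x) (g y)) \<in> hom G' L"
    by (simp add: comp_def)
next
  fix x assume "x \<in> carrier G'"
  then have "\<beta> (f x) \<in> hom H L"
    using assms by (auto simp: bilinear_map_def hom_in_carrier)
  from hom_compose[OF assms(3) this] show "(\<lambda>y. \<beta> (f x) (g y)) \<in> hom H' L"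
    by (simp add: comp_def)
qed

lemma hom_bilinear_map:
  assumes "bilinear_map G H L \<beta>" "h \<in> hom L L'"
  shows "bilinear_map G H L' (\<lambda>x y. h (\<beta> x y))"
  unfolding bilinear_map_def
proof (intro conjI ballI)
  fix y assume "y \<in> carrier H"
  then have "(\<lambda>x. \<beta> x y) \<in> hom G L" using assms(1) by (simp add: bilinear_map_def)
  from hom_compose[OF this assms(2)] show "(\<lambda>x. h (\<beta> x y)) \<in> hom G L'"
    by (simp add: comp_def)
next
  fix x assume "x \<in> carrier G"
  then have "\<beta> x \<in> hom H L" using assms(1) by (simp add: bilinear_map_def)
  from hom_compose[OF this assms(2)] show "(\<lambda>y. h (\<beta> x y)) \<in> hom H L'"
    by (simp add: comp_def)
qed

locale tensor_product = G: comm_group G + H: comm_group H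
  for G :: "('a, 'r) monoid_scheme" and H :: "('b, 's) monoid_scheme"
begin

sublocale presentation "carrier G \<times> carrier H" "bilinear_rels G H"
proof
  show "bilinear_rels G H \<subseteq> carrier (free_Abelian_group (carrier G \<times> carrier H))"
    unfolding bilinear_rels_def
    by (auto dest!: subsetD[OF keys_diff])
qed

lemma tensor_eq: "tensor G H = P"
  by (simp add: tensor_def)

sublocale T: comm_group "tensor G H"
  unfolding tensor_eq by (rule P.comm_group_axioms)

lemma tens_closed: "x \<in> carrier G \<Longrightarrow> y \<in> carrier H \<Longrightarrow> tens G H x y \<in> carrier (tensor G H)"
  unfolding tensor_def tens_def by (rule presented_gen_closed) simp

lemma quotient_relation_3:
  assumes "frag_of u - frag_of v - frag_of w \<in> bilinear_rels G H"
    "u \<in> carrier G \<times> carrier H" "v \<in> carrier G \<times> carrier H" "w \<in> carrier G \<times> carrier H"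
  shows "presented_gen (carrier G \<times> carrier H) (bilinear_rels G H) u =
    presented_gen (carrier G \<times> carrier H) (bilinear_rels G H) v \<otimes>\<^bsub>P\<^esub>
    presented_gen (carrier G \<times> carrier H) (bilinear_rels G H) w"
proof -
  have mem: "frag_of u \<in> carrier F" "frag_of v \<in> carrier F" "frag_of w \<in> carrier F"
      "frag_of u - frag_of v \<in> carrier F"
    using assms(2-4) by (auto dest!: subsetD[OF keys_diff])
  have "(K #>\<^bsub>F\<^esub> frag_of u) \<otimes>\<^bsub>P\<^esub> inv\<^bsub>P\<^esub> (K #>\<^bsub>F\<^esub> frag_of v) \<otimes>\<^bsub>P\<^esub> inv\<^bsub>P\<^esub> (K #>\<^bsub>F\<^esub> frag_of w)
      = K #>\<^bsub>F\<^esub> (frag_of u - frag_of v - frag_of w)"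
    using hom_free_Abelian_group_diff[OF P.is_group quotient_hom mem(4,3)]
      hom_free_Abelian_group_diff[OF P.is_group quotient_hom mem(1,2)] by simp
  also have "\<dots> = \<one>\<^bsub>P\<^esub>"
    by (rule quotient_relation) fact
  finally have "(K #>\<^bsub>F\<^esub> frag_of u) \<otimes>\<^bsub>P\<^esub> inv\<^bsub>P\<^esub> (K #>\<^bsub>F\<^esub> frag_of v) \<otimes>\<^bsub>P\<^esub> inv\<^bsub>P\<^esub> (K #>\<^bsub>F\<^esub> frag_of w)
    = \<one>\<^bsub>P\<^esub>" .
  moreover have cl: "K #>\<^bsub>F\<^esub> frag_of u \<in> carrier P" "K #>\<^bsub>F\<^esub> frag_of v \<in> carrier P" "K #>\<^bsub>F\<^esub> frag_of w \<in> carrier P"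
    using mem hom_in_carrier[OF quotient_hom] by blast+
  ultimately show ?thesis
    using P.diff_diff_eq_one_iff[OF cl] by (simp add: presented_gen_def)
qed

lemma tens_bilinear: "bilinear_map G H (tensor G H) (tens G H)"
  unfolding bilinear_map_def
proof (intro conjI ballI homI)
  fix x x' y assume xy: "x \<in> carrier G" "x' \<in> carrier G" "y \<in> carrier H"
  then have "frag_of (x \<otimes>\<^bsub>G\<^esub> x', y) - frag_of (x, y) - frag_of (x', y) \<in> bilinear_rels G H"
    by (auto simp: bilinear_rels_def)
  from quotient_relation_3[OF this] xy
  show "tens G H (x \<otimes>\<^bsub>G\<^esub> x') y = tens G H x y \<otimes>\<^bsub>tensor G H\<^esub> tens G H x' y"
    by (simp add: tens_def tensor_def)
next
  fix x y y' assume xy: "x \<in> carrier G" "y \<in> carrier H" "y' \<in> carrier H"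
  then have "frag_of (x, y \<otimes>\<^bsub>H\<^esub> y') - frag_of (x, y) - frag_of (x, y') \<in> bilinear_rels G H"
    by (auto simp: bilinear_rels_def)
  from quotient_relation_3[OF this] xy
  show "tens G H x (y \<otimes>\<^bsub>H\<^esub> y') = tens G H x y \<otimes>\<^bsub>tensor G H\<^esub> tens G H x y'"
    by (simp add: tens_def tensor_def)
qed (simp_all add: tens_closed)

lemma tensor_hom_eqI:
  assumes "group L" "f \<in> hom (tensor G H) L" "g \<in> hom (tensor G H) L"
    "\<And>x y. x \<in> carrier G \<Longrightarrow> y \<in> carrier H \<Longrightarrow> f (tens G H x y) = g (tens G H x y)"
    "z \<in> carrier (tensor G H)"
  shows "f z = g z"
  using presented_hom_eqI[of L f g z] assms by (auto simp: tensor_def tens_def)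

lemma tensor_universal:
  assumes "comm_group L" "bilinear_map G H L \<beta>"
  shows "\<exists>h\<in>ext_hom (tensor G H) L. \<forall>x\<in>carrier G. \<forall>y\<in>carrier H. h (tens G H x y) = \<beta> x y"
proof -
  interpret L: comm_group L by fact
  have "respects_relations (carrier G \<times> carrier H) (bilinear_rels G H) L (\<lambda>(x, y). \<beta> x y)"
    unfolding respects_relations_def
  proof (intro conjI ballI impI)
    show "(\<lambda>(x, y). \<beta> x y) \<in> carrier G \<times> carrier H \<rightarrow> carrier L"
      using bilinear_map_closed[OF assms(2)] by auto
    fix k r assume k: "k \<in> hom F L" "\<forall>x\<in>carrier G \<times> carrier H. k (frag_of x) = (case x of (x, y) \<Rightarrow> \<beta> x y)"
      and "r \<in> bilinear_rels G H"
    then obtain u v w where r: "r = frag_of u - frag_of v - frag_of w"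
      "u \<in> carrier G \<times> carrier H" "v \<in> carrier G \<times> carrier H" "w \<in> carrier G \<times> carrier H"
      "case_prod \<beta> u = case_prod \<beta> v \<otimes>\<^bsub>L\<^esub> case_prod \<beta> w"
    proof -
      from \<open>r \<in> _\<close> consider
          x x' y where "r = frag_of (x \<otimes>\<^bsub>G\<^esub> x', y) - frag_of (x, y) - frag_of (x', y)"
            "x \<in> carrier G" "x' \<in> carrier G" "y \<in> carrier H"
        | x y y' where "r = frag_of (x, y \<otimes>\<^bsub>H\<^esub> y') - frag_of (x, y) - frag_of (x, y')"
            "x \<in> carrier G" "y \<in> carrier H" "y' \<in> carrier H"
        unfolding bilinear_rels_def by blast
      then show thesis
      proof cases
        case 1
        with assms(2) show thesis
          by (intro that[of "(x \<otimes>\<^bsub>G\<^esub> x', y)" "(x, y)" "(x', y)"]) (auto simp: bilinear_map_def hom_def)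
      next
        case 2
        with assms(2) show thesis
          by (intro that[of "(x, y \<otimes>\<^bsub>H\<^esub> y')" "(x, y)" "(x, y')"]) (auto simp: bilinear_map_def hom_def)
      qed
    qed
    have mem: "frag_of u \<in> carrier F" "frag_of v \<in> carrier F" "frag_of w \<in> carrier F"
        "frag_of u - frag_of v \<in> carrier F"
      using r by (auto dest!: subsetD[OF keys_diff])
    have "k r = k (frag_of u) \<otimes>\<^bsub>L\<^esub> inv\<^bsub>L\<^esub> k (frag_of v) \<otimes>\<^bsub>L\<^esub> inv\<^bsub>L\<^esub> k (frag_of w)"
      unfolding r(1) using hom_free_Abelian_group_diff[OF L.is_group k(1) mem(4,3)]
        hom_free_Abelian_group_diff[OF L.is_group k(1) mem(1,2)] by simp
    moreover have "k (frag_of u) = k (frag_of v) \<otimes>\<^bsub>L\<^esub> k (frag_of w)"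
      using k(2) r by auto
    moreover have "k (frag_of u) \<in> carrier L" "k (frag_of v) \<in> carrier L" "k (frag_of w) \<in> carrier L"
      using mem hom_in_carrier[OF k(1)] by blast+
    ultimately show "k r = \<one>\<^bsub>L\<^esub>"
      using L.diff_diff_eq_one_iff by metis
  qed
  from presented_universal[OF assms(1) this] obtain h where
    "h \<in> ext_hom P L" "\<And>x. x \<in> carrier G \<times> carrier H \<Longrightarrow>
        h (presented_gen (carrier G \<times> carrier H) (bilinear_rels G H) x) = (\<lambda>(x, y). \<beta> x y) x"
    by blast
  then show ?thesis
    by (auto simp: tensor_def tens_def)
qed

end

lemma tensor_map_props:
  assumes "comm_group G" "comm_group H" "comm_group G'" "comm_group H'" "f \<in> hom G G'" "g \<in> hom H H'"
  shows "tensor_map G H G' H' f g \<in> hom (tensor G H) (tensor G' H')"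
    and "x \<in> carrier G \<Longrightarrow> y \<in> carrier H \<Longrightarrow>
      tensor_map G H G' H' f g (tens G H x y) = tens G' H' (f x) (g y)"
proof -
  interpret A: tensor_product G H by (intro tensor_product.intro assms)
  interpret B: tensor_product G' H' by (intro tensor_product.intro assms)
  have bil: "bilinear_map G H (tensor G' H') (\<lambda>x y. tens G' H' (f x) (g y))"
    using B.tens_bilinear assms(5,6) by (rule bilinear_map_comp)
  obtain h where h: "h \<in> ext_hom (tensor G H) (tensor G' H')"
    and h_tens: "\<forall>x\<in>carrier G. \<forall>y\<in>carrier H. h (tens G H x y) = tens G' H' (f x) (g y)"
    by (rule bexE[OF A.tensor_universal[OF B.T.comm_group_axioms bil]])
  have "tensor_map G H G' H' f g = h"
    unfolding tensor_map_def
  proof (rule the_equality)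
    fix h' assume h': "h' \<in> ext_hom (tensor G H) (tensor G' H') \<and>
      (\<forall>x\<in>carrier G. \<forall>y\<in>carrier H. h' (tens G H x y) = tens G' H' (f x) (g y))"
    show "h' = h"
    proof (rule ext_hom_eqI)
      show "h' z = h z" if "z \<in> carrier (tensor G H)" for z
        using h h' h_tens that by (intro A.tensor_hom_eqI[OF B.T.is_group, of h' h z]) (simp_all add: ext_homD)
    qed (use h h' in simp_all)
  qed (use h h_tens in simp)
  then show "tensor_map G H G' H' f g \<in> hom (tensor G H) (tensor G' H')"
    "x \<in> carrier G \<Longrightarrow> y \<in> carrier H \<Longrightarrow>
      tensor_map G H G' H' f g (tens G H x y) = tens G' H' (f x) (g y)"
    using h h_tens by (simp_all add: ext_homD)
qed

text \<open>The extension is made in one variable at a time.  Extending in the first variable gives a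
  homomorphism \<open>h t\<close> for each generator \<open>t\<close> of the second group.  To extend \<open>t \<mapsto> h t x\<close> for a given
  \<open>x\<close>, its value at each relation must vanish; this value depends additively on \<open>x\<close> and vanishes for
  generators \<open>x\<close>, hence for all \<open>x\<close>.\<close>

lemma presentation_bilinear_universal:
  assumes "presentation S R" "presentation S' R'" "comm_group L"
    "\<And>t. t \<in> S' \<Longrightarrow> respects_relations S R L (\<lambda>s. \<phi> s t)"
    "\<And>s. s \<in> S \<Longrightarrow> respects_relations S' R' L (\<phi> s)"
  shows "\<exists>\<beta>. bilinear_map (presented S R) (presented S' R') L \<beta> \<and>
    (\<forall>s\<in>S. \<forall>t\<in>S'. \<beta> (presented_gen S R s) (presented_gen S' R' t) = \<phi> s t)"
proof -
  interpret L: comm_group L by fact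
  interpret A: presentation S R by fact
  interpret B: presentation S' R' by fact
  have "\<forall>t\<in>S'. \<exists>h. h \<in> hom A.P L \<and> (\<forall>s\<in>S. h (presented_gen S R s) = \<phi> s t)"
    using A.presented_universal[OF assms(3) assms(4)] by (metis ext_homD)
  then obtain h where h: "\<And>t. t \<in> S' \<Longrightarrow> h t \<in> hom A.P L"
      "\<And>s t. s \<in> S \<Longrightarrow> t \<in> S' \<Longrightarrow> h t (presented_gen S R s) = \<phi> s t"
    by metis
  have respects: "respects_relations S' R' L (\<lambda>t. h t x)" if x: "x \<in> carrier A.P" for x
    unfolding respects_relations_def
  proof (intro conjI ballI impI)
    show "(\<lambda>t. h t x) \<in> S' \<rightarrow> carrier L"
      using h(1) x by (auto simp: hom_def)
    fix k r assume k: "k \<in> hom B.F L" "\<forall>t\<in>S'. k (frag_of t) = h t x" and r: "r \<in> R'"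
    \<comment> \<open>The value at a relation \<open>r\<close> is additive in \<open>x\<close>, so it suffices to know it on generators.\<close>
    define e where "e = (\<lambda>x. \<Otimes>\<^bsub>L\<^esub>t\<in>Poly_Mapping.keys r. h t x [^]\<^bsub>L\<^esub> Poly_Mapping.lookup r t)"
    have keys: "Poly_Mapping.keys r \<subseteq> S'"
      using subsetD[OF B.relations r] by simp
    have k_r: "k' r = (\<Otimes>\<^bsub>L\<^esub>t\<in>Poly_Mapping.keys r. k' (frag_of t) [^]\<^bsub>L\<^esub> Poly_Mapping.lookup r t)"
      if "k' \<in> hom B.F L" for k'
    proof -
      interpret k': group_hom B.F L k'
        using that by (simp add: group_hom_def group_hom_axioms_def L.is_group)
      have "k' r = k' (\<Sum>t\<in>Poly_Mapping.keys r. frag_cmul (Poly_Mapping.lookup r t) (frag_of t))"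
        using frag_expansion[of r] by (simp add: frag_extend_def)
      also have "\<dots> = (\<Otimes>\<^bsub>L\<^esub>t\<in>Poly_Mapping.keys r. k' (frag_cmul (Poly_Mapping.lookup r t) (frag_of t)))"
        using keys by (intro hom_free_Abelian_group_sum[OF assms(3) that])
          (auto dest!: subsetD[OF keys_cmul])
      also have "\<dots> = (\<Otimes>\<^bsub>L\<^esub>t\<in>Poly_Mapping.keys r. k' (frag_of t) [^]\<^bsub>L\<^esub> Poly_Mapping.lookup r t)"
      proof (rule L.finprod_cong')
        fix t assume "t \<in> Poly_Mapping.keys r"
        then have t: "frag_of t \<in> carrier B.F" using keys by auto
        then show "k' (frag_cmul (Poly_Mapping.lookup r t) (frag_of t)) =
            k' (frag_of t) [^]\<^bsub>L\<^esub> Poly_Mapping.lookup r t"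
          using k'.hom_int_pow[OF t, of "Poly_Mapping.lookup r t"] by simp
      qed (use keys in \<open>auto intro!: L.int_pow_closed k'.hom_closed\<close>)
      finally show ?thesis .
    qed
    have e_hom: "e \<in> hom A.P L"
      unfolding e_def
    proof (rule finprod_hom_in_hom[OF assms(3)])
      fix t assume "t \<in> Poly_Mapping.keys r"
      then interpret ht: group_hom A.P L "h t"
        using h(1) keys by (auto simp: group_hom_def group_hom_axioms_def L.is_group A.P.is_group)
      show "(\<lambda>x. h t x [^]\<^bsub>L\<^esub> Poly_Mapping.lookup r t) \<in> hom A.P L"
        by (rule homI) (simp_all add: L.int_pow_distrib)
    qed
    have "e x = \<one>\<^bsub>L\<^esub>"
    proof (rule A.presented_hom_eqI[OF L.is_group e_hom _ _ x])
      show "(\<lambda>_. \<one>\<^bsub>L\<^esub>) \<in> hom A.P L"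
        by (simp add: hom_def)
      fix s assume s: "s \<in> S"
      obtain k' where k': "k' \<in> hom B.F L" "\<And>t. t \<in> S' \<Longrightarrow> k' (frag_of t) = \<phi> s t"
        using L.free_Abelian_group_universal[of "\<phi> s" S'] assms(5)[OF s]
        by (auto simp: respects_relations_def image_subset_iff_funcset)
      have "e (presented_gen S R s) = k' r"
        unfolding e_def k_r[OF k'(1)] using keys k' s h(2) hom_in_carrier[OF k'(1)]
        by (intro L.finprod_cong') (auto intro!: L.int_pow_closed simp del: k'(2) simp flip: k'(2))
      also have "\<dots> = \<one>\<^bsub>L\<^esub>"
        using assms(5)[OF s] k' r by (auto simp: respects_relations_def)
      finally show "e (presented_gen S R s) = \<one>\<^bsub>L\<^esub>" .
    qed
    moreover have "k r = e x"
      unfolding e_def k_r[OF k(1)] using keys k(2) h(1) x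
      by (intro L.finprod_cong') (auto intro!: L.int_pow_closed simp: hom_def)
    ultimately show "k r = \<one>\<^bsub>L\<^esub>" by simp
  qed
  have "\<forall>x\<in>carrier A.P. \<exists>g. g \<in> hom B.P L \<and> (\<forall>t\<in>S'. g (presented_gen S' R' t) = h t x)"
    using B.presented_universal[OF assms(3) respects] by (metis ext_homD)
  then obtain \<beta> where \<beta>: "\<And>x. x \<in> carrier A.P \<Longrightarrow> \<beta> x \<in> hom B.P L"
      "\<And>x t. x \<in> carrier A.P \<Longrightarrow> t \<in> S' \<Longrightarrow> \<beta> x (presented_gen S' R' t) = h t x"
    by metis
  have "bilinear_map A.P B.P L \<beta>"
    unfolding bilinear_map_def
  proof (intro conjI ballI)
    fix y assume y: "y \<in> carrier B.P"
    show "(\<lambda>x. \<beta> x y) \<in> hom A.P L"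
    proof (rule homI)
      show "\<beta> x y \<in> carrier L" if "x \<in> carrier A.P" for x
        using \<beta>(1)[OF that] y by (rule hom_in_carrier)
      fix x x' assume xy: "x \<in> carrier A.P" "x' \<in> carrier A.P"
      show "\<beta> (x \<otimes>\<^bsub>A.P\<^esub> x') y = \<beta> x y \<otimes>\<^bsub>L\<^esub> \<beta> x' y"
      proof (rule B.presented_hom_eqI[OF L.is_group _ _ _ y])
        show "(\<lambda>y. \<beta> x y \<otimes>\<^bsub>L\<^esub> \<beta> x' y) \<in> hom B.P L"
          using xy \<beta>(1) by (intro L.hom_group_mult) auto
        show "\<beta> (x \<otimes>\<^bsub>A.P\<^esub> x') \<in> hom B.P L"
          using xy \<beta>(1) A.P.m_closed by blast
        fix t assume "t \<in> S'"
        then show "\<beta> (x \<otimes>\<^bsub>A.P\<^esub> x') (presented_gen S' R' t) =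
            \<beta> x (presented_gen S' R' t) \<otimes>\<^bsub>L\<^esub> \<beta> x' (presented_gen S' R' t)"
          using xy \<beta>(2) hom_mult[OF h(1)] A.P.m_closed by metis
      qed
    qed
  qed (rule \<beta>(1))
  moreover have "\<forall>s\<in>S. \<forall>t\<in>S'. \<beta> (presented_gen S R s) (presented_gen S' R' t) = \<phi> s t"
    using \<beta>(2) h(2) A.presented_gen_closed by simp
  ultimately show ?thesis by blast
qed

section \<open>Direct sums\<close>

locale direct_sum =
  fixes I :: "'i set" and G :: "'i \<Rightarrow> ('a, 'r) monoid_scheme"
  assumes comm_group_summand: "i \<in> I \<Longrightarrow> comm_group (G i)"
begin

lemma group_summand: "i \<in> I \<Longrightarrow> group (G i)"
  using comm_group_summand comm_group.axioms(2) by blast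

lemma carrier_iff: "x \<in> carrier (sum_group I G) \<longleftrightarrow>
    x \<in> (\<Pi>\<^sub>E i\<in>I. carrier (G i)) \<and> finite {i \<in> I. x i \<noteq> \<one>\<^bsub>G i\<^esub>}"
  using carrier_sum_group[of I G] group_summand by auto

sublocale comm_group "sum_group I G"
proof (rule group.group_comm_groupI)
  fix x y assume "x \<in> carrier (sum_group I G)" "y \<in> carrier (sum_group I G)"
  then show "x \<otimes>\<^bsub>sum_group I G\<^esub> y = y \<otimes>\<^bsub>sum_group I G\<^esub> x"
    using comm_group_summand by (auto simp: carrier_iff comm_monoid.m_comm comm_group.axioms(1) PiE_iff
      intro!: restrict_ext)
qed (simp add: group_summand)

lemma component_hom: "i \<in> I \<Longrightarrow> (\<lambda>x. x i) \<in> hom (sum_group I G) (G i)"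
  by (rule homI) (auto simp: carrier_iff)

lemma finprod_component:
  assumes "i \<in> I" "\<And>a. a \<in> A \<Longrightarrow> f a \<in> carrier (sum_group I G)"
  shows "finprod (sum_group I G) f A i = (\<Otimes>\<^bsub>G i\<^esub>a\<in>A. f a i)"
  using hom_finprod[OF comm_group_axioms comm_group_summand[OF assms(1)] component_hom[OF assms(1)], of A f] assms(2)
  by simp

lemma sum_incl_component:
  "i \<in> I \<Longrightarrow> j \<in> I \<Longrightarrow> sum_incl I G i x j = (if j = i then x else \<one>\<^bsub>G j\<^esub>)"
  by (simp add: sum_incl_def)

lemma sum_incl_closed: "i \<in> I \<Longrightarrow> x \<in> carrier (G i) \<Longrightarrow> sum_incl I G i x \<in> carrier (sum_group I G)"
proof -
  assume "i \<in> I" "x \<in> carrier (G i)"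
  moreover have "finite {j \<in> I. (if j = i then x else \<one>\<^bsub>G j\<^esub>) \<noteq> \<one>\<^bsub>G j\<^esub>}"
    by (rule finite_subset[of _ "{i}"]) auto
  ultimately show ?thesis
    using group.is_monoid[OF group_summand] by (auto simp: carrier_iff sum_incl_def monoid.one_closed cong: conj_cong)
qed

lemma sum_incl_hom: "i \<in> I \<Longrightarrow> sum_incl I G i \<in> hom (G i) (sum_group I G)"
proof (rule homI)
  fix x y assume "i \<in> I" "x \<in> carrier (G i)" "y \<in> carrier (G i)"
  then show "sum_incl I G i (x \<otimes>\<^bsub>G i\<^esub> y) = sum_incl I G i x \<otimes>\<^bsub>sum_group I G\<^esub> sum_incl I G i y"
    using group.is_monoid[OF group_summand]
    by (auto simp: sum_incl_def intro!: restrict_ext)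
qed (rule sum_incl_closed)

text \<open>An element of the direct sum is built up from its finitely many nontrivial components.\<close>

lemma sum_group_hom_eqI:
  assumes "group H" "f \<in> hom (sum_group I G) H" "g \<in> hom (sum_group I G) H"
    "\<And>i x. i \<in> I \<Longrightarrow> x \<in> carrier (G i) \<Longrightarrow> f (sum_incl I G i x) = g (sum_incl I G i x)"
    "z \<in> carrier (sum_group I G)"
  shows "f z = g z"
proof -
  have "f z = g z" if "finite A" "{i \<in> I. z i \<noteq> \<one>\<^bsub>G i\<^esub>} \<subseteq> A" "z \<in> carrier (sum_group I G)" for A z
    using that
  proof (induction A arbitrary: z rule: finite_induct)
    case empty
    then have "z = \<one>\<^bsub>sum_group I G\<^esub>"
      by (auto simp: carrier_iff PiE_iff fun_eq_iff extensional_def)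
    then show ?case
      using hom_one[OF assms(2) is_group assms(1)] hom_one[OF assms(3) is_group assms(1)] by metis
  next
    case (insert i A)
    show ?case
    proof (cases "i \<in> I")
      case False
      with insert show ?thesis by (intro insert.IH) auto
    next
      case True
      let ?y = "(\<lambda>j\<in>I. if j = i then \<one>\<^bsub>G j\<^esub> else z j)"
      have z: "z \<in> (\<Pi>\<^sub>E i\<in>I. carrier (G i))" using insert.prems by (simp add: carrier_iff)
      have sub: "{j \<in> I. ?y j \<noteq> \<one>\<^bsub>G j\<^esub>} \<subseteq> A" using insert.prems by auto
      have y: "?y \<in> carrier (sum_group I G)"
        using z group.is_monoid[OF group_summand] finite_subset[OF sub insert.hyps(1)]
        by (auto simp: carrier_iff)
      have zi: "sum_incl I G i (z i) \<in> carrier (sum_group I G)" "z i \<in> carrier (G i)"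
        using z True by (auto intro!: sum_incl_closed)
      have "z = sum_incl I G i (z i) \<otimes>\<^bsub>sum_group I G\<^esub> ?y"
      proof
        fix j show "z j = (sum_incl I G i (z i) \<otimes>\<^bsub>sum_group I G\<^esub> ?y) j"
          using z group.is_monoid[OF group_summand, of j]
          by (cases "j \<in> I") (auto simp: sum_incl_def PiE_iff extensional_def)
      qed
      moreover have "f ?y = g ?y"
        using sub y by (rule insert.IH)
      moreover have "f (sum_incl I G i (z i)) = g (sum_incl I G i (z i))"
        using True zi by (intro assms(4))
      ultimately show ?thesis
        using hom_mult[OF assms(2) zi(1) y] hom_mult[OF assms(3) zi(1) y] by metis
    qed
  qed
  then show ?thesis
    using assms(5) by (auto simp: carrier_iff)
qed

lemma sum_group_universal:
  assumes "comm_group H" "\<And>i. i \<in> I \<Longrightarrow> f i \<in> hom (G i) H"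
  shows "\<exists>h\<in>ext_hom (sum_group I G) H. \<forall>i\<in>I. \<forall>x\<in>carrier (G i). h (sum_incl I G i x) = f i x"
proof -
  interpret H: comm_group H by fact
  let ?h = "\<lambda>x. gfinprod H (\<lambda>i. f i (x i)) I"
  have one: "f i \<one>\<^bsub>G i\<^esub> = \<one>\<^bsub>H\<^esub>" if "i \<in> I" for i
    using hom_one[OF assms(2) group_summand H.is_group] that by blast
  have on_incl: "?h (sum_incl I G i x) = f i x" if i: "i \<in> I" and x: "x \<in> carrier (G i)" for i x
  proof -
    have cl: "(\<lambda>j. f j (sum_incl I G i x j)) \<in> I \<rightarrow> carrier H"
    proof
      fix j assume "j \<in> I"
      then show "f j (sum_incl I G i x j) \<in> carrier H"
        using hom_in_carrier[OF assms(2)] sum_incl_closed[OF i x] by (auto simp: carrier_iff)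
    qed
    have "?h (sum_incl I G i x) = gfinprod H (\<lambda>j. f j (sum_incl I G i x j)) {i}"
      using cl i one by (intro H.gfinprod_mono_neutral_cong_right) (auto simp: sum_incl_component)
    also have "\<dots> = f i x"
      using cl i x hom_in_carrier[OF assms(2)] by (subst H.gfinprod_eq_finprod)
        (auto simp: sum_incl_component)
    finally show ?thesis .
  qed
  show ?thesis
    using restrict_ext_hom[OF is_group H.hom_group_sum[OF assms(2) group_summand]] on_incl sum_incl_closed
    by (intro bexI[where x = "restrict ?h (carrier (sum_group I G))"]) auto
qed

end

text \<open>As for presented groups, the extension is made in one variable at a time, and each additivity
  statement about the first step is an equality of two homomorphisms that is tested on summands.\<close>

lemma direct_sum_bilinear_universal:
  assumes "direct_sum I G" "direct_sum J H" "comm_group L"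
    "\<And>i j. i \<in> I \<Longrightarrow> j \<in> J \<Longrightarrow> bilinear_map (G i) (H j) L (B i j)"
  shows "\<exists>\<beta>. bilinear_map (sum_group I G) (sum_group J H) L \<beta> \<and>
    (\<forall>i\<in>I. \<forall>j\<in>J. \<forall>x\<in>carrier (G i). \<forall>y\<in>carrier (H j).
      \<beta> (sum_incl I G i x) (sum_incl J H j y) = B i j x y)"
proof -
  interpret L: comm_group L by fact
  interpret G: direct_sum I G by fact
  interpret H: direct_sum J H by fact
  have "\<forall>j\<in>J. \<forall>y\<in>carrier (H j). \<exists>h. h \<in> hom (sum_group I G) L \<and>
      (\<forall>i\<in>I. \<forall>x\<in>carrier (G i). h (sum_incl I G i x) = B i j x y)"
    using G.sum_group_universal[OF assms(3), of "\<lambda>i x. B i j x y" for j y] assms(4)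
    by (fastforce simp: bilinear_map_def ext_hom_def)
  then obtain h where h: "\<And>j y. j \<in> J \<Longrightarrow> y \<in> carrier (H j) \<Longrightarrow> h j y \<in> hom (sum_group I G) L"
      "\<And>i j x y. i \<in> I \<Longrightarrow> j \<in> J \<Longrightarrow> x \<in> carrier (G i) \<Longrightarrow> y \<in> carrier (H j) \<Longrightarrow>
        h j y (sum_incl I G i x) = B i j x y"
    by metis
  have h_mult: "h j (y \<otimes>\<^bsub>H j\<^esub> y') x = h j y x \<otimes>\<^bsub>L\<^esub> h j y' x"
    if j: "j \<in> J" and y: "y \<in> carrier (H j)" "y' \<in> carrier (H j)"
      and x: "x \<in> carrier (sum_group I G)" for j y y' x
  proof -
    interpret Hj: comm_group "H j" using j by (rule H.comm_group_summand)
    show ?thesis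
    proof (rule G.sum_group_hom_eqI[OF L.is_group _ _ _ x])
      show "(\<lambda>x. h j y x \<otimes>\<^bsub>L\<^esub> h j y' x) \<in> hom (sum_group I G) L"
        using h(1) j y by (intro L.hom_group_mult) auto
      show "h j (y \<otimes>\<^bsub>H j\<^esub> y') \<in> hom (sum_group I G) L"
        using h(1) j y by simp
      fix i x assume "i \<in> I" "x \<in> carrier (G i)"
      then show "h j (y \<otimes>\<^bsub>H j\<^esub> y') (sum_incl I G i x) =
          h j y (sum_incl I G i x) \<otimes>\<^bsub>L\<^esub> h j y' (sum_incl I G i x)"
        using h(2) j y assms(4)[of i j] by (simp add: bilinear_map_def hom_mult)
    qed
  qed
  have "\<forall>x\<in>carrier (sum_group I G). \<exists>g. g \<in> hom (sum_group J H) L \<and>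
      (\<forall>j\<in>J. \<forall>y\<in>carrier (H j). g (sum_incl J H j y) = h j y x)"
  proof
    fix x assume x: "x \<in> carrier (sum_group I G)"
    have "(\<lambda>y. h j y x) \<in> hom (H j) L" if "j \<in> J" for j
      using h_mult[OF that _ _ x] hom_in_carrier[OF h(1)[OF that] x] by (intro homI) auto
    from H.sum_group_universal[OF assms(3) this] show "\<exists>g. g \<in> hom (sum_group J H) L \<and>
        (\<forall>j\<in>J. \<forall>y\<in>carrier (H j). g (sum_incl J H j y) = h j y x)"
      by (auto simp: ext_hom_def)
  qed
  then obtain \<beta> where \<beta>: "\<And>x. x \<in> carrier (sum_group I G) \<Longrightarrow> \<beta> x \<in> hom (sum_group J H) L"
      "\<And>x j y. x \<in> carrier (sum_group I G) \<Longrightarrow> j \<in> J \<Longrightarrow> y \<in> carrier (H j) \<Longrightarrow>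
        \<beta> x (sum_incl J H j y) = h j y x"
    by metis
  have "bilinear_map (sum_group I G) (sum_group J H) L \<beta>"
    unfolding bilinear_map_def
  proof (intro conjI ballI)
    fix y assume y: "y \<in> carrier (sum_group J H)"
    show "(\<lambda>x. \<beta> x y) \<in> hom (sum_group I G) L"
    proof (rule homI)
      show "\<beta> x y \<in> carrier L" if "x \<in> carrier (sum_group I G)" for x
        using \<beta>(1)[OF that] y by (rule hom_in_carrier)
      fix x x' assume x: "x \<in> carrier (sum_group I G)" "x' \<in> carrier (sum_group I G)"
      show "\<beta> (x \<otimes>\<^bsub>sum_group I G\<^esub> x') y = \<beta> x y \<otimes>\<^bsub>L\<^esub> \<beta> x' y"
      proof (rule H.sum_group_hom_eqI[OF L.is_group _ _ _ y])
        show "(\<lambda>y. \<beta> x y \<otimes>\<^bsub>L\<^esub> \<beta> x' y) \<in> hom (sum_group J H) L"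
          using x \<beta>(1) by (intro L.hom_group_mult) auto
        show "\<beta> (x \<otimes>\<^bsub>sum_group I G\<^esub> x') \<in> hom (sum_group J H) L"
          using x \<beta>(1) G.m_closed by blast
        fix j y assume "j \<in> J" "y \<in> carrier (H j)"
        then show "\<beta> (x \<otimes>\<^bsub>sum_group I G\<^esub> x') (sum_incl J H j y) =
            \<beta> x (sum_incl J H j y) \<otimes>\<^bsub>L\<^esub> \<beta> x' (sum_incl J H j y)"
          using x \<beta>(2) hom_mult[OF h(1)] G.m_closed by metis
      qed
    qed
  qed (rule \<beta>(1))
  moreover have "\<forall>i\<in>I. \<forall>j\<in>J. \<forall>x\<in>carrier (G i). \<forall>y\<in>carrier (H j).
      \<beta> (sum_incl I G i x) (sum_incl J H j y) = B i j x y"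
    using \<beta>(2) h(2) G.sum_incl_closed by simp
  ultimately show ?thesis by blast
qed

lemma hom_into_finite_sum_group:
  assumes "finite I" "\<And>i. i \<in> I \<Longrightarrow> group (G i)" "\<And>i. i \<in> I \<Longrightarrow> f i \<in> hom H (G i)"
  shows "(\<lambda>x. \<lambda>i\<in>I. f i x) \<in> hom H (sum_group I G)"
proof (rule homI)
  fix x y assume x: "x \<in> carrier H"
  show "(\<lambda>i\<in>I. f i x) \<in> carrier (sum_group I G)"
    using assms(1) hom_in_carrier[OF assms(3) x] by (subst carrier_sum_group[OF assms(2)]) auto
  assume y: "y \<in> carrier H"
  show "(\<lambda>i\<in>I. f i (x \<otimes>\<^bsub>H\<^esub> y)) = (\<lambda>i\<in>I. f i x) \<otimes>\<^bsub>sum_group I G\<^esub> (\<lambda>i\<in>I. f i y)"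
    using hom_mult[OF assms(3) x y] by (auto intro!: restrict_ext)
qed

section \<open>Symbols\<close>

definition generates :: "('a, 'r) monoid_scheme \<Rightarrow> 'a set \<Rightarrow> bool" where
  "generates A U \<longleftrightarrow> U \<subseteq> carrier A \<and> generate A U = carrier A"

lemma symbols_iff: "as \<in> symbols n A \<longleftrightarrow> length as = n \<and> generates A (set as)"
  by (auto simp: symbols_def generates_def)

text \<open>In this form it is clear that a generating set may be modified in any way that does not affect
  which subgroups contain it.\<close>

lemma (in group) generates_iff:
  "generates G U \<longleftrightarrow> U \<subseteq> carrier G \<and> (\<forall>H. subgroup H G \<longrightarrow> U \<subseteq> H \<longrightarrow> carrier G \<subseteq> H)"
proof
  assume "generates G U"
  then show "U \<subseteq> carrier G \<and> (\<forall>H. subgroup H G \<longrightarrow> U \<subseteq> H \<longrightarrow> carrier G \<subseteq> H)"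
    unfolding generates_def using generate_subgroup_incl by metis
next
  assume *: "U \<subseteq> carrier G \<and> (\<forall>H. subgroup H G \<longrightarrow> U \<subseteq> H \<longrightarrow> carrier G \<subseteq> H)"
  then have "carrier G \<subseteq> generate G U"
    using generate_is_subgroup[of U] generate.incl[of _ U G] by blast
  with * show "generates G U"
    using generate_incl[of U] by (auto simp: generates_def)
qed

lemma (in group) generates_cong:
  assumes "U \<subseteq> carrier G" "V \<subseteq> carrier G" "\<And>H. subgroup H G \<Longrightarrow> U \<subseteq> H \<longleftrightarrow> V \<subseteq> H"
  shows "generates G U \<longleftrightarrow> generates G V"
  using assms by (auto simp: generates_iff)

text \<open>The blow-up of a family at \<open>i\<close>, where \<open>J\<close> indexes the entries that the relation changes.
  Entries outside \<open>J\<close> are the \<open>b\<^sub>j\<close> of the relation.\<close>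

definition blowup :: "('a, 'r) monoid_scheme \<Rightarrow> 'i set \<Rightarrow> ('i \<Rightarrow> 'a) \<Rightarrow> 'i \<Rightarrow> 'i \<Rightarrow> 'a" where
  "blowup A J a i = (\<lambda>j. if j \<in> J \<and> j \<noteq> i then a j \<otimes>\<^bsub>A\<^esub> inv\<^bsub>A\<^esub> (a i) else a j)"

lemma length_blowup_entries [simp]: "length (blowup_entries A as i) = length as"
  by (simp add: blowup_entries_def)

lemma blowup_entries_eq: "blowup_entries A as i = map (blowup A {..<length as} ((!) as) i) [0..<length as]"
  by (auto simp: blowup_entries_def blowup_def)

lemma (in group) blowup_closed:
  "\<lbrakk>a \<in> I \<rightarrow> carrier G; i \<in> I; j \<in> I\<rbrakk> \<Longrightarrow> blowup G J a i j \<in> carrier G"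
  by (auto simp: blowup_def)

text \<open>The entry at \<open>i\<close> is kept, so the others can be recovered by adding it back.\<close>

lemma (in group) blowup_subset_iff:
  assumes "subgroup H G" "a \<in> I \<rightarrow> carrier G" "J \<subseteq> I" "i \<in> J"
  shows "blowup G J a i ` I \<subseteq> H \<longleftrightarrow> a ` I \<subseteq> H"
proof -
  interpret H: subgroup H G by fact
  show ?thesis
  proof
    assume *: "blowup G J a i ` I \<subseteq> H"
    have "blowup G J a i i \<in> H" using * assms by blast
    then have i: "a i \<in> H" by (simp add: blowup_def)
    show "a ` I \<subseteq> H"
    proof clarify
      fix j assume j: "j \<in> I"
      show "a j \<in> H"
      proof (cases "j \<in> J \<and> j \<noteq> i")
        case True
        with * j have "a j \<otimes> inv (a i) \<in> H" by (force simp: blowup_def)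
        from H.m_closed[OF this i] show ?thesis
          using assms j by (auto simp: m_assoc Pi_iff subset_iff)
      next
        case False
        with * j show ?thesis by (force simp: blowup_def)
      qed
    qed
  next
    assume "a ` I \<subseteq> H"
    then show "blowup G J a i ` I \<subseteq> H"
      using subsetD[OF assms(3,4)] by (auto simp: blowup_def intro!: H.m_closed H.m_inv_closed)
  qed
qed

lemma (in group) generates_blowup:
  assumes "a \<in> I \<rightarrow> carrier G" "J \<subseteq> I" "i \<in> J"
  shows "generates G (blowup G J a i ` I) \<longleftrightarrow> generates G (a ` I)"
  using assms blowup_subset_iff[OF _ assms] blowup_closed[OF assms(1), of i _ J]
  by (intro generates_cong) auto

lemma (in group) blowup_entries_symbols:
  assumes "as @ bs \<in> symbols n G" "i < length as"
  shows "blowup_entries G as i @ bs \<in> symbols n G"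
proof -
  let ?I = "{..<length as + length bs}" and ?J = "{..<length as}"
  have all: "set (as @ bs) = (!) (as @ bs) ` ?I"
    by (auto simp: set_conv_nth simp del: set_append)
  have "blowup_entries G as i @ bs = map (blowup G ?J ((!) (as @ bs)) i) [0..<length as + length bs]"
    using assms(2) by (intro nth_equalityI) (auto simp: blowup_entries_eq nth_append blowup_def)
  then have "set (blowup_entries G as i @ bs) = blowup G ?J ((!) (as @ bs)) i ` ?I"
    by (simp only: set_map atLeast_upt lessThan_atLeast0 set_upt)
  moreover have "generates G (blowup G ?J ((!) (as @ bs)) i ` ?I)"
    using assms all by (subst generates_blowup) (auto simp: symbols_iff generates_def)
  ultimately show ?thesis
    using assms(1) by (simp add: symbols_iff del: set_append)
qed

text \<open>These functions are the homomorphisms from \<open>\<M>\<^sub>n(A)\<close>, restricted to the generators.  Invariance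
  under permutations is expressed by multisets: two tuples are permutations of each other iff they
  have the same multiset of entries.\<close>

definition modular_symbol ::
  "nat \<Rightarrow> ('a, 'r) monoid_scheme \<Rightarrow> ('b, 's) monoid_scheme \<Rightarrow> ('a list \<Rightarrow> 'b) \<Rightarrow> bool" where
  "modular_symbol n A H \<phi> \<longleftrightarrow>
     (\<forall>as\<in>symbols n A. \<phi> as \<in> carrier H \<and> (\<forall>bs. mset bs = mset as \<longrightarrow> \<phi> bs = \<phi> as)) \<and>
     (\<forall>as bs. 2 \<le> length as \<longrightarrow> as @ bs \<in> symbols n A \<longrightarrow>
        \<phi> (as @ bs) = (\<Otimes>\<^bsub>H\<^esub>i\<in>{..<length as}. \<phi> (blowup_entries A as i @ bs)))"

text \<open>The additional condition for a homomorphism from \<open>\<M>\<^sub>n\<^sup>-(A)\<close>.\<close>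

definition odd_symbol ::
  "nat \<Rightarrow> ('a, 'r) monoid_scheme \<Rightarrow> ('b, 's) monoid_scheme \<Rightarrow> ('a list \<Rightarrow> 'b) \<Rightarrow> bool" where
  "odd_symbol n A H \<phi> \<longleftrightarrow>
     (\<forall>a as. a # as \<in> symbols n A \<longrightarrow> \<phi> (inv\<^bsub>A\<^esub> a # as) = inv\<^bsub>H\<^esub> \<phi> (a # as))"

lemma symbols_mset_cong: "mset bs = mset as \<Longrightarrow> bs \<in> symbols n A \<longleftrightarrow> as \<in> symbols n A"
  by (metis mset_eq_setD mset_eq_length symbols_iff)

lemma modular_symbol_closed: "modular_symbol n A H \<phi> \<Longrightarrow> as \<in> symbols n A \<Longrightarrow> \<phi> as \<in> carrier H"
  unfolding modular_symbol_def by blast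

lemma modular_symbol_mset:
  "modular_symbol n A H \<phi> \<Longrightarrow> as \<in> symbols n A \<Longrightarrow> mset bs = mset as \<Longrightarrow> \<phi> bs = \<phi> as"
  unfolding modular_symbol_def by blast

lemma modular_symbol_blowup:
  "modular_symbol n A H \<phi> \<Longrightarrow> 2 \<le> length as \<Longrightarrow> as @ bs \<in> symbols n A \<Longrightarrow>
    \<phi> (as @ bs) = (\<Otimes>\<^bsub>H\<^esub>i\<in>{..<length as}. \<phi> (blowup_entries A as i @ bs))"
  unfolding modular_symbol_def by blast

lemma (in group) inv_Cons_symbols: "a # as \<in> symbols n G \<Longrightarrow> inv a # as \<in> symbols n G"
proof -
  assume *: "a # as \<in> symbols n G"
  then have "generates G (set (inv a # as)) \<longleftrightarrow> generates G (set (a # as))"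
    using subgroup.m_inv_closed[of _ G "inv a"] subgroup.m_inv_closed[of _ G a]
    by (intro generates_cong) (auto simp: symbols_iff generates_def)
  with * show ?thesis by (simp add: symbols_iff)
qed

locale symbol_relations = A: comm_group A for A :: "('a, 'r) monoid_scheme" +
  fixes n :: nat
begin

abbreviation "Rels \<equiv> perm_rels n A \<union> blowup_rels n A"
abbreviation "Rels_minus \<equiv> Rels \<union> anti_rels n A"

lemma relations_subset: "Rels_minus \<subseteq> carrier (free_Abelian_group (symbols n A))"
proof -
  have diff: "x - y \<in> carrier (free_Abelian_group S)"
    if "x \<in> carrier (free_Abelian_group S)" "y \<in> carrier (free_Abelian_group S)" for x y :: "'a list \<Rightarrow>\<^sub>0 int" and S
    using that keys_diff[of x y] by auto
  have plus: "x + y \<in> carrier (free_Abelian_group S)"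
    if "x \<in> carrier (free_Abelian_group S)" "y \<in> carrier (free_Abelian_group S)" for x y :: "'a list \<Rightarrow>\<^sub>0 int" and S
    using that keys_add[of x y] by auto
  have "perm_rels n A \<subseteq> carrier (free_Abelian_group (symbols n A))"
    unfolding perm_rels_def
  proof clarify
    fix p as assume "as \<in> symbols n A" "p permutes {..<n}"
    moreover from this have "permute_list p as \<in> symbols n A"
      using symbols_mset_cong[OF mset_permute_list] by (auto simp: symbols_iff)
    ultimately show "frag_of (permute_list p as) - frag_of as \<in> carrier (free_Abelian_group (symbols n A))"
      by (intro diff) (simp_all only: frag_of_in_free_Abelian_group)
  qed
  moreover have "blowup_rels n A \<subseteq> carrier (free_Abelian_group (symbols n A))"
    unfolding blowup_rels_def
  proof clarify
    fix as bs assume "2 \<le> length as" "as @ bs \<in> symbols n A"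
    then show "frag_of (as @ bs) - (\<Sum>i<length as. frag_of (blowup_entries A as i @ bs))
        \<in> carrier (free_Abelian_group (symbols n A))"
      by (intro diff sum_closed_free_Abelian_group) (simp_all add: A.blowup_entries_symbols)
  qed
  moreover have "anti_rels n A \<subseteq> carrier (free_Abelian_group (symbols n A))"
    unfolding anti_rels_def
  proof clarify
    fix a as assume "a # as \<in> symbols n A"
    then show "frag_of (inv\<^bsub>A\<^esub> a # as) + frag_of (a # as) \<in> carrier (free_Abelian_group (symbols n A))"
      by (intro plus) (simp_all add: A.inv_Cons_symbols)
  qed
  ultimately show ?thesis by blast
qed

lemma presentation_symbols: "presentation (symbols n A) Rels"
  using relations_subset by (simp add: presentation_def)

lemma presentation_symbols_minus: "presentation (symbols n A) Rels_minus"
  using relations_subset by (simp add: presentation_def)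

text \<open>Stated for every set of relations that contains those of \<open>\<M>\<^sub>n(A)\<close>, so as to cover \<open>\<M>\<^sub>n\<^sup>-(A)\<close>.\<close>

lemma modular_presented_gen:
  assumes "presentation (symbols n A) R" "Rels \<subseteq> R"
  shows "modular_symbol n A (presented (symbols n A) R) (presented_gen (symbols n A) R)"
proof -
  interpret presentation "symbols n A" R by fact
  have eqI: "x = y" if "x \<otimes>\<^bsub>P\<^esub> inv\<^bsub>P\<^esub> y = \<one>\<^bsub>P\<^esub>" "x \<in> carrier P" "y \<in> carrier P" for x y
    using that P.inv_solve_right'[of "\<one>\<^bsub>P\<^esub>" x y] by simp
  show ?thesis
    unfolding modular_symbol_def
  proof (intro conjI ballI allI impI)
    fix as assume as: "as \<in> symbols n A"
    then show "presented_gen (symbols n A) R as \<in> carrier P"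
      by (rule presented_gen_closed)
    fix bs assume "mset bs = mset as"
    then obtain p where p: "p permutes {..<length as}" "permute_list p as = bs"
      by (rule mset_eq_permutation)
    have bs: "bs \<in> symbols n A"
      using as symbols_mset_cong[OF \<open>mset bs = mset as\<close>] by blast
    have "frag_of bs - frag_of as \<in> R"
      using assms(2) as p by (auto simp: perm_rels_def symbols_iff)
    moreover have "K #>\<^bsub>F\<^esub> (frag_of bs - frag_of as) =
        presented_gen (symbols n A) R bs \<otimes>\<^bsub>P\<^esub> inv\<^bsub>P\<^esub> presented_gen (symbols n A) R as"
      unfolding presented_gen_def using as bs
      by (intro hom_free_Abelian_group_diff[OF P.is_group quotient_hom]) simp_all
    ultimately show "presented_gen (symbols n A) R bs = presented_gen (symbols n A) R as"
      using eqI[OF _ presented_gen_closed[OF bs] presented_gen_closed[OF as]] quotient_relation by metis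
  next
    fix as bs assume as: "2 \<le> length as" "as @ bs \<in> symbols n A"
    have bl: "blowup_entries A as i @ bs \<in> symbols n A" if "i < length as" for i
      using as(2) that by (rule A.blowup_entries_symbols)
    have sum: "(\<Sum>i<length as. frag_of (blowup_entries A as i @ bs)) \<in> carrier F"
      using bl by (intro sum_closed_free_Abelian_group) simp
    have "frag_of (as @ bs) - (\<Sum>i<length as. frag_of (blowup_entries A as i @ bs)) \<in> R"
      using assms(2) as by (auto simp: blowup_rels_def)
    moreover have "K #>\<^bsub>F\<^esub> (frag_of (as @ bs) - (\<Sum>i<length as. frag_of (blowup_entries A as i @ bs))) =
        presented_gen (symbols n A) R (as @ bs) \<otimes>\<^bsub>P\<^esub>
          inv\<^bsub>P\<^esub> (K #>\<^bsub>F\<^esub> (\<Sum>i<length as. frag_of (blowup_entries A as i @ bs)))"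
      unfolding presented_gen_def using as sum
      by (intro hom_free_Abelian_group_diff[OF P.is_group quotient_hom]) simp_all
    ultimately have "presented_gen (symbols n A) R (as @ bs) =
        K #>\<^bsub>F\<^esub> (\<Sum>i<length as. frag_of (blowup_entries A as i @ bs))"
      using eqI[OF _ presented_gen_closed[OF as(2)] hom_in_carrier[OF quotient_hom sum]]
        quotient_relation by metis
    also have "\<dots> = (\<Otimes>\<^bsub>P\<^esub>i\<in>{..<length as}. presented_gen (symbols n A) R (blowup_entries A as i @ bs))"
      unfolding presented_gen_def
      using bl by (intro hom_free_Abelian_group_sum[OF P.comm_group_axioms quotient_hom]) simp
    finally show "presented_gen (symbols n A) R (as @ bs) = \<dots>" .
  qed
qed

lemma modular_respects:
  assumes "comm_group H" "modular_symbol n A H \<phi>"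
  shows "respects_relations (symbols n A) Rels H \<phi>"
proof -
  interpret H: comm_group H by fact
  note cl = modular_symbol_closed[OF assms(2)]
  show ?thesis
    unfolding respects_relations_def
  proof (intro conjI ballI impI)
    show "\<phi> \<in> symbols n A \<rightarrow> carrier H" using cl by auto
    fix k r assume k: "k \<in> hom (free_Abelian_group (symbols n A)) H"
      "\<forall>x\<in>symbols n A. k (frag_of x) = \<phi> x"
    assume "r \<in> Rels"
    then consider p as where "r = frag_of (permute_list p as) - frag_of as" "as \<in> symbols n A" "p permutes {..<n}"
      | as bs where "r = frag_of (as @ bs) - (\<Sum>i<length as. frag_of (blowup_entries A as i @ bs))"
        "2 \<le> length as" "as @ bs \<in> symbols n A"
      unfolding perm_rels_def blowup_rels_def by blast
    then show "k r = \<one>\<^bsub>H\<^esub>"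
    proof cases
      case 1
      then have ms: "mset (permute_list p as) = mset as"
        by (intro mset_permute_list) (simp add: symbols_iff)
      then have "permute_list p as \<in> symbols n A"
        using 1 symbols_mset_cong by blast
      then show ?thesis
        using 1 k cl[OF 1(2)] modular_symbol_mset[OF assms(2) 1(2) ms]
        by (simp add: hom_free_Abelian_group_diff[OF H.is_group k(1)])
    next
      case 2
      have bl: "blowup_entries A as i @ bs \<in> symbols n A" if "i < length as" for i
        using 2(3) that by (rule A.blowup_entries_symbols)
      have sum: "(\<Sum>i<length as. frag_of (blowup_entries A as i @ bs))
          \<in> carrier (free_Abelian_group (symbols n A))"
        using bl by (intro sum_closed_free_Abelian_group) simp
      have "k (\<Sum>i<length as. frag_of (blowup_entries A as i @ bs)) =
          (\<Otimes>\<^bsub>H\<^esub>i\<in>{..<length as}. k (frag_of (blowup_entries A as i @ bs)))"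
        using bl by (intro hom_free_Abelian_group_sum[OF assms(1) k(1)]) simp
      also have "\<dots> = (\<Otimes>\<^bsub>H\<^esub>i\<in>{..<length as}. \<phi> (blowup_entries A as i @ bs))"
        using bl k(2) cl by (intro H.finprod_cong') auto
      also have "\<dots> = \<phi> (as @ bs)"
        using modular_symbol_blowup[OF assms(2) 2(2,3)] by simp
      finally show ?thesis
        using 2 sum k cl[OF 2(3)] hom_free_Abelian_group_diff[OF H.is_group k(1) _ sum, of "frag_of (as @ bs)"]
        by simp
    qed
  qed
qed

sublocale M: presentation "symbols n A" Rels
  by (rule presentation_symbols)

sublocale Mm: presentation "symbols n A" Rels_minus
  by (rule presentation_symbols_minus)

lemma symbol_module_comm_group: "comm_group (symbol_module n A)"
  unfolding symbol_module_def by (rule M.P.comm_group_axioms)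

lemma symbol_module_minus_comm_group: "comm_group (symbol_module_minus n A)"
  unfolding symbol_module_minus_def by (rule Mm.P.comm_group_axioms)

lemma modular_symbol_symbol: "modular_symbol n A (symbol_module n A) (symbol n A)"
  using modular_presented_gen[OF presentation_symbols]
  by (simp add: symbol_module_def symbol_def[abs_def])

lemma modular_symbol_symbol_minus: "modular_symbol n A (symbol_module_minus n A) (symbol_minus n A)"
  using modular_presented_gen[OF presentation_symbols_minus]
  by (simp add: symbol_module_minus_def symbol_minus_def[abs_def])

lemma symbol_module_hom_eqI:
  assumes "group H" "f \<in> hom (symbol_module n A) H" "g \<in> hom (symbol_module n A) H"
    "\<And>as. as \<in> symbols n A \<Longrightarrow> f (symbol n A as) = g (symbol n A as)"
    "z \<in> carrier (symbol_module n A)"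
  shows "f z = g z"
  using assms unfolding symbol_module_def symbol_def by (rule M.presented_hom_eqI)

lemma odd_symbol_symbol_minus: "odd_symbol n A (symbol_module_minus n A) (symbol_minus n A)"
  unfolding odd_symbol_def
proof (intro allI impI)
  fix a as assume a: "a # as \<in> symbols n A"
  note ia = A.inv_Cons_symbols[OF a]
  have "frag_of (inv\<^bsub>A\<^esub> a # as) + frag_of (a # as) \<in> Rels_minus"
    using a by (auto simp: anti_rels_def)
  from Mm.quotient_relation[OF this]
  have "symbol_minus n A (inv\<^bsub>A\<^esub> a # as) \<otimes>\<^bsub>symbol_module_minus n A\<^esub> symbol_minus n A (a # as) =
      \<one>\<^bsub>symbol_module_minus n A\<^esub>"
    using hom_mult[OF Mm.quotient_hom, of "frag_of (inv\<^bsub>A\<^esub> a # as)" "frag_of (a # as)"] a ia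
    by (simp add: symbol_minus_def symbol_module_minus_def presented_gen_def)
  then show "symbol_minus n A (inv\<^bsub>A\<^esub> a # as) = inv\<^bsub>symbol_module_minus n A\<^esub> symbol_minus n A (a # as)"
    using group.inv_equality[OF comm_group.axioms(2)[OF symbol_module_minus_comm_group]]
      modular_symbol_closed[OF modular_symbol_symbol_minus] a ia by metis
qed

end

section \<open>The multiplication of an exact sequence\<close>

text \<open>The dual sequence \<open>0 \<rightarrow> A'' \<rightarrow> A \<rightarrow> A' \<rightarrow> 0\<close>, with \<open>A''\<close> a subset of \<open>A\<close> as for groups of roots
  of unity.  The kernel is finite so that the sums over lifts are finite.\<close>

locale dual_sequence = A: comm_group A for A :: "'a monoid" (structure) +
  fixes A'' A' :: "'a monoid" and \<pi> :: "'a \<Rightarrow> 'a"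
  assumes exact: "short_exact_sequence A' A A'' \<pi> id"
    and finite_kernel: "finite (carrier A'')"
begin

lemma epi: "\<pi> \<in> epi A A'" and exact': "exact_seq ([A', A, A''], [\<pi>, id])"
  using short_exact_sequenceD[OF exact] by auto

sublocale \<pi>: group_hom A A' \<pi>
  using exact' by (simp add: group_hom_def group_hom_axioms_def)

sublocale \<iota>: group_hom A'' A id
  using exact' by simp

lemma surj: "\<pi> ` carrier A = carrier A'"
  using epi by (simp add: epi_def)

lemma kernel_iff: "x \<in> carrier A'' \<longleftrightarrow> x \<in> carrier A \<and> \<pi> x = \<one>\<^bsub>A'\<^esub>"
  using exact' by (auto simp: kernel_def)

lemma sub_mult: "x \<in> carrier A'' \<Longrightarrow> y \<in> carrier A'' \<Longrightarrow> x \<otimes>\<^bsub>A''\<^esub> y = x \<otimes> y"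
  using \<iota>.hom_mult by simp

lemma sub_inv: "x \<in> carrier A'' \<Longrightarrow> inv\<^bsub>A''\<^esub> x = inv x"
  using \<iota>.hom_inv by simp

lemma subgroup_kernel: "subgroup (carrier A'') A"
  using \<iota>.img_is_subgroup by simp

lemma subgroup_sub: "subgroup H A'' \<Longrightarrow> subgroup H A"
  using \<iota>.subgroup_img_is_subgroup[of H] by simp

lemma subgroup_Int_kernel:
  assumes "subgroup H A" shows "subgroup (H \<inter> carrier A'') A''"
proof (rule \<iota>.G.subgroupI)
  interpret H: subgroup H A by fact
  have "\<one> \<in> H \<inter> carrier A''"
    using \<iota>.hom_one H.one_closed \<iota>.G.one_closed by simp
  then show "H \<inter> carrier A'' \<noteq> {}" by blast
  fix x assume x: "x \<in> H \<inter> carrier A''"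
  show "inv\<^bsub>A''\<^esub> x \<in> H \<inter> carrier A''"
    using x \<iota>.G.inv_closed[of x] H.m_inv_closed[of x] sub_inv[of x] by simp
  fix y assume y: "y \<in> H \<inter> carrier A''"
  show "x \<otimes>\<^bsub>A''\<^esub> y \<in> H \<inter> carrier A''"
    using x y \<iota>.G.m_closed[of x y] H.m_closed[of x y] sub_mult[of x y] by simp
qed blast

lemma comm_group_sub: "comm_group A''"
proof (rule group.group_comm_groupI)
  fix x y assume "x \<in> carrier A''" "y \<in> carrier A''"
  then show "x \<otimes>\<^bsub>A''\<^esub> y = y \<otimes>\<^bsub>A''\<^esub> x"
    using A.m_comm[of x y] by (simp add: sub_mult kernel_iff)
qed (rule \<iota>.G.is_group)

lemma comm_group_quotient: "comm_group A'"
proof (rule group.group_comm_groupI)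
  fix x y assume "x \<in> carrier A'" "y \<in> carrier A'"
  then obtain u v where "u \<in> carrier A" "v \<in> carrier A" "x = \<pi> u" "y = \<pi> v"
    using surj by blast
  then show "x \<otimes>\<^bsub>A'\<^esub> y = y \<otimes>\<^bsub>A'\<^esub> x"
    using A.m_comm[of u v] by (simp flip: \<pi>.hom_mult)
qed (rule \<pi>.H.is_group)

text \<open>A subgroup that contains \<open>U\<close> and \<open>V\<close> contains the kernel of \<open>\<pi>\<close> and is mapped onto \<open>A'\<close>.\<close>

lemma generates_lift:
  assumes "generates A' (\<pi> ` U)" "generates A'' V" "U \<subseteq> carrier A"
  shows "generates A (U \<union> V)"
  unfolding A.generates_iff
proof (intro conjI allI impI)
  have V: "V \<subseteq> carrier A''" using assms(2) by (simp add: generates_def)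
  then show "U \<union> V \<subseteq> carrier A" using assms(3) by (auto simp: kernel_iff)
  fix H assume H: "subgroup H A" "U \<union> V \<subseteq> H"
  interpret H: subgroup H A by fact
  have "carrier A'' \<subseteq> H \<inter> carrier A''"
    using assms(2) H(2) V subgroup_Int_kernel[OF H(1)] unfolding \<iota>.G.generates_iff by blast
  moreover have "carrier A' \<subseteq> \<pi> ` H"
    using assms(1) H(2) \<pi>.subgroup_img_is_subgroup[OF H(1)] unfolding \<pi>.H.generates_iff by blast
  ultimately show "carrier A \<subseteq> H"
  proof (intro subsetI)
    fix x assume *: "carrier A'' \<subseteq> H \<inter> carrier A''" "carrier A' \<subseteq> \<pi> ` H" and x: "x \<in> carrier A"
    then obtain h where h: "h \<in> H" "\<pi> x = \<pi> h" using \<pi>.hom_closed[OF x] by blast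
    then have "x \<otimes> inv h \<in> carrier A''"
      using x by (simp add: kernel_iff)
    with * have "x \<otimes> inv h \<in> H" by blast
    from H.m_closed[OF this h(1)] show "x \<in> H"
      using x h(1) by (simp add: A.m_assoc)
  qed
qed

lemma lift_symbols:
  assumes "as \<in> symbols n' A'" "bs \<in> symbols n'' A''" "cs \<in> lifts A \<pi> as"
  shows "cs @ bs \<in> symbols (n' + n'') A"
  using assms generates_lift[of "set cs" "set bs"]
  by (auto simp: symbols_iff lifts_def)

text \<open>A nonempty fibre is a coset of the finite group \<open>A''\<close>.\<close>

lemma finite_fibre: "finite {x \<in> carrier A. \<pi> x = y}"
proof (cases "\<exists>u\<in>carrier A. \<pi> u = y")
  case True
  then obtain u where u: "u \<in> carrier A" "\<pi> u = y" by blast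
  have "{x \<in> carrier A. \<pi> x = y} \<subseteq> (\<lambda>v. v \<otimes> u) ` carrier A''"
  proof clarify
    fix x assume "x \<in> carrier A" "y = \<pi> x"
    then show "x \<in> (\<lambda>v. v \<otimes> u) ` carrier A''"
      using u by (intro image_eqI[where x = "x \<otimes> inv u"]) (auto simp: kernel_iff A.m_assoc)
  qed
  then show ?thesis using finite_kernel finite_surj by blast
next
  case False
  then have "{x \<in> carrier A. \<pi> x = y} = {}" by auto
  then show ?thesis by (simp only: finite.emptyI)
qed

lemma finite_lifts: "finite (lifts A \<pi> as)"
proof (rule finite_subset)
  let ?B = "\<Union>y\<in>set as. {x \<in> carrier A. \<pi> x = y}"
  show "lifts A \<pi> as \<subseteq> {cs. set cs \<subseteq> ?B \<and> length cs = length as}"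
    by (auto simp: lifts_def)
  show "finite {cs. set cs \<subseteq> ?B \<and> length cs = length as}"
    by (intro finite_lists_length_eq) (auto simp: finite_fibre)
qed

lemma lifts_permute:
  assumes "p permutes {..<length as}"
  shows "bij_betw (permute_list p) (lifts A \<pi> as) (lifts A \<pi> (permute_list p as))"
proof (rule bij_betw_byWitness[where f' = "permute_list (inv_into UNIV p)"])
  note inv = permutes_inv[OF assms]
  have len: "length cs = length as" if "cs \<in> lifts A \<pi> as \<or> cs \<in> lifts A \<pi> (permute_list p as)" for cs
    using that by (auto simp: lifts_def dest: arg_cong[of _ _ length])
  show "\<forall>cs\<in>lifts A \<pi> as. permute_list (inv_into UNIV p) (permute_list p cs) = cs"
    using len assms inv permutes_inv_o(1)[OF assms] by (metis permute_list_compose permute_list_id)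
  show "\<forall>cs\<in>lifts A \<pi> (permute_list p as). permute_list p (permute_list (inv_into UNIV p) cs) = cs"
    using len assms inv permutes_inv_o(2)[OF assms] by (metis permute_list_compose permute_list_id)
  show "permute_list p ` lifts A \<pi> as \<subseteq> lifts A \<pi> (permute_list p as)"
  proof clarify
    fix cs assume cs: "cs \<in> lifts A \<pi> as"
    with assms len[of cs] permute_list_map[of p cs \<pi>]
    show "permute_list p cs \<in> lifts A \<pi> (permute_list p as)"
      by (simp add: lifts_def)
  qed
  show "permute_list (inv_into UNIV p) ` lifts A \<pi> (permute_list p as) \<subseteq> lifts A \<pi> as"
  proof clarify
    fix cs assume cs: "cs \<in> lifts A \<pi> (permute_list p as)"
    have "map \<pi> (permute_list (inv_into UNIV p) cs) = permute_list (inv_into UNIV p) (permute_list p as)"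
      using cs len[of cs] inv permute_list_map[of "inv_into UNIV p" cs \<pi>] by (simp add: lifts_def)
    also have "\<dots> = as"
      using assms inv permutes_inv_o(1)[OF assms] by (metis permute_list_compose permute_list_id)
    finally show "permute_list (inv_into UNIV p) cs \<in> lifts A \<pi> as"
      using cs len[of cs] inv by (simp add: lifts_def)
  qed
qed

text \<open>As \<open>\<pi>\<close> is a homomorphism, blowing up a lift of \<open>a\<close> gives a lift of the blow-up of \<open>a\<close>; the
  inverse map adds the entry at \<open>i\<close> back to the other entries that were changed.\<close>

lemma lifts_blowup:
  assumes "set (as @ bs) \<subseteq> carrier A'" "i < length as"
  shows "bij_betw (\<lambda>cs. blowup_entries A (take (length as) cs) i @ drop (length as) cs)
           (lifts A \<pi> (as @ bs)) (lifts A \<pi> (blowup_entries A' as i @ bs))"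
proof -
  define m where "m = length as"
  \<comment> \<open>With \<open>u\<close> the group inverse this is the blow-up; with \<open>u\<close> the identity it is the inverse map.\<close>
  define shift where "shift = (\<lambda>(u :: 'a \<Rightarrow> 'a) cs.
    map (\<lambda>j. if j < m \<and> j \<noteq> i then cs ! j \<otimes> u (cs ! i) else cs ! j) [0..<length cs])"
  have i: "i < m" using assms(2) by (simp add: m_def)
  have len: "length cs = m + length bs"
    if "cs \<in> lifts A \<pi> (as @ bs) \<or> cs \<in> lifts A \<pi> (blowup_entries A' as i @ bs)" for cs
    using that by (auto simp: lifts_def m_def dest!: arg_cong[of _ _ length])
  have cl: "cs ! j \<in> carrier A"
    if "cs \<in> lifts A \<pi> (as @ bs) \<or> cs \<in> lifts A \<pi> (blowup_entries A' as i @ bs)" "j < m + length bs" for cs j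
    using that len[OF that(1)] nth_mem[of j cs] by (auto simp: lifts_def)
  have nth_shift: "shift u cs ! j = (if j < m \<and> j \<noteq> i then cs ! j \<otimes> u (cs ! i) else cs ! j)"
    if "j < length cs" for u cs j
    using that by (simp add: shift_def)
  have len_shift: "length (shift u cs) = length cs" for u cs
    by (simp add: shift_def)
  have eq: "blowup_entries A (take (length as) cs) i @ drop (length as) cs = shift (m_inv A) cs"
    if "cs \<in> lifts A \<pi> (as @ bs)" for cs
  proof (rule nth_equalityI)
    show "length (blowup_entries A (take (length as) cs) i @ drop (length as) cs) = length (shift (m_inv A) cs)"
      using len[of cs] that by (simp add: len_shift m_def)
    fix j assume "j < length (blowup_entries A (take (length as) cs) i @ drop (length as) cs)"
    then have "j < length cs" using len[of cs] that by (simp add: m_def)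
    then show "(blowup_entries A (take (length as) cs) i @ drop (length as) cs) ! j = shift (m_inv A) cs ! j"
      using i len[of cs] that by (auto simp: nth_shift nth_append blowup_entries_def m_def)
  qed
  have iff: "map \<pi> cs = as @ bs \<longleftrightarrow> (\<forall>j<m + length bs. \<pi> (cs ! j) = (as @ bs) ! j)"
    if "length cs = m + length bs" for cs
    using that by (auto simp: list_eq_iff_nth_eq m_def)
  have nth_blowup: "(blowup_entries A' as i @ bs) ! j =
      (if j < m \<and> j \<noteq> i then (as @ bs) ! j \<otimes>\<^bsub>A'\<^esub> inv\<^bsub>A'\<^esub> ((as @ bs) ! i) else (as @ bs) ! j)"
    if "j < m + length bs" for j
    using that i by (simp add: nth_append blowup_entries_def m_def)
  have iff': "map \<pi> cs = blowup_entries A' as i @ bs \<longleftrightarrow>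
      (\<forall>j<m + length bs. \<pi> (cs ! j) =
        (if j < m \<and> j \<noteq> i then (as @ bs) ! j \<otimes>\<^bsub>A'\<^esub> inv\<^bsub>A'\<^esub> ((as @ bs) ! i) else (as @ bs) ! j))"
    if "length cs = m + length bs" for cs
  proof -
    have "map \<pi> cs = blowup_entries A' as i @ bs \<longleftrightarrow>
        (\<forall>j<m + length bs. \<pi> (cs ! j) = (blowup_entries A' as i @ bs) ! j)"
      using that by (auto simp: list_eq_iff_nth_eq m_def)
    then show ?thesis using nth_blowup by simp
  qed
  have nth_closed: "(as @ bs) ! j \<in> carrier A'" if "j < m + length bs" for j
    using assms(1) nth_mem[of j "as @ bs"] that by (auto simp: m_def simp del: set_append nth_mem)
  have "bij_betw (shift (m_inv A)) (lifts A \<pi> (as @ bs)) (lifts A \<pi> (blowup_entries A' as i @ bs))"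
  proof (rule bij_betw_byWitness[where f' = "shift (\<lambda>x. x)"])
    show "\<forall>cs\<in>lifts A \<pi> (as @ bs). shift (\<lambda>x. x) (shift (m_inv A) cs) = cs"
    proof
      fix cs assume cs: "cs \<in> lifts A \<pi> (as @ bs)"
      then show "shift (\<lambda>x. x) (shift (m_inv A) cs) = cs"
        using i len[of cs] cl[of cs]
        by (intro nth_equalityI) (auto simp: len_shift nth_shift A.m_assoc)
    qed
    show "\<forall>cs\<in>lifts A \<pi> (blowup_entries A' as i @ bs). shift (m_inv A) (shift (\<lambda>x. x) cs) = cs"
    proof
      fix cs assume cs: "cs \<in> lifts A \<pi> (blowup_entries A' as i @ bs)"
      then show "shift (m_inv A) (shift (\<lambda>x. x) cs) = cs"
        using i len[of cs] cl[of cs]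
        by (intro nth_equalityI) (auto simp: len_shift nth_shift A.m_assoc)
    qed
    show "shift (m_inv A) ` lifts A \<pi> (as @ bs) \<subseteq> lifts A \<pi> (blowup_entries A' as i @ bs)"
    proof clarify
      fix cs assume cs: "cs \<in> lifts A \<pi> (as @ bs)"
      have "\<pi> (cs ! j) = (as @ bs) ! j" if "j < m + length bs" for j
        using cs iff[of cs] len[of cs] that by (auto simp: lifts_def)
      then have "map \<pi> (shift (m_inv A) cs) = blowup_entries A' as i @ bs"
        using cs i len[of cs] cl[of cs] by (subst iff') (auto simp: len_shift nth_shift)
      moreover have "set (shift (m_inv A) cs) \<subseteq> carrier A"
        using cs i len[of cs] cl[of cs] by (auto simp: shift_def)
      ultimately show "shift (m_inv A) cs \<in> lifts A \<pi> (blowup_entries A' as i @ bs)"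
        by (simp add: lifts_def)
    qed
    show "shift (\<lambda>x. x) ` lifts A \<pi> (blowup_entries A' as i @ bs) \<subseteq> lifts A \<pi> (as @ bs)"
    proof clarify
      fix cs assume cs: "cs \<in> lifts A \<pi> (blowup_entries A' as i @ bs)"
      have "\<pi> (cs ! j) = (if j < m \<and> j \<noteq> i then (as @ bs) ! j \<otimes>\<^bsub>A'\<^esub> inv\<^bsub>A'\<^esub> ((as @ bs) ! i)
          else (as @ bs) ! j)" if "j < m + length bs" for j
        using cs iff'[of cs] len[of cs] that by (auto simp: lifts_def)
      then have "map \<pi> (shift (\<lambda>x. x) cs) = as @ bs"
        using cs i len[of cs] cl[of cs] nth_closed
        by (subst iff) (auto simp: len_shift nth_shift \<pi>.H.m_assoc)
      moreover have "set (shift (\<lambda>x. x) cs) \<subseteq> carrier A"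
        using cs i len[of cs] cl[of cs] by (auto simp: shift_def)
      ultimately show "shift (\<lambda>x. x) cs \<in> lifts A \<pi> (as @ bs)"
        by (simp add: lifts_def)
    qed
  qed
  then show ?thesis
    using eq by (subst bij_betw_cong[where g = "shift (m_inv A)"])
qed

context
  fixes H :: "('c, 'u) monoid_scheme" and \<phi> :: "'a list \<Rightarrow> 'c" and n' n'' :: nat
  assumes H: "comm_group H" and \<phi>: "modular_symbol (n' + n'') A H \<phi>"
begin

interpretation H: comm_group H by (rule H)

lemma lift_sum_closed:
  assumes "as \<in> symbols n' A'" "bs \<in> symbols n'' A''"
  shows "(\<Otimes>\<^bsub>H\<^esub>cs\<in>lifts A \<pi> as. \<phi> (cs @ bs)) \<in> carrier H"
  using modular_symbol_closed[OF \<phi> lift_symbols[OF assms]] by (intro H.finprod_closed) auto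

text \<open>Each summand satisfies the blow-up relation in \<open>A\<close>, and the lifts of the blow-ups correspond
  bijectively to the blow-ups of the lifts.\<close>

lemma modular_lift_sum_left:
  assumes bs: "bs \<in> symbols n'' A''"
  shows "modular_symbol n' A' H (\<lambda>as. \<Otimes>\<^bsub>H\<^esub>cs\<in>lifts A \<pi> as. \<phi> (cs @ bs))"
  unfolding modular_symbol_def
proof (intro conjI ballI allI impI)
  fix as assume as: "as \<in> symbols n' A'"
  show "(\<Otimes>\<^bsub>H\<^esub>cs\<in>lifts A \<pi> as. \<phi> (cs @ bs)) \<in> carrier H"
    by (rule lift_sum_closed[OF as bs])
  fix as' assume "mset as' = mset as"
  then obtain p where p: "p permutes {..<length as}" "permute_list p as = as'"
    by (rule mset_eq_permutation)
  have as': "as' \<in> symbols n' A'"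
    using as symbols_mset_cong[OF \<open>mset as' = mset as\<close>] by blast
  have "(\<Otimes>\<^bsub>H\<^esub>cs\<in>lifts A \<pi> as'. \<phi> (cs @ bs)) = (\<Otimes>\<^bsub>H\<^esub>cs\<in>lifts A \<pi> as. \<phi> (permute_list p cs @ bs))"
    using H.finprod_bij[OF lifts_permute[OF p(1)], of "\<lambda>cs. \<phi> (cs @ bs)"]
      modular_symbol_closed[OF \<phi> lift_symbols[OF as' bs]] p(2) by simp
  also have "\<dots> = (\<Otimes>\<^bsub>H\<^esub>cs\<in>lifts A \<pi> as. \<phi> (cs @ bs))"
  proof (rule H.finprod_cong')
    fix cs assume cs: "cs \<in> lifts A \<pi> as"
    then have "length cs = length as" by (auto simp: lifts_def)
    with p(1) show "\<phi> (permute_list p cs @ bs) = \<phi> (cs @ bs)"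
      by (intro modular_symbol_mset[OF \<phi> lift_symbols[OF as bs cs]]) simp
  qed (use modular_symbol_closed[OF \<phi> lift_symbols[OF as bs]] in auto)
  finally show "(\<Otimes>\<^bsub>H\<^esub>cs\<in>lifts A \<pi> as'. \<phi> (cs @ bs)) = (\<Otimes>\<^bsub>H\<^esub>cs\<in>lifts A \<pi> as. \<phi> (cs @ bs))" .
next
  fix as as2 assume as: "2 \<le> length as" "as @ as2 \<in> symbols n' A'"
  let ?m = "length as"
  let ?b = "\<lambda>i cs. blowup_entries A (take ?m cs) i @ drop ?m cs"
  have set: "set (as @ as2) \<subseteq> carrier A'"
    using as(2) by (auto simp: symbols_def)
  have bl: "blowup_entries A' as i @ as2 \<in> symbols n' A'" if "i < ?m" for i
    using as(2) that by (rule \<pi>.H.blowup_entries_symbols)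
  have b_closed: "\<phi> (?b i cs @ bs) \<in> carrier H" if "i < ?m" "cs \<in> lifts A \<pi> (as @ as2)" for i cs
    using bij_betw_apply[OF lifts_blowup[OF set that(1)] that(2)] 
    by (intro modular_symbol_closed[OF \<phi> lift_symbols[OF bl[OF that(1)] bs]])
  have "(\<Otimes>\<^bsub>H\<^esub>cs\<in>lifts A \<pi> (as @ as2). \<phi> (cs @ bs)) =
      (\<Otimes>\<^bsub>H\<^esub>cs\<in>lifts A \<pi> (as @ as2). \<Otimes>\<^bsub>H\<^esub>i\<in>{..<?m}. \<phi> (?b i cs @ bs))"
  proof (rule H.finprod_cong')
    fix cs assume cs: "cs \<in> lifts A \<pi> (as @ as2)"
    then have len: "length (take ?m cs) = ?m"
      by (auto simp: lifts_def dest!: arg_cong[of _ _ length])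
    have "take ?m cs @ drop ?m cs @ bs \<in> symbols (n' + n'') A"
      using lift_symbols[OF as(2) bs cs] by (simp add: append_assoc[symmetric] del: append_assoc)
    from modular_symbol_blowup[OF \<phi> _ this] as(1) len
    show "\<phi> (cs @ bs) = (\<Otimes>\<^bsub>H\<^esub>i\<in>{..<?m}. \<phi> (?b i cs @ bs))"
      by (simp add: append_assoc[symmetric] del: append_assoc)
  qed (use b_closed in \<open>auto intro!: H.finprod_closed\<close>)
  also have "\<dots> = (\<Otimes>\<^bsub>H\<^esub>i\<in>{..<?m}. \<Otimes>\<^bsub>H\<^esub>cs\<in>lifts A \<pi> (as @ as2). \<phi> (?b i cs @ bs))"
    using b_closed by (intro H.finprod_swap) (auto simp: finite_lifts)
  also have "\<dots> = (\<Otimes>\<^bsub>H\<^esub>i\<in>{..<?m}. \<Otimes>\<^bsub>H\<^esub>cs\<in>lifts A \<pi> (blowup_entries A' as i @ as2). \<phi> (cs @ bs))"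
  proof (rule H.finprod_cong')
    fix i assume "i \<in> {..<?m}"
    then have i: "i < ?m" by simp
    show "(\<Otimes>\<^bsub>H\<^esub>cs\<in>lifts A \<pi> (as @ as2). \<phi> (?b i cs @ bs)) =
        (\<Otimes>\<^bsub>H\<^esub>cs\<in>lifts A \<pi> (blowup_entries A' as i @ as2). \<phi> (cs @ bs))"
      using modular_symbol_closed[OF \<phi> lift_symbols[OF bl[OF i] bs]]
      by (intro H.finprod_bij[OF lifts_blowup[OF set i], of "\<lambda>cs. \<phi> (cs @ bs)"])
  qed (use lift_sum_closed[OF bl bs] in auto)
  finally show "(\<Otimes>\<^bsub>H\<^esub>cs\<in>lifts A \<pi> (as @ as2). \<phi> (cs @ bs)) = \<dots>" .
qed

text \<open>Here the lifts do not change, and the relation holds summand by summand.\<close>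

lemma modular_lift_sum_right:
  assumes as: "as \<in> symbols n' A'"
  shows "modular_symbol n'' A'' H (\<lambda>bs. \<Otimes>\<^bsub>H\<^esub>cs\<in>lifts A \<pi> as. \<phi> (cs @ bs))"
  unfolding modular_symbol_def
proof (intro conjI ballI allI impI)
  fix bs assume bs: "bs \<in> symbols n'' A''"
  show "(\<Otimes>\<^bsub>H\<^esub>cs\<in>lifts A \<pi> as. \<phi> (cs @ bs)) \<in> carrier H"
    by (rule lift_sum_closed[OF as bs])
  fix bs' assume ms: "mset bs' = mset bs"
  show "(\<Otimes>\<^bsub>H\<^esub>cs\<in>lifts A \<pi> as. \<phi> (cs @ bs')) = (\<Otimes>\<^bsub>H\<^esub>cs\<in>lifts A \<pi> as. \<phi> (cs @ bs))"
  proof (rule H.finprod_cong')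
    show "\<phi> (cs @ bs') = \<phi> (cs @ bs)" if "cs \<in> lifts A \<pi> as" for cs
      using ms by (intro modular_symbol_mset[OF \<phi> lift_symbols[OF as bs that]]) simp
  qed (use modular_symbol_closed[OF \<phi> lift_symbols[OF as bs]] in auto)
next
  fix bs bs2 assume bs: "2 \<le> length bs" "bs @ bs2 \<in> symbols n'' A''"
  have bl: "blowup_entries A'' bs i @ bs2 \<in> symbols n'' A''" if "i < length bs" for i
    using bs(2) that by (rule \<iota>.G.blowup_entries_symbols)
  have carrier: "bs ! j \<in> carrier A''" if "j < length bs" for j
    using bs(2) nth_mem[OF that] by (auto simp: symbols_def)
  have entries: "blowup_entries A'' bs i = blowup_entries A bs i" if "i < length bs" for i
    unfolding blowup_entries_def using carrier that
    by (intro map_cong refl) (auto simp: sub_mult sub_inv \<iota>.G.inv_closed simp flip: sub_inv)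
  have "(\<Otimes>\<^bsub>H\<^esub>cs\<in>lifts A \<pi> as. \<phi> (cs @ bs @ bs2)) =
      (\<Otimes>\<^bsub>H\<^esub>cs\<in>lifts A \<pi> as. \<Otimes>\<^bsub>H\<^esub>i\<in>{..<length bs}. \<phi> (cs @ blowup_entries A'' bs i @ bs2))"
  proof (rule H.finprod_cong')
    fix cs assume cs: "cs \<in> lifts A \<pi> as"
    note sym = lift_symbols[OF as bs(2) cs]
    have sym': "bs @ bs2 @ cs \<in> symbols (n' + n'') A"
      using sym by (subst symbols_mset_cong[of _ "cs @ bs @ bs2"]) simp_all
    have "\<phi> (cs @ bs @ bs2) = \<phi> (bs @ bs2 @ cs)"
      by (rule modular_symbol_mset[OF \<phi> sym']) simp
    also have "\<dots> = (\<Otimes>\<^bsub>H\<^esub>i\<in>{..<length bs}. \<phi> (blowup_entries A bs i @ bs2 @ cs))"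
      by (rule modular_symbol_blowup[OF \<phi> bs(1) sym'])
    also have "\<dots> = (\<Otimes>\<^bsub>H\<^esub>i\<in>{..<length bs}. \<phi> (cs @ blowup_entries A'' bs i @ bs2))"
    proof (rule H.finprod_cong')
      fix i assume "i \<in> {..<length bs}"
      then have i: "i < length bs" by simp
      show "\<phi> (blowup_entries A bs i @ bs2 @ cs) = \<phi> (cs @ blowup_entries A'' bs i @ bs2)"
        using entries[OF i] by (intro modular_symbol_mset[OF \<phi> lift_symbols[OF as bl[OF i] cs]]) simp
    qed (use modular_symbol_closed[OF \<phi> lift_symbols[OF as bl cs]] in auto)
    finally show "\<phi> (cs @ bs @ bs2) = \<dots>" .
  qed (use modular_symbol_closed[OF \<phi> lift_symbols[OF as bl]] in \<open>auto intro!: H.finprod_closed\<close>)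
  also have "\<dots> = (\<Otimes>\<^bsub>H\<^esub>i\<in>{..<length bs}. \<Otimes>\<^bsub>H\<^esub>cs\<in>lifts A \<pi> as. \<phi> (cs @ blowup_entries A'' bs i @ bs2))"
    using modular_symbol_closed[OF \<phi> lift_symbols[OF as bl]]
    by (intro H.finprod_swap) (auto simp: finite_lifts)
  finally show "(\<Otimes>\<^bsub>H\<^esub>cs\<in>lifts A \<pi> as. \<phi> (cs @ bs @ bs2)) = \<dots>" .
qed

end

end

text \<open>Tensors of symbols generate the tensor product.\<close>

lemma symbol_tensor_hom_eqI:
  assumes "comm_group A" "comm_group B" "group L"
    "f \<in> hom (tensor (symbol_module m A) (symbol_module n B)) L"
    "g \<in> hom (tensor (symbol_module m A) (symbol_module n B)) L"
    "\<And>as bs. as \<in> symbols m A \<Longrightarrow> bs \<in> symbols n B \<Longrightarrow>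
      f (tens (symbol_module m A) (symbol_module n B) (symbol m A as) (symbol n B bs)) =
      g (tens (symbol_module m A) (symbol_module n B) (symbol m A as) (symbol n B bs))"
    "z \<in> carrier (tensor (symbol_module m A) (symbol_module n B))"
  shows "f z = g z"
proof -
  interpret A: symbol_relations A m by (intro symbol_relations.intro assms)
  interpret B: symbol_relations B n by (intro symbol_relations.intro assms)
  let ?MA = "symbol_module m A" and ?MB = "symbol_module n B"
  interpret T: tensor_product ?MA ?MB
    by (intro tensor_product.intro A.symbol_module_comm_group B.symbol_module_comm_group)
  have homs: "(\<lambda>x. h (tens ?MA ?MB x y)) \<in> hom ?MA L" "(\<lambda>y. h (tens ?MA ?MB x y)) \<in> hom ?MB L"
    if "h \<in> hom (tensor ?MA ?MB) L" "x \<in> carrier ?MA" "y \<in> carrier ?MB" for h x y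
    using hom_bilinear_map[OF T.tens_bilinear that(1)] that by (auto simp: bilinear_map_def)
  have sym: "symbol m A as \<in> carrier ?MA" if "as \<in> symbols m A" for as
    using that by (rule modular_symbol_closed[OF A.modular_symbol_symbol])
  show ?thesis
  proof (rule T.tensor_hom_eqI[OF assms(3-5) _ assms(7)])
    fix x y assume xy: "x \<in> carrier ?MA" "y \<in> carrier ?MB"
    show "f (tens ?MA ?MB x y) = g (tens ?MA ?MB x y)"
    proof (rule A.symbol_module_hom_eqI[OF assms(3), where z = x])
      show "(\<lambda>x. f (tens ?MA ?MB x y)) \<in> hom ?MA L" "(\<lambda>x. g (tens ?MA ?MB x y)) \<in> hom ?MA L"
        using homs assms(4,5) xy by blast+
      fix as assume as: "as \<in> symbols m A"
      show "f (tens ?MA ?MB (symbol m A as) y) = g (tens ?MA ?MB (symbol m A as) y)"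
      proof (rule B.symbol_module_hom_eqI[OF assms(3), where z = y])
        show "(\<lambda>y. f (tens ?MA ?MB (symbol m A as) y)) \<in> hom ?MB L"
          "(\<lambda>y. g (tens ?MA ?MB (symbol m A as) y)) \<in> hom ?MB L"
          using homs[OF _ sym[OF as] xy(2)] assms(4,5) by blast+
      qed (use as assms(6) xy in auto)
    qed (rule xy(1))
  qed
qed

context dual_sequence
begin

lemma nabla_hom_and_symbols:
  shows "nabla n' n'' A'' A A' id \<pi> \<in> hom (tensor (symbol_module n' A') (symbol_module n'' A'')) (symbol_module (n' + n'') A)"
    and "as \<in> symbols n' A' \<Longrightarrow> bs \<in> symbols n'' A'' \<Longrightarrow>
      nabla n' n'' A'' A A' id \<pi> (tens (symbol_module n' A') (symbol_module n'' A'') (symbol n' A' as) (symbol n'' A'' bs)) =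
      (\<Otimes>\<^bsub>symbol_module (n' + n'') A\<^esub>cs\<in>lifts A \<pi> as. symbol (n' + n'') A (cs @ bs))"
proof -
  interpret R': symbol_relations A' n' by (intro symbol_relations.intro comm_group_quotient)
  interpret R'': symbol_relations A'' n'' by (intro symbol_relations.intro comm_group_sub)
  interpret R: symbol_relations A "n' + n''" by (intro symbol_relations.intro A.comm_group_axioms)
  let ?M' = "symbol_module n' A'" and ?M'' = "symbol_module n'' A''" and ?M = "symbol_module (n' + n'') A"
  note M = R.symbol_module_comm_group
  interpret T: tensor_product ?M' ?M''
    by (intro tensor_product.intro R'.symbol_module_comm_group R''.symbol_module_comm_group)
  define \<phi> where "\<phi> = (\<lambda>as bs. \<Otimes>\<^bsub>?M\<^esub>cs\<in>lifts A \<pi> as. symbol (n' + n'') A (cs @ bs))"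
  have left: "respects_relations (symbols n' A') R'.Rels ?M (\<lambda>as. \<phi> as bs)" if "bs \<in> symbols n'' A''" for bs
    unfolding \<phi>_def
    using modular_lift_sum_left[OF M R.modular_symbol_symbol that] by (rule R'.modular_respects[OF M])
  have right: "respects_relations (symbols n'' A'') R''.Rels ?M (\<phi> as)" if "as \<in> symbols n' A'" for as
    unfolding \<phi>_def
    using modular_lift_sum_right[OF M R.modular_symbol_symbol that] by (rule R''.modular_respects[OF M])
  from presentation_bilinear_universal[OF R'.presentation_symbols R''.presentation_symbols M left right]
  obtain \<beta> where \<beta>: "bilinear_map ?M' ?M'' ?M \<beta>"
    "\<forall>as\<in>symbols n' A'. \<forall>bs\<in>symbols n'' A''. \<beta> (symbol n' A' as) (symbol n'' A'' bs) = \<phi> as bs"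
    unfolding symbol_module_def symbol_def by blast
  obtain f where f: "f \<in> ext_hom (tensor ?M' ?M'') ?M"
    "\<forall>x\<in>carrier ?M'. \<forall>y\<in>carrier ?M''. f (tens ?M' ?M'' x y) = \<beta> x y"
    by (rule bexE[OF T.tensor_universal[OF M \<beta>(1)]])
  have f_symbols: "\<forall>as\<in>symbols n' A'. \<forall>bs\<in>symbols n'' A''.
      f (tens ?M' ?M'' (symbol n' A' as) (symbol n'' A'' bs)) = \<phi> as bs"
    using f(2) \<beta>(2) modular_symbol_closed[OF R'.modular_symbol_symbol]
      modular_symbol_closed[OF R''.modular_symbol_symbol] by simp
  have "nabla n' n'' A'' A A' id \<pi> = f"
    unfolding nabla_def
  proof (rule the_equality)
    fix g assume g: "g \<in> ext_hom (tensor ?M' ?M'') ?M \<and>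
      (\<forall>as\<in>symbols n' A'. \<forall>bs\<in>symbols n'' A''.
        g (tens ?M' ?M'' (symbol n' A' as) (symbol n'' A'' bs)) =
        (\<Otimes>\<^bsub>?M\<^esub>cs\<in>lifts A \<pi> as. symbol (n' + n'') A (cs @ map id bs)))"
    show "g = f"
    proof (rule ext_hom_eqI)
      show "g z = f z" if "z \<in> carrier (tensor ?M' ?M'')" for z
        using g f(1) f_symbols that
        by (intro symbol_tensor_hom_eqI[OF comm_group_quotient comm_group_sub
              comm_group.axioms(2)[OF M], of g n' n'' f z]) (simp_all add: ext_homD \<phi>_def)
    qed (use g f in simp_all)
  qed (use f f_symbols in \<open>simp add: \<phi>_def\<close>)
  then show "nabla n' n'' A'' A A' id \<pi> \<in> hom (tensor ?M' ?M'') ?M"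
    "as \<in> symbols n' A' \<Longrightarrow> bs \<in> symbols n'' A'' \<Longrightarrow>
      nabla n' n'' A'' A A' id \<pi> (tens ?M' ?M'' (symbol n' A' as) (symbol n'' A'' bs)) =
      (\<Otimes>\<^bsub>?M\<^esub>cs\<in>lifts A \<pi> as. symbol (n' + n'') A (cs @ bs))"
    using f(1) f_symbols by (simp_all add: ext_homD \<phi>_def)
qed

end

section \<open>Symbols of indexed families\<close>

text \<open>Symbols are invariant under permutations, so a tuple can be indexed by any finite set instead of
  an initial segment of the natural numbers.  This is convenient for the comultiplication, where
  tuples are restricted to subsets of the index set and indices are exchanged.\<close>

definition is_family :: "nat \<Rightarrow> ('a, 'r) monoid_scheme \<Rightarrow> 'i set \<Rightarrow> ('i \<Rightarrow> 'a) \<Rightarrow> bool" where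
  "is_family n A I a \<longleftrightarrow> finite I \<and> card I = n \<and> generates A (a ` I)"

text \<open>The value of a modular symbol at a family; the order in which the entries are listed does not
  matter.\<close>

definition family_value :: "('a list \<Rightarrow> 'b) \<Rightarrow> 'i set \<Rightarrow> ('i \<Rightarrow> 'a) \<Rightarrow> 'b" where
  "family_value \<phi> I a = \<phi> (SOME xs. mset xs = image_mset a (mset_set I))"

lemma family_value_eq:
  assumes "modular_symbol n A H \<phi>" "as \<in> symbols n A" "mset as = image_mset a (mset_set I)"
  shows "family_value \<phi> I a = \<phi> as"
  unfolding family_value_def
  using someI[of "\<lambda>xs. mset xs = image_mset a (mset_set I)", OF assms(3)] assms(3)
  by (intro modular_symbol_mset[OF assms(1,2)]) simp

lemma family_value_cong:
  assumes "\<And>i. i \<in> I \<Longrightarrow> a i = b i"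
  shows "family_value \<phi> I a = family_value \<phi> I b"
proof -
  have "image_mset a (mset_set I) = image_mset b (mset_set I)"
    using assms by (intro image_mset_cong) (cases "finite I", auto)
  then show ?thesis by (simp add: family_value_def)
qed

lemma family_value_reindex:
  "inj_on p I \<Longrightarrow> family_value \<phi> (p ` I) a = family_value \<phi> I (a \<circ> p)"
  by (simp add: family_value_def image_mset_mset_set[symmetric] multiset.map_comp)

lemma is_family_symbols:
  assumes "is_family n A I a" "distinct js" "set js = I"
  shows "map a js \<in> symbols n A" "mset (map a js) = image_mset a (mset_set I)"
  using assms distinct_card[of js] by (auto simp: is_family_def symbols_iff mset_set_set)

lemma family_value_list:
  assumes "modular_symbol n A H \<phi>" "is_family n A I a" "distinct js" "set js = I"
  shows "family_value \<phi> I a = \<phi> (map a js)"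
  using is_family_symbols[OF assms(2-4)] by (intro family_value_eq[OF assms(1)])

lemma family_value_closed:
  assumes "modular_symbol n A H \<phi>" "is_family n A I a"
  shows "family_value \<phi> I a \<in> carrier H"
proof -
  obtain js where "distinct js" "set js = I"
    using finite_distinct_list[of I] assms(2) by (auto simp: is_family_def)
  then show ?thesis
    using family_value_list[OF assms] modular_symbol_closed[OF assms(1)]
      is_family_symbols(1)[OF assms(2)] by metis
qed

lemma (in group) is_family_blowup:
  assumes "is_family n G I a" "J \<subseteq> I" "i \<in> J"
  shows "is_family n G I (blowup G J a i)"
  using assms generates_blowup[of a I J i] by (auto simp: is_family_def generates_def)

text \<open>If \<open>J\<close> has one element, blowing up changes nothing and there is nothing to prove.  Including this
  case spares a distinction later, where \<open>J\<close> is an intersection of unknown size.\<close>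

lemma (in group) family_value_blowup:
  assumes "comm_group H" "modular_symbol n G H \<phi>" "is_family n G I a" "J \<subseteq> I" "J \<noteq> {}"
  shows "family_value \<phi> I a = (\<Otimes>\<^bsub>H\<^esub>i\<in>J. family_value \<phi> I (blowup G J a i))"
proof -
  interpret H: comm_group H by fact
  have finite: "finite I" using assms(3) by (simp add: is_family_def)
  obtain js where js: "distinct js" "set js = J"
    using finite_distinct_list finite_subset[OF assms(4) finite] by blast
  obtain ks where ks: "distinct ks" "set ks = I - J"
    using finite_distinct_list finite by blast
  have jks: "distinct (js @ ks)" "set (js @ ks) = I"
    using js ks assms(4) by auto
  have closed: "family_value \<phi> I (blowup G J a i) \<in> carrier H" if "i \<in> J" for i
    using family_value_closed[OF assms(2) is_family_blowup[OF assms(3,4) that]] .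
  show ?thesis
  proof (cases "length js = 1")
    case True
    then obtain i where "js = [i]" by (auto simp: length_Suc_conv)
    then have J: "J = {i}" using js by auto
    have "blowup G J a i = a" by (auto simp: blowup_def J)
    then show ?thesis using closed[of i] by (simp add: J)
  next
    case False
    with assms(5) js have len: "2 \<le> length (map a js)"
      by (cases js) (auto simp: Suc_le_eq)
    have "family_value \<phi> I a = \<phi> (map a js @ map a ks)"
      using family_value_list[OF assms(2,3) jks] by simp
    also have "\<dots> = (\<Otimes>\<^bsub>H\<^esub>i\<in>{..<length js}. \<phi> (blowup_entries G (map a js) i @ map a ks))"
      using modular_symbol_blowup[OF assms(2) len] is_family_symbols(1)[OF assms(3) jks] by simp
    also have "\<dots> = (\<Otimes>\<^bsub>H\<^esub>i\<in>{..<length js}. family_value \<phi> I (blowup G J a (js ! i)))"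
    proof (rule H.finprod_cong')
      fix i assume "i \<in> {..<length js}"
      then have i: "i < length js" "js ! i \<in> J" using js(2) by auto
      have "blowup_entries G (map a js) i = map (blowup G J a (js ! i)) js"
        using i js by (intro nth_equalityI) (auto simp: blowup_entries_def blowup_def nth_eq_iff_index_eq)
      moreover have "map a ks = map (blowup G J a (js ! i)) ks"
        using ks(2) by (auto simp: blowup_def)
      ultimately show "\<phi> (blowup_entries G (map a js) i @ map a ks) = family_value \<phi> I (blowup G J a (js ! i))"
        using family_value_list[OF assms(2) is_family_blowup[OF assms(3,4) i(2)] jks] by (simp only: map_append)
    qed (use closed js(2) in auto)
    also have "\<dots> = (\<Otimes>\<^bsub>H\<^esub>i\<in>J. family_value \<phi> I (blowup G J a i))"
      using closed by (intro H.finprod_bij bij_betw_nth js(1)) (use js(2) in auto)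
    finally show ?thesis .
  qed
qed

lemma (in group) is_family_inv_entry:
  assumes "is_family n G I a" "i \<in> I"
  shows "is_family n G I (a(i := inv (a i)))"
proof -
  have a: "a ` I \<subseteq> carrier G" using assms(1) by (simp add: is_family_def generates_def)
  have "(a(i := inv (a i))) ` I \<subseteq> H \<longleftrightarrow> a ` I \<subseteq> H" if "subgroup H G" for H
  proof -
    have "inv (a i) \<in> H \<longleftrightarrow> a i \<in> H"
      using subgroup.m_inv_closed[OF that, of "a i"] subgroup.m_inv_closed[OF that, of "inv (a i)"] a assms(2)
      by (auto simp: image_subset_iff)
    then show ?thesis
      using assms(2) by (auto simp: image_subset_iff)
  qed
  moreover have "(a(i := inv (a i))) ` I \<subseteq> carrier G" using a assms(2) by auto
  ultimately have "generates G ((a(i := inv (a i))) ` I) \<longleftrightarrow> generates G (a ` I)"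
    using a by (intro generates_cong)
  with assms(1) show ?thesis by (simp add: is_family_def)
qed

lemma (in group) family_value_inv_entry:
  assumes "modular_symbol n G H \<phi>" "odd_symbol n G H \<phi>" "is_family n G I a" "i \<in> I"
  shows "family_value \<phi> I (a(i := inv (a i))) = inv\<^bsub>H\<^esub> (family_value \<phi> I a)"
proof -
  obtain ks where ks: "distinct ks" "set ks = I - {i}"
    using finite_distinct_list[of "I - {i}"] assms(3) by (auto simp: is_family_def)
  have iks: "distinct (i # ks)" "set (i # ks) = I" using ks assms(4) by auto
  have sym: "a i # map a ks \<in> symbols n G"
    using is_family_symbols(1)[OF assms(3) iks] by simp
  let ?b = "a(i := inv (a i))"
  have map_b: "map ?b (i # ks) = inv (a i) # map a ks"
    using ks(2) by auto
  have mset: "mset (map ?b (i # ks)) = image_mset ?b (mset_set I)"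
    using mset_set_set[OF iks(1)] iks(2) by simp
  have "family_value \<phi> I ?b = \<phi> (inv (a i) # map a ks)"
    using inv_Cons_symbols[OF sym] mset unfolding map_b by (rule family_value_eq[OF assms(1)])
  also have "\<dots> = inv\<^bsub>H\<^esub> \<phi> (a i # map a ks)"
    using assms(2) sym by (simp add: odd_symbol_def)
  also have "\<phi> (a i # map a ks) = family_value \<phi> I a"
    using family_value_list[OF assms(1,3) iks] by simp
  finally show ?thesis .
qed

text \<open>Negating the entry at \<open>i\<close> of the blow-up at \<open>i\<close> changes the sign of its value, so that the sum
  becomes minus the sum of all blow-ups, which is minus the value at \<open>a\<close>.\<close>

lemma (in group) odd_symbol_cancellation:
  assumes "comm_group H" "modular_symbol n G H \<phi>" "odd_symbol n G H \<phi>" "is_family n G I a" "J \<subseteq> I" "J \<noteq> {}"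
  shows "family_value \<phi> I a \<otimes>\<^bsub>H\<^esub>
    (\<Otimes>\<^bsub>H\<^esub>i\<in>J. family_value \<phi> I ((blowup G J a i)(i := inv (a i)))) = \<one>\<^bsub>H\<^esub>"
proof -
  interpret H: comm_group H by fact
  have closed: "family_value \<phi> I (blowup G J a i) \<in> carrier H" if "i \<in> J" for i
    using family_value_closed[OF assms(2) is_family_blowup[OF assms(4,5) that]] .
  have "(\<Otimes>\<^bsub>H\<^esub>i\<in>J. family_value \<phi> I ((blowup G J a i)(i := inv (a i)))) =
      (\<Otimes>\<^bsub>H\<^esub>i\<in>J. inv\<^bsub>H\<^esub> (family_value \<phi> I (blowup G J a i)))"
  proof (rule H.finprod_cong')
    fix i assume i: "i \<in> J"
    have "blowup G J a i i = a i" by (simp add: blowup_def)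
    with family_value_inv_entry[OF assms(2,3) is_family_blowup[OF assms(4,5) i], of i] i assms(5)
    show "family_value \<phi> I ((blowup G J a i)(i := inv (a i))) =
        inv\<^bsub>H\<^esub> (family_value \<phi> I (blowup G J a i))" by auto
  qed (use closed in auto)
  also have "\<dots> = inv\<^bsub>H\<^esub> (\<Otimes>\<^bsub>H\<^esub>i\<in>J. family_value \<phi> I (blowup G J a i))"
  proof -
    have "(\<lambda>x. inv\<^bsub>H\<^esub> x) \<in> hom H H"
      by (rule homI) (simp_all add: H.inv_mult)
    from hom_finprod[OF assms(1,1) this, of J "\<lambda>i. family_value \<phi> I (blowup G J a i)"] closed
    show ?thesis by simp
  qed
  also have "\<dots> = inv\<^bsub>H\<^esub> (family_value \<phi> I a)"
    using family_value_blowup[OF assms(1,2,4-6)] by simp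
  finally show ?thesis
    using family_value_closed[OF assms(2,4)] by simp
qed

lemma symbols_family:
  assumes "as \<in> symbols n A"
  shows "is_family n A {..<length as} ((!) as)"
proof -
  have "set as = (!) as ` {..<length as}" by (auto simp: set_conv_nth)
  with assms show ?thesis by (auto simp: is_family_def symbols_iff)
qed

text \<open>Used to compare families indexed by \<open>insert k T\<close> and by \<open>insert i T\<close>.\<close>

lemma replace_point:
  assumes "i \<notin> T" "k \<notin> T"
  shows "inj_on (\<lambda>j. if j = k then i else j) (insert k T)"
    and "(\<lambda>j. if j = k then i else j) ` insert k T = insert i T"
  using assms by (auto simp: inj_on_def)

lemma nths_eq_map_filter: "nths xs I = map ((!) xs) (filter (\<lambda>i. i \<in> I) [0..<length xs])"
proof -
  have "zip xs [0..<length xs] = map (\<lambda>i. (xs ! i, i)) [0..<length xs]"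
    by (intro nth_equalityI) auto
  then show ?thesis
    by (simp add: nths_def filter_map comp_def)
qed

lemma mset_nths:
  assumes "I \<subseteq> {..<length xs}"
  shows "mset (nths xs I) = image_mset ((!) xs) (mset_set I)"
proof -
  have "set (filter (\<lambda>i. i \<in> I) [0..<length xs]) = I" using assms by auto
  then show ?thesis
    using mset_set_set[of "filter (\<lambda>i. i \<in> I) [0..<length xs]"] by (simp add: nths_eq_map_filter)
qed

lemma set_nths_image:
  assumes "I \<subseteq> {..<length xs}" shows "set (nths xs I) = (!) xs ` I"
  using assms by (auto simp: nths_eq_map_filter)

lemma length_nths_card:
  assumes "I \<subseteq> {..<length xs}" shows "length (nths xs I) = card I"
  using arg_cong[OF mset_nths[OF assms], of size] by simp

section \<open>The comultiplication of an exact sequence\<close>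

definition subsets_of_size :: "'i set \<Rightarrow> nat \<Rightarrow> 'i set set" where
  "subsets_of_size I k = {S. S \<subseteq> I \<and> card S = k}"

lemma finite_subsets_of_size: "finite I \<Longrightarrow> finite (subsets_of_size I k)"
  by (simp add: subsets_of_size_def)

context dual_sequence
begin

text \<open>The entries indexed by \<open>S\<close> vanish in \<open>A'\<close>, so the images of the others generate it.\<close>

lemma generates_quotient:
  assumes "generates A (a ` I)" "S \<subseteq> I" "a ` S \<subseteq> carrier A''"
  shows "generates A' ((\<pi> \<circ> a) ` (I - S))"
  unfolding \<pi>.H.generates_iff
proof (intro conjI allI impI)
  have a: "a ` I \<subseteq> carrier A" using assms(1) by (simp add: generates_def)
  then show "(\<pi> \<circ> a) ` (I - S) \<subseteq> carrier A'" by auto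
  fix H assume H: "subgroup H A'" "(\<pi> \<circ> a) ` (I - S) \<subseteq> H"
  interpret H: subgroup H A' by fact
  have sub: "subgroup {x \<in> carrier A. \<pi> x \<in> H} A"
    by (rule A.subgroupI) (auto intro!: exI[of _ "\<one>"])
  have "a ` I \<subseteq> {x \<in> carrier A. \<pi> x \<in> H}"
  proof clarify
    fix i assume i: "i \<in> I"
    show "a i \<in> carrier A \<and> \<pi> (a i) \<in> H"
    proof (cases "i \<in> S")
      case True
      then have "\<pi> (a i) = \<one>\<^bsub>A'\<^esub>" using assms(3) kernel_iff by blast
      then show ?thesis using a i by auto
    next
      case False
      then show ?thesis using a i H(2) by auto
    qed
  qed
  with sub assms(1) have "carrier A \<subseteq> {x \<in> carrier A. \<pi> x \<in> H}"
    unfolding A.generates_iff by blast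
  then show "carrier A' \<subseteq> H" unfolding surj[symmetric] by auto
qed

lemma split_families:
  assumes "is_family (n' + n'') A I a" "S \<in> subsets_of_size I n''" "generates A'' (a ` S)"
  shows "is_family n'' A'' S a" "is_family n' A' (I - S) (\<pi> \<circ> a)"
proof -
  have S: "S \<subseteq> I" "card S = n''" "finite S" "finite I" "card I = n' + n''" "generates A (a ` I)"
    using assms finite_subset by (auto simp: is_family_def subsets_of_size_def)
  then show "is_family n'' A'' S a" using assms(3) by (simp add: is_family_def)
  have "a ` S \<subseteq> carrier A''" using assms(3) by (simp add: generates_def)
  then show "is_family n' A' (I - S) (\<pi> \<circ> a)"
    using S generates_quotient[of a I S] by (simp add: is_family_def card_Diff_subset)
qed

lemma splittings_symbols:
  assumes "as \<in> symbols (n' + n'') A" "(I', I'', bs) \<in> splittings n' n'' A'' id as"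
  shows "map \<pi> (nths as I') \<in> symbols n' A'" "bs \<in> symbols n'' A''" "bs = nths as I''"
    "I'' \<in> subsets_of_size {..<length as} n''" "I' = {..<length as} - I''"
proof -
  have s: "I' \<union> I'' = {..<length as}" "I' \<inter> I'' = {}" "card I'' = n''" "bs \<in> symbols n'' A''" "map id bs = nths as I''"
    using assms(2) by (auto simp: splittings_def)
  then show bs: "bs \<in> symbols n'' A''" "bs = nths as I''"
    and I'': "I'' \<in> subsets_of_size {..<length as} n''" and I': "I' = {..<length as} - I''"
    by (auto simp: subsets_of_size_def)
  have sub: "I' \<subseteq> {..<length as}" "I'' \<subseteq> {..<length as}" using s(1) by auto
  note family = symbols_family[OF assms(1)]
  have "generates A'' ((!) as ` I'')"
    using bs set_nths_image[OF sub(2)] by (simp add: symbols_iff)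
  from split_families(2)[OF family I'' this]
  show "map \<pi> (nths as I') \<in> symbols n' A'"
    using set_nths_image[OF sub(1)] length_nths_card[OF sub(1)]
    by (simp add: is_family_def symbols_iff I'[symmetric] image_comp)
qed

lemma finite_splittings: "finite (splittings n' n'' A'' id as)"
proof (rule finite_subset)
  show "splittings n' n'' A'' id as \<subseteq>
      (\<lambda>(I', I''). (I', I'', nths as I'')) ` (Pow {..<length as} \<times> Pow {..<length as})"
    by (auto simp: splittings_def)
qed simp

end

text \<open>The coproduct formula with arbitrary modular symbols in place of the universal ones, followed by
  an arbitrary bilinear map in place of the tensor product.\<close>

locale coproduct_data = dual_sequence A A'' A' \<pi> + M': comm_group M' + M'': comm_group M'' + L: comm_group L
  for A :: "'a monoid" (structure) and A'' A' \<pi>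
    and M' :: "('b, 's) monoid_scheme" and M'' :: "('c, 't) monoid_scheme" and L :: "('d, 'u) monoid_scheme" +
  fixes n' n'' :: nat and \<phi>' \<phi>'' \<beta>
  assumes modular': "modular_symbol n' A' M' \<phi>'"
    and modular'': "modular_symbol n'' A'' M'' \<phi>''"
    and odd'': "odd_symbol n'' A'' M'' \<phi>''"
    and bilinear: "bilinear_map M' M'' L \<beta>"
begin

text \<open>The contribution of the partition of \<open>I\<close> into \<open>I - S\<close> and \<open>S\<close>, where \<open>S\<close> belongs to the second
  factor.  It is trivial when the entries in \<open>S\<close> do not form a symbol for \<open>A''\<close>; in this way the sums
  run over all subsets of a given size, and this range is the same for \<open>a\<close> and its blow-ups.\<close>

definition split_term :: "'i set \<Rightarrow> ('i \<Rightarrow> 'a) \<Rightarrow> 'i set \<Rightarrow> 'd" where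
  "split_term I a S = (if generates A'' (a ` S)
     then \<beta> (family_value \<phi>' (I - S) (\<pi> \<circ> a)) (family_value \<phi>'' S a) else \<one>\<^bsub>L\<^esub>)"

definition split_sum :: "'i set \<Rightarrow> ('i \<Rightarrow> 'a) \<Rightarrow> 'd" where
  "split_sum I a = (\<Otimes>\<^bsub>L\<^esub>S\<in>subsets_of_size I n''. split_term I a S)"

lemma split_term_closed:
  assumes "is_family (n' + n'') A I a" "S \<in> subsets_of_size I n''"
  shows "split_term I a S \<in> carrier L"
  unfolding split_term_def
  by (auto intro!: bilinear_map_closed[OF bilinear] family_value_closed[OF modular']
      family_value_closed[OF modular''] split_families[OF assms])

lemma split_sum_closed:
  assumes "is_family (n' + n'') A I a" shows "split_sum I a \<in> carrier L"
  unfolding split_sum_def using split_term_closed[OF assms] by (intro L.finprod_closed) auto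

lemma split_term_cong:
  assumes "\<And>i. i \<in> I \<Longrightarrow> a i = b i" "S \<subseteq> I"
  shows "split_term I a S = split_term I b S"
proof -
  have "a ` S = b ` S" using assms by (intro image_cong) auto
  moreover have "family_value \<phi>'' S a = family_value \<phi>'' S b"
    using assms by (intro family_value_cong) auto
  moreover have "family_value \<phi>' (I - S) (\<pi> \<circ> a) = family_value \<phi>' (I - S) (\<pi> \<circ> b)"
    using assms by (intro family_value_cong) auto
  ultimately show ?thesis by (simp add: split_term_def)
qed

lemma split_sum_cong:
  assumes "\<And>i. i \<in> I \<Longrightarrow> a i = b i" "is_family (n' + n'') A I b"
  shows "split_sum I a = split_sum I b"
  unfolding split_sum_def using split_term_closed[OF assms(2)] split_term_cong[OF assms(1)]
  by (intro L.finprod_cong') (auto simp: subsets_of_size_def)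

lemma split_sum_reindex:
  assumes "inj_on p I" "is_family (n' + n'') A (p ` I) a"
  shows "split_sum (p ` I) a = split_sum I (a \<circ> p)"
proof -
  have bij: "bij_betw ((`) p) (subsets_of_size I n'') (subsets_of_size (p ` I) n'')"
    unfolding bij_betw_def
  proof
    show "inj_on ((`) p) (subsets_of_size I n'')"
      using inj_on_image_Pow[OF assms(1)] by (rule inj_on_subset) (auto simp: subsets_of_size_def)
    show "(`) p ` subsets_of_size I n'' = subsets_of_size (p ` I) n''"
    proof (intro equalityI subsetI)
      fix T assume "T \<in> (`) p ` subsets_of_size I n''"
      then show "T \<in> subsets_of_size (p ` I) n''"
        using card_image[OF inj_on_subset[OF assms(1)]] by (auto simp: subsets_of_size_def)
    next
      fix T assume T: "T \<in> subsets_of_size (p ` I) n''"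
      then obtain S where S: "S \<subseteq> I" "T = p ` S"
        by (auto simp: subsets_of_size_def subset_image_iff)
      with T card_image[OF inj_on_subset[OF assms(1) S(1)]]
      show "T \<in> (`) p ` subsets_of_size I n''" by (auto simp: subsets_of_size_def)
    qed
  qed
  have on_image: "split_term (p ` I) a (p ` S) = split_term I (a \<circ> p) S" if "S \<subseteq> I" for S
  proof -
    have inj: "inj_on p S" "inj_on p (I - S)" using assms(1) that by (auto intro: inj_on_subset)
    have "p ` I - p ` S = p ` (I - S)"
      using inj_on_image_set_diff[OF assms(1) _ that] by auto
    then show ?thesis
      using inj by (simp add: split_term_def family_value_reindex image_comp comp_assoc)
  qed
  have "split_sum I (a \<circ> p) = (\<Otimes>\<^bsub>L\<^esub>S\<in>subsets_of_size I n''. split_term (p ` I) a (p ` S))"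
    unfolding split_sum_def
    using split_term_closed[OF assms(2) bij_betw_apply[OF bij]] on_image
    by (intro L.finprod_cong') (auto simp: subsets_of_size_def)
  also have "\<dots> = split_sum (p ` I) a"
    unfolding split_sum_def using split_term_closed[OF assms(2)]
    by (intro L.finprod_bij[OF bij])
  finally show ?thesis by simp
qed

context
  fixes I :: "'i set" and a :: "'i \<Rightarrow> 'a" and J :: "'i set"
  assumes family: "is_family (n' + n'') A I a" and J: "J \<subseteq> I"
begin

lemma finite_index: "finite I" "finite J"
  using family J finite_subset by (auto simp: is_family_def)

lemma entry_closed: "i \<in> I \<Longrightarrow> a i \<in> carrier A"
  using family by (auto simp: is_family_def generates_def)

lemma blowup_family: "i \<in> J \<Longrightarrow> is_family (n' + n'') A I (blowup A J a i)"
  by (rule A.is_family_blowup[OF family J])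

lemma blowup_term_closed:
  "i \<in> J \<Longrightarrow> S \<in> subsets_of_size I n'' \<Longrightarrow> split_term I (blowup A J a i) S \<in> carrier L"
  by (rule split_term_closed[OF blowup_family])

text \<open>If \<open>i \<in> S\<close>, then \<open>S\<close> contributes to the coproduct of the blow-up at \<open>i\<close> iff it contributes to
  that of \<open>a\<close>.\<close>

lemma generates_kernel_blowup:
  assumes "S \<subseteq> I" "i \<in> J \<inter> S"
  shows "generates A'' (blowup A J a i ` S) \<longleftrightarrow> generates A'' (a ` S)"
proof -
  have iff: "blowup A J a i ` S \<subseteq> H \<longleftrightarrow> a ` S \<subseteq> H" if "subgroup H A" for H
  proof -
    have "blowup A J a i ` S = blowup A (J \<inter> S) a i ` S"
      by (intro image_cong) (auto simp: blowup_def)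
    then show ?thesis
      using A.blowup_subset_iff[OF that, of a S "J \<inter> S" i] assms entry_closed by auto
  qed
  show ?thesis
    unfolding \<iota>.G.generates_iff by (simp add: iff[OF subgroup_kernel] iff[OF subgroup_sub])
qed

text \<open>If \<open>S\<close> contributes, then \<open>a\<^sub>i\<close> lies in the kernel of \<open>\<pi>\<close> for \<open>i \<in> S\<close>, so that only the second
  factor is blown up.\<close>

lemma split_terms_inside:
  assumes S: "S \<in> subsets_of_size I n''" and nonempty: "J \<inter> S \<noteq> {}"
  shows "(\<Otimes>\<^bsub>L\<^esub>i\<in>J \<inter> S. split_term I (blowup A J a i) S) = split_term I a S"
proof (cases "generates A'' (a ` S)")
  case False
  then show ?thesis
    using generates_kernel_blowup S by (auto simp: split_term_def subsets_of_size_def intro!: L.finprod_one_eqI)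
next
  case True
  have SI: "S \<subseteq> I" using S by (simp add: subsets_of_size_def)
  have aS: "a i \<in> carrier A''" if "i \<in> S" for i
    using True that by (auto simp: generates_def)
  note fam = split_families[OF family S True]
  let ?x = "family_value \<phi>' (I - S) (\<pi> \<circ> a)"
  have x: "?x \<in> carrier M'" using fam(2) by (rule family_value_closed[OF modular'])
  have y: "family_value \<phi>'' S (blowup A'' (J \<inter> S) a i) \<in> carrier M''" if "i \<in> J \<inter> S" for i
    using \<iota>.G.is_family_blowup[OF fam(1) _ that] by (intro family_value_closed[OF modular'']) auto
  have "split_term I (blowup A J a i) S = \<beta> ?x (family_value \<phi>'' S (blowup A'' (J \<inter> S) a i))"
    if i: "i \<in> J \<inter> S" for i
  proof -
    have pi: "\<pi> (a i) = \<one>\<^bsub>A'\<^esub>" using aS i kernel_iff by blast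
    have "family_value \<phi>' (I - S) (\<pi> \<circ> blowup A J a i) = ?x"
      using i SI entry_closed pi by (intro family_value_cong) (auto simp: blowup_def)
    moreover have "family_value \<phi>'' S (blowup A J a i) = family_value \<phi>'' S (blowup A'' (J \<inter> S) a i)"
      using i aS \<iota>.G.inv_closed
      by (intro family_value_cong) (auto simp: blowup_def sub_mult sub_inv[symmetric])
    ultimately show ?thesis
      using generates_kernel_blowup[OF SI i] True by (simp add: split_term_def)
  qed
  then have "(\<Otimes>\<^bsub>L\<^esub>i\<in>J \<inter> S. split_term I (blowup A J a i) S) =
      (\<Otimes>\<^bsub>L\<^esub>i\<in>J \<inter> S. \<beta> ?x (family_value \<phi>'' S (blowup A'' (J \<inter> S) a i)))"
    using bilinear_map_closed[OF bilinear x y] by (intro L.finprod_cong') auto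
  also have "\<dots> = \<beta> ?x (\<Otimes>\<^bsub>M''\<^esub>i\<in>J \<inter> S. family_value \<phi>'' S (blowup A'' (J \<inter> S) a i))"
    using x y by (intro bilinear_map_finprod_right[OF M''.comm_group_axioms L.comm_group_axioms bilinear, symmetric])
  also have "\<dots> = \<beta> ?x (family_value \<phi>'' S a)"
    using \<iota>.G.family_value_blowup[OF M''.comm_group_axioms modular'' fam(1), of "J \<inter> S"] nonempty by simp
  finally show ?thesis using True by (simp add: split_term_def)
qed

text \<open>No entry of the second factor is changed, and the first factor is blown up at all of \<open>J\<close>.\<close>

lemma split_terms_outside:
  assumes S: "S \<in> subsets_of_size I n''" and disjoint: "J \<inter> S = {}" and nonempty: "J \<noteq> {}"
  shows "(\<Otimes>\<^bsub>L\<^esub>i\<in>J. split_term I (blowup A J a i) S) = split_term I a S"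
proof -
  have on_S: "blowup A J a i j = a j" if "j \<in> S" for i j
    using disjoint that by (auto simp: blowup_def)
  have gen: "generates A'' (blowup A J a i ` S) \<longleftrightarrow> generates A'' (a ` S)" for i
    using on_S by (simp cong: image_cong)
  show ?thesis
  proof (cases "generates A'' (a ` S)")
    case False
    then show ?thesis
      by (auto simp: split_term_def gen intro!: L.finprod_one_eqI)
  next
    case True
    have SI: "S \<subseteq> I" using S by (simp add: subsets_of_size_def)
    have JS: "J \<subseteq> I - S" using J disjoint by auto
    note fam = split_families[OF family S True]
    let ?y = "family_value \<phi>'' S a"
    have y: "?y \<in> carrier M''" using fam(1) by (rule family_value_closed[OF modular''])
    have x: "family_value \<phi>' (I - S) (blowup A' J (\<pi> \<circ> a) i) \<in> carrier M'" if "i \<in> J" for i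
      using \<pi>.H.is_family_blowup[OF fam(2) JS that] by (rule family_value_closed[OF modular'])
    have "split_term I (blowup A J a i) S = \<beta> (family_value \<phi>' (I - S) (blowup A' J (\<pi> \<circ> a) i)) ?y"
      if i: "i \<in> J" for i
    proof -
      have "family_value \<phi>' (I - S) (\<pi> \<circ> blowup A J a i) = family_value \<phi>' (I - S) (blowup A' J (\<pi> \<circ> a) i)"
        using i J entry_closed by (intro family_value_cong) (auto simp: blowup_def)
      moreover have "family_value \<phi>'' S (blowup A J a i) = ?y"
        using on_S by (rule family_value_cong)
      ultimately show ?thesis
        using gen True by (simp add: split_term_def)
    qed
    then have "(\<Otimes>\<^bsub>L\<^esub>i\<in>J. split_term I (blowup A J a i) S) =
        (\<Otimes>\<^bsub>L\<^esub>i\<in>J. \<beta> (family_value \<phi>' (I - S) (blowup A' J (\<pi> \<circ> a) i)) ?y)"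
      using bilinear_map_closed[OF bilinear x y] by (intro L.finprod_cong') auto
    also have "\<dots> = \<beta> (\<Otimes>\<^bsub>M'\<^esub>i\<in>J. family_value \<phi>' (I - S) (blowup A' J (\<pi> \<circ> a) i)) ?y"
      using x y by (intro bilinear_map_finprod_left[OF M'.comm_group_axioms L.comm_group_axioms bilinear, symmetric])
    also have "\<dots> = \<beta> (family_value \<phi>' (I - S) (\<pi> \<circ> a)) ?y"
      using \<pi>.H.family_value_blowup[OF M'.comm_group_axioms modular' fam(2) JS nonempty] by simp
    finally show ?thesis using True by (simp add: split_term_def)
  qed
qed

text \<open>Suppose that the pair \<open>(C - {k}, k)\<close> contributes.  Then the entries \<open>a\<^sub>i\<close> for \<open>i \<in> C \<inter> J\<close> are
  congruent to \<open>a\<^sub>k\<close> modulo \<open>A''\<close>, so all pairs \<open>(C - {i}, i)\<close> have the same first factor.  The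
  blow-up at \<open>k\<close> restricts to a family \<open>c\<close> in \<open>A''\<close>, indexed by \<open>C - {k}\<close>, and the second factors
  are those of \<open>odd_symbol_cancellation\<close> for \<open>c\<close>.\<close>

lemma split_terms_cancel:
  assumes C: "C \<subseteq> I" "card C = Suc n''" and two: "2 \<le> card (C \<inter> J)"
  shows "(\<Otimes>\<^bsub>L\<^esub>i\<in>C \<inter> J. split_term I (blowup A J a i) (C - {i})) = \<one>\<^bsub>L\<^esub>"
proof (cases "\<exists>k\<in>C \<inter> J. generates A'' (blowup A J a k ` (C - {k}))")
  case False
  then show ?thesis
    by (auto simp: split_term_def intro!: L.finprod_one_eqI)
next
  case True
  then obtain k where k: "k \<in> C" "k \<in> J" "k \<in> I" and gen: "generates A'' (blowup A J a k ` (C - {k}))"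
    using J by auto
  define D where "D = C \<inter> J - {k}"
  define C' where "C' = C - {k}"
  define c where "c = blowup A J a k"
  define e where "e = (\<lambda>i. (blowup A'' D c i)(i := inv\<^bsub>A''\<^esub> (c i)))"
  have finC: "finite C" using C(1) finite_index finite_subset by blast
  have KD: "C \<inter> J = insert k D" "k \<notin> D" using k by (auto simp: D_def)
  have D: "D \<subseteq> C'" "finite D" by (auto simp: D_def C'_def finC)
  have D_nonempty: "D \<noteq> {}" using two KD by auto
  have C': "C' \<in> subsets_of_size I n''"
    using C k finC by (auto simp: C'_def subsets_of_size_def)
  note fam = split_families[OF blowup_family[OF k(2)] C' gen[folded C'_def]]
  have fam'': "is_family n'' A'' C' c" using fam(1) by (simp add: c_def)
  have c_closed: "c j \<in> carrier A''" if "j \<in> C'" for j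
    using fam'' that by (auto simp: is_family_def generates_def)
  have c_D: "c i = a i \<otimes> inv (a k)" if "i \<in> D" for i
    using that by (auto simp: c_def D_def blowup_def)
  have aD: "a i \<in> carrier A" if "i \<in> insert k D" for i
    using that k C(1) by (intro entry_closed) (auto simp: D_def)
  have pi: "\<pi> (a i) = \<pi> (a k)" if "i \<in> insert k D" for i
  proof (cases "i = k")
    case False
    with that have i: "i \<in> D" by simp
    have "\<pi> (a i \<otimes> inv (a k)) = \<one>\<^bsub>A'\<^esub>"
      using c_closed[of i] i D c_D[OF i] kernel_iff by auto
    then have "\<pi> (a i) \<otimes>\<^bsub>A'\<^esub> inv\<^bsub>A'\<^esub> \<pi> (a k) = \<one>\<^bsub>A'\<^esub>"
      using aD[of i] aD[of k] i by simp
    then show ?thesis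
      using aD[of i] aD[of k] i \<pi>.H.inv_solve_right'[of "\<one>\<^bsub>A'\<^esub>" "\<pi> (a i)" "\<pi> (a k)"] by simp
  qed simp
  have e_family: "is_family n'' A'' C' (e i)" if i: "i \<in> D" for i
  proof -
    have "is_family n'' A'' C' (blowup A'' D c i)"
      using D(1) i by (intro \<iota>.G.is_family_blowup[OF fam''])
    from \<iota>.G.is_family_inv_entry[OF this, of i] i D(1)
    show ?thesis by (auto simp: e_def blowup_def)
  qed
  let ?x = "family_value \<phi>' (I - C') (\<pi> \<circ> c)"
  have x: "?x \<in> carrier M'"
    using family_value_closed[OF modular' fam(2)] by (simp add: c_def)
  \<comment> \<open>\<open>y i\<close> is the second factor for \<open>S = C - {i}\<close>, as a family indexed by \<open>C - {k}\<close> for all \<open>i\<close>.\<close>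
  define y where "y = (\<lambda>i. if i = k then family_value \<phi>'' C' c else family_value \<phi>'' C' (e i))"
  have y: "y i \<in> carrier M''" if "i \<in> insert k D" for i
    using that family_value_closed[OF modular''] fam'' e_family by (auto simp: y_def)
  have term_eq: "split_term I (blowup A J a i) (C - {i}) = \<beta> ?x (y i)" if i: "i \<in> insert k D" for i
  proof (cases "i = k")
    case True
    then show ?thesis
      using gen by (simp add: split_term_def y_def c_def C'_def)
  next
    case False
    with i have i: "i \<in> D" by simp
    have i': "i \<in> C" "i \<in> J" "i \<noteq> k" "i \<in> I" using i C(1) by (auto simp: D_def)
    \<comment> \<open>\<open>p\<close> puts \<open>i\<close> in the place of \<open>k\<close> and \<open>q\<close> puts \<open>k\<close> in the place of \<open>i\<close>; they carry the index sets for \<open>k\<close> to those for \<open>i\<close>.\<close>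
    define p where "p = (\<lambda>j. if j = k then i else j)"
    define q where "q = (\<lambda>j. if j = i then k else j)"
    have sets: "I - C' = insert k (I - C)" "I - (C - {i}) = insert i (I - C)"
      "C' = insert i (C - {i, k})" "C - {i} = insert k (C - {i, k})"
      using i' k by (auto simp: C'_def)
    have p: "inj_on p (I - C')" "p ` (I - C') = I - (C - {i})"
      unfolding p_def sets(1,2) using i' k by (intro replace_point; simp)+
    have q: "inj_on q C'" "q ` C' = C - {i}"
      unfolding q_def sets(4) by (subst sets(3), intro replace_point; simp)+
    have "family_value \<phi>' (I - (C - {i})) (\<pi> \<circ> blowup A J a i) =
        family_value \<phi>' (I - C') (\<pi> \<circ> blowup A J a i \<circ> p)"
      using family_value_reindex[OF p(1), of \<phi>' "\<pi> \<circ> blowup A J a i"] p(2) by simp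
    also have "\<dots> = ?x"
    proof (rule family_value_cong)
      fix j assume "j \<in> I - C'"
      then consider "j = k" | "j \<in> I" "j \<notin> C" using sets(1) by blast
      then show "(\<pi> \<circ> blowup A J a i \<circ> p) j = (\<pi> \<circ> c) j"
      proof cases
        case 1
        then show ?thesis using pi[of i] i by (simp add: p_def c_def blowup_def)
      next
        case 2
        then have j: "p j = j" "j \<noteq> i" "j \<noteq> k" using i' k by (auto simp: p_def)
        have "a i \<in> carrier A" "a j \<in> carrier A" "a k \<in> carrier A" "\<pi> (a i) = \<pi> (a k)"
          using aD[of i] aD[of k] i entry_closed[OF 2(1)] pi[of i] by simp_all
        then show ?thesis using j by (simp add: c_def blowup_def)
      qed
    qed
    finally have value': "family_value \<phi>' (I - (C - {i})) (\<pi> \<circ> blowup A J a i) = ?x" .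
    have on_C': "(blowup A J a i \<circ> q) j = e i j" if j: "j \<in> C'" for j
    proof -
      consider "j = i" | "j \<noteq> i" "j \<in> D" | "j \<noteq> i" "j \<notin> D" by blast
      then show ?thesis
      proof cases
        case 1
        have "inv\<^bsub>A''\<^esub> (c i) = inv (a i \<otimes> inv (a k))"
          using c_closed[of i] i D c_D by (auto simp: sub_inv)
        also have "\<dots> = a k \<otimes> inv (a i)"
          using aD[of i] aD[of k] i by (simp add: A.inv_mult_group)
        finally show ?thesis using 1 k i' by (simp add: q_def e_def blowup_def)
      next
        case 2
        have cj: "c j \<in> carrier A''" "c i \<in> carrier A''" using 2 i D c_closed by auto
        have "c j \<otimes>\<^bsub>A''\<^esub> inv\<^bsub>A''\<^esub> (c i) = c j \<otimes> inv (c i)"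
          using cj \<iota>.G.inv_closed[OF cj(2)] sub_mult sub_inv[OF cj(2)] by simp
        also have "\<dots> = (a j \<otimes> inv (a k)) \<otimes> (a k \<otimes> inv (a i))"
          using aD[of i] aD[of k] i c_D 2 by (simp add: A.inv_mult_group)
        also have "\<dots> = a j \<otimes> inv (a i)"
          using aD[of i] aD[of j] aD[of k] i 2 by (simp add: A.m_assoc A.inv_solve_left')
        finally show ?thesis using 2 by (auto simp: q_def e_def blowup_def D_def)
      next
        case 3
        then show ?thesis using j by (auto simp: q_def e_def blowup_def D_def C'_def c_def)
      qed
    qed
    have "family_value \<phi>'' (C - {i}) (blowup A J a i) = family_value \<phi>'' C' (blowup A J a i \<circ> q)"
      using family_value_reindex[OF q(1), of \<phi>'' "blowup A J a i"] q(2) by simp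
    also have "\<dots> = y i"
      using on_C' i' unfolding y_def by (simp cong: family_value_cong)
    finally have value'': "family_value \<phi>'' (C - {i}) (blowup A J a i) = y i" .
    have "blowup A J a i ` (C - {i}) = e i ` C'"
      using on_C' by (simp add: q(2)[symmetric] image_comp cong: image_cong)
    then have "generates A'' (blowup A J a i ` (C - {i}))"
      using e_family[OF i] by (simp add: is_family_def)
    then show ?thesis by (simp add: split_term_def value' value'')
  qed
  have "(\<Otimes>\<^bsub>L\<^esub>i\<in>C \<inter> J. split_term I (blowup A J a i) (C - {i})) = (\<Otimes>\<^bsub>L\<^esub>i\<in>insert k D. \<beta> ?x (y i))"
    unfolding KD(1) using bilinear_map_closed[OF bilinear x y] term_eq by (intro L.finprod_cong') auto
  also have "\<dots> = \<beta> ?x (\<Otimes>\<^bsub>M''\<^esub>i\<in>insert k D. y i)"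
    using x y by (intro bilinear_map_finprod_right[OF M''.comm_group_axioms L.comm_group_axioms bilinear, symmetric])
  also have "(\<Otimes>\<^bsub>M''\<^esub>i\<in>insert k D. y i) = y k \<otimes>\<^bsub>M''\<^esub> (\<Otimes>\<^bsub>M''\<^esub>i\<in>D. y i)"
    using y D(2) KD(2) by (intro M''.finprod_insert) auto
  also have "(\<Otimes>\<^bsub>M''\<^esub>i\<in>D. y i) = (\<Otimes>\<^bsub>M''\<^esub>i\<in>D. family_value \<phi>'' C' (e i))"
    using KD(2) family_value_closed[OF modular'' e_family] by (intro M''.finprod_cong') (auto simp: y_def)
  also have "y k \<otimes>\<^bsub>M''\<^esub> \<dots> = \<one>\<^bsub>M''\<^esub>"
    using \<iota>.G.odd_symbol_cancellation[OF M''.comm_group_axioms modular'' odd'' fam'' D(1) D_nonempty]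
    by (simp add: y_def e_def)
  also have "\<beta> ?x \<one>\<^bsub>M''\<^esub> = \<one>\<^bsub>L\<^esub>"
    using bilinear x unfolding bilinear_map_def
    by (blast intro: hom_one[OF _ M''.is_group L.is_group])
  finally show ?thesis .
qed

text \<open>For each \<open>S\<close>, the pairs \<open>(S, i)\<close> add up to the contribution of \<open>S\<close> to the coproduct of \<open>a\<close> and a
  remainder \<open>u S\<close>, which consists of the pairs with \<open>i \<notin> S\<close> if \<open>S\<close> meets \<open>J\<close>.  The remainders are
  rearranged according to \<open>C = S \<union> {i}\<close> and cancel.\<close>

lemma split_sum_blowup:
  assumes nonempty: "J \<noteq> {}"
  shows "split_sum I a = (\<Otimes>\<^bsub>L\<^esub>i\<in>J. split_sum I (blowup A J a i))"
proof -
  let ?P = "subsets_of_size I n''"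
  let ?t = "\<lambda>S i. split_term I (blowup A J a i) S"
  define P' where "P' = {S \<in> ?P. J \<inter> S \<noteq> {}}"
  define Q where "Q = {C \<in> subsets_of_size I (Suc n''). 2 \<le> card (C \<inter> J)}"
  define u where "u = (\<lambda>S. if S \<in> P' then (\<Otimes>\<^bsub>L\<^esub>i\<in>J - S. ?t S i) else \<one>\<^bsub>L\<^esub>)"
  have finP: "finite ?P" and finP': "finite P'" and finQ: "finite Q"
    using finite_subsets_of_size[OF finite_index(1)] by (auto simp: P'_def Q_def)
  have u_closed: "u S \<in> carrier L" if "S \<in> ?P" for S
    using that blowup_term_closed by (auto simp: u_def intro!: L.finprod_closed)
  have inner: "(\<Otimes>\<^bsub>L\<^esub>i\<in>J. ?t S i) = split_term I a S \<otimes>\<^bsub>L\<^esub> u S" if S: "S \<in> ?P" for S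
  proof (cases "J \<inter> S = {}")
    case True
    then show ?thesis
      using split_terms_outside[OF S _ nonempty] split_term_closed[OF family S] by (simp add: u_def P'_def)
  next
    case False
    have "(\<Otimes>\<^bsub>L\<^esub>i\<in>(J \<inter> S) \<union> (J - S). ?t S i) = (\<Otimes>\<^bsub>L\<^esub>i\<in>J \<inter> S. ?t S i) \<otimes>\<^bsub>L\<^esub> (\<Otimes>\<^bsub>L\<^esub>i\<in>J - S. ?t S i)"
      using blowup_term_closed[OF _ S] finite_index by (intro L.finprod_Un_disjoint) auto
    also have "(J \<inter> S) \<union> (J - S) = J" by auto
    finally show ?thesis
      using split_terms_inside[OF S False] S False by (simp add: u_def P'_def)
  qed
  have bij: "bij_betw (\<lambda>(S, i). (insert i S, i)) (Sigma P' (\<lambda>S. J - S)) (Sigma Q (\<lambda>C. C \<inter> J))"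
  proof (rule bij_betw_byWitness[where f' = "\<lambda>(C, i). (C - {i}, i)"])
    show "(\<lambda>(S, i). (insert i S, i)) ` Sigma P' (\<lambda>S. J - S) \<subseteq> Sigma Q (\<lambda>C. C \<inter> J)"
    proof
      fix q assume "q \<in> (\<lambda>(S, i). (insert i S, i)) ` Sigma P' (\<lambda>S. J - S)"
      then obtain S i where q: "q = (insert i S, i)" and S: "S \<in> P'" and i: "i \<in> J" "i \<notin> S"
        by auto
      from S have "S \<subseteq> I" "card S = n''" "J \<inter> S \<noteq> {}" by (auto simp: P'_def subsets_of_size_def)
      moreover have finS: "finite S" using \<open>S \<subseteq> I\<close> finite_index finite_subset by blast
      moreover have "2 \<le> card (insert i S \<inter> J)"
      proof -
        have "0 < card (J \<inter> S)" using \<open>J \<inter> S \<noteq> {}\<close> finS by (simp add: card_gt_0_iff)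
        moreover have "card (insert i (J \<inter> S)) = Suc (card (J \<inter> S))" using i finS by simp
        ultimately have "2 \<le> card (insert i (J \<inter> S))" by linarith
        also have "insert i (J \<inter> S) = insert i S \<inter> J" using i by auto
        finally show ?thesis .
      qed
      ultimately show "q \<in> Sigma Q (\<lambda>C. C \<inter> J)"
        unfolding q using i J by (auto simp: Q_def subsets_of_size_def)
    qed
    show "(\<lambda>(C, i). (C - {i}, i)) ` Sigma Q (\<lambda>C. C \<inter> J) \<subseteq> Sigma P' (\<lambda>S. J - S)"
    proof
      fix q assume "q \<in> (\<lambda>(C, i). (C - {i}, i)) ` Sigma Q (\<lambda>C. C \<inter> J)"
      then obtain C i where q: "q = (C - {i}, i)" and C: "C \<in> Q" and i: "i \<in> C" "i \<in> J"
        by auto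
      have finC: "finite C" using C finite_index finite_subset by (auto simp: Q_def subsets_of_size_def)
      have "C \<inter> J \<noteq> {i}" using C by (auto simp: Q_def)
      with C i finC show "q \<in> Sigma P' (\<lambda>S. J - S)"
        unfolding q by (auto simp: P'_def Q_def subsets_of_size_def)
    qed
  qed (auto simp: insert_absorb)
  have "(\<Otimes>\<^bsub>L\<^esub>S\<in>?P. u S) = (\<Otimes>\<^bsub>L\<^esub>S\<in>P'. \<Otimes>\<^bsub>L\<^esub>i\<in>J - S. ?t S i)"
    using finP u_closed by (intro L.finprod_mono_neutral_cong_right) (auto simp: u_def P'_def)
  also have "\<dots> = (\<Otimes>\<^bsub>L\<^esub>p\<in>Sigma P' (\<lambda>S. J - S). ?t (fst p) (snd p))"
    using finP' finite_index blowup_term_closed by (intro L.finprod_Sigma[symmetric]) (auto simp: P'_def)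
  also have "\<dots> = (\<Otimes>\<^bsub>L\<^esub>p\<in>Sigma P' (\<lambda>S. J - S).
      (\<lambda>q. ?t (fst q - {snd q}) (snd q)) ((\<lambda>(S, i). (insert i S, i)) p))"
    using blowup_term_closed by (intro L.finprod_cong') (auto simp: P'_def)
  also have "\<dots> = (\<Otimes>\<^bsub>L\<^esub>q\<in>Sigma Q (\<lambda>C. C \<inter> J). ?t (fst q - {snd q}) (snd q))"
  proof (rule L.finprod_bij[OF bij])
    fix q assume "q \<in> Sigma Q (\<lambda>C. C \<inter> J)"
    then have "fst q - {snd q} \<in> ?P" "snd q \<in> J"
      using finite_subset[OF _ finite_index(1)] by (auto simp: Q_def subsets_of_size_def)
    then show "?t (fst q - {snd q}) (snd q) \<in> carrier L" by (intro blowup_term_closed)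
  qed
  also have "\<dots> = (\<Otimes>\<^bsub>L\<^esub>C\<in>Q. \<Otimes>\<^bsub>L\<^esub>i\<in>C \<inter> J. ?t (C - {i}) i)"
  proof (rule L.finprod_Sigma)
    fix C i assume "C \<in> Q" "i \<in> C \<inter> J"
    then have "C - {i} \<in> ?P" "i \<in> J"
      using finite_subset[OF _ finite_index(1)] by (auto simp: Q_def subsets_of_size_def)
    then show "?t (C - {i}) i \<in> carrier L" by (intro blowup_term_closed)
  qed (use finQ finite_index in auto)
  also have "\<dots> = \<one>\<^bsub>L\<^esub>"
    by (intro L.finprod_one_eqI split_terms_cancel) (auto simp: Q_def subsets_of_size_def)
  finally have u_sum: "(\<Otimes>\<^bsub>L\<^esub>S\<in>?P. u S) = \<one>\<^bsub>L\<^esub>" .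
  have "(\<Otimes>\<^bsub>L\<^esub>i\<in>J. split_sum I (blowup A J a i)) = (\<Otimes>\<^bsub>L\<^esub>S\<in>?P. \<Otimes>\<^bsub>L\<^esub>i\<in>J. ?t S i)"
    unfolding split_sum_def using finite_index finP blowup_term_closed by (intro L.finprod_swap)
  also have "\<dots> = (\<Otimes>\<^bsub>L\<^esub>S\<in>?P. split_term I a S \<otimes>\<^bsub>L\<^esub> u S)"
    using inner split_term_closed[OF family] u_closed by (intro L.finprod_cong') auto
  also have "\<dots> = split_sum I a \<otimes>\<^bsub>L\<^esub> (\<Otimes>\<^bsub>L\<^esub>S\<in>?P. u S)"
    unfolding split_sum_def using split_term_closed[OF family] u_closed by (intro L.finprod_multf) auto
  also have "\<dots> = split_sum I a"
    using split_sum_closed[OF family] by (simp add: u_sum)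
  finally show ?thesis by simp
qed

end

text \<open>Tuples are families indexed by initial segments; permuting a tuple reindexes the family, and the
  blow-up relation changes the entries of an initial segment.\<close>

lemma modular_split_sum:
  "modular_symbol (n' + n'') A L (\<lambda>as. split_sum {..<length as} ((!) as))"
  unfolding modular_symbol_def
proof (intro conjI ballI allI impI)
  note family = symbols_family[of _ "n' + n''" A]
  {
    fix as assume as: "as \<in> symbols (n' + n'') A"
    show "split_sum {..<length as} ((!) as) \<in> carrier L"
      by (rule split_sum_closed[OF family[OF as]])
    fix bs assume "mset bs = mset as"
    then obtain p where p: "p permutes {..<length as}" "permute_list p as = bs"
      by (rule mset_eq_permutation)
    have image: "p ` {..<length as} = {..<length as}" and inj: "inj_on p {..<length as}"
      using permutes_image[OF p(1)] permutes_inj_on[OF p(1)] by auto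
    have length: "length bs = length as" using p by auto
    have "split_sum {..<length bs} ((!) bs) = split_sum {..<length as} ((!) as \<circ> p)"
      unfolding length
    proof (rule split_sum_cong[symmetric])
      show "((!) as \<circ> p) i = bs ! i" if "i \<in> {..<length as}" for i
        using p that by (auto simp: permute_list_nth)
      show "is_family (n' + n'') A {..<length as} ((!) bs)"
        using family[of bs] symbols_mset_cong[OF \<open>mset bs = mset as\<close>] as length by metis
    qed
    also have "\<dots> = split_sum {..<length as} ((!) as)"
      using split_sum_reindex[OF inj, of "(!) as"] family[OF as] by (simp add: image)
    finally show "split_sum {..<length bs} ((!) bs) = split_sum {..<length as} ((!) as)" .
  }
  fix as bs assume as: "2 \<le> length as" "as @ bs \<in> symbols (n' + n'') A"
  let ?I = "{..<length (as @ bs)}"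
  have J: "{..<length as} \<subseteq> ?I" by auto
  have "split_sum ?I ((!) (as @ bs)) =
      (\<Otimes>\<^bsub>L\<^esub>i\<in>{..<length as}. split_sum ?I (blowup A {..<length as} ((!) (as @ bs)) i))"
    using as(1) by (intro split_sum_blowup[OF family[OF as(2)] J]) (auto simp: lessThan_empty_iff)
  also have "\<dots> = (\<Otimes>\<^bsub>L\<^esub>i\<in>{..<length as}. split_sum {..<length (blowup_entries A as i @ bs)}
      ((!) (blowup_entries A as i @ bs)))"
  proof (rule L.finprod_cong')
    fix i assume "i \<in> {..<length as}"
    then have i: "i < length as" by simp
    have length: "length (blowup_entries A as i @ bs) = length (as @ bs)" by simp
    note fam = family[OF A.blowup_entries_symbols[OF as(2) i], unfolded length]
    show "split_sum ?I (blowup A {..<length as} ((!) (as @ bs)) i) =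
        split_sum {..<length (blowup_entries A as i @ bs)} ((!) (blowup_entries A as i @ bs))"
      unfolding length
    proof (rule split_sum_cong[OF _ fam])
      show "blowup A {..<length as} ((!) (as @ bs)) i j = (blowup_entries A as i @ bs) ! j"
        if "j \<in> ?I" for j
        using i that by (auto simp: blowup_entries_eq blowup_def nth_append)
    qed
  qed (use split_sum_closed[OF family[OF A.blowup_entries_symbols[OF as(2)]]] in auto)
  finally show "split_sum ?I ((!) (as @ bs)) = \<dots>" .
qed

text \<open>The splittings are the subsets whose entries form a symbol for \<open>A''\<close>, and all other terms of the
  sum over subsets are trivial.\<close>

lemma split_sum_eq_splittings:
  assumes as: "as \<in> symbols (n' + n'') A"
  shows "split_sum {..<length as} ((!) as) =
    finprod L (\<lambda>(I', I'', bs). \<beta> (\<phi>' (map \<pi> (nths as I'))) (\<phi>'' bs)) (splittings n' n'' A'' id as)"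
proof -
  let ?I = "{..<length as}" and ?a = "(!) as"
  let ?t = "\<lambda>(I', I'', bs). \<beta> (\<phi>' (map \<pi> (nths as I'))) (\<phi>'' bs)"
  note family = symbols_family[OF as]
  define P where "P = {S \<in> subsets_of_size ?I n''. generates A'' (?a ` S)}"
  have bij: "bij_betw (\<lambda>S. (?I - S, S, nths as S)) P (splittings n' n'' A'' id as)"
  proof (rule bij_betw_byWitness[where f' = "\<lambda>(I', I'', bs). I''"])
    show "(\<lambda>S. (?I - S, S, nths as S)) ` P \<subseteq> splittings n' n'' A'' id as"
    proof
      fix s assume "s \<in> (\<lambda>S. (?I - S, S, nths as S)) ` P"
      then obtain S where s: "s = (?I - S, S, nths as S)" and S: "S \<subseteq> ?I" "card S = n''"
        and gen: "generates A'' (?a ` S)" by (auto simp: P_def subsets_of_size_def)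
      have "nths as S \<in> symbols n'' A''"
        using S gen by (simp add: symbols_iff set_nths_image length_nths_card)
      moreover have "card (?I - S) = n'"
        using S as finite_subset[OF S(1)] by (simp add: card_Diff_subset symbols_iff)
      ultimately show "s \<in> splittings n' n'' A'' id as"
        unfolding s using S by (auto simp: splittings_def)
    qed
    show "(\<lambda>(I', I'', bs). I'') ` splittings n' n'' A'' id as \<subseteq> P"
    proof
      fix S assume "S \<in> (\<lambda>(I', I'', bs). I'') ` splittings n' n'' A'' id as"
      then obtain I' bs where "(I', S, bs) \<in> splittings n' n'' A'' id as" by auto
      note * = splittings_symbols[OF as this]
      then show "S \<in> P"
        using set_nths_image[of S as] by (auto simp: P_def symbols_iff subsets_of_size_def)
    qed
    show "\<forall>s\<in>splittings n' n'' A'' id as. (\<lambda>S. (?I - S, S, nths as S)) ((\<lambda>(I', I'', bs). I'') s) = s"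
    proof
      fix s assume s: "s \<in> splittings n' n'' A'' id as"
      obtain I' I'' bs where eq: "s = (I', I'', bs)" by (cases s)
      show "(\<lambda>S. (?I - S, S, nths as S)) ((\<lambda>(I', I'', bs). I'') s) = s"
        using splittings_symbols(3,5)[OF as s[unfolded eq]] by (simp add: eq)
    qed
  qed auto
  have "split_sum ?I ?a = (\<Otimes>\<^bsub>L\<^esub>S\<in>P. ?t (?I - S, S, nths as S))"
    unfolding split_sum_def
  proof (rule L.finprod_mono_neutral_cong_right)
    fix S assume "S \<in> P"
    then have S: "S \<subseteq> ?I" and gen: "generates A'' (?a ` S)"
      and fam: "is_family n'' A'' S ?a" "is_family n' A' (?I - S) (\<pi> \<circ> ?a)"
      using split_families[OF family] by (auto simp: P_def subsets_of_size_def)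
    note s = splittings_symbols[OF as bij_betw_apply[OF bij \<open>S \<in> P\<close>]]
    have "family_value \<phi>' (?I - S) (\<pi> \<circ> ?a) = \<phi>' (map \<pi> (nths as (?I - S)))"
      by (rule family_value_eq[OF modular' s(1)]) (simp add: mset_nths multiset.map_comp)
    moreover have "family_value \<phi>'' S ?a = \<phi>'' (nths as S)"
      by (rule family_value_eq[OF modular'' s(2)]) (simp add: mset_nths S)
    ultimately show "split_term ?I ?a S = ?t (?I - S, S, nths as S)"
      using gen by (simp add: split_term_def)
  qed (use split_term_closed[OF family] finite_subsets_of_size[of ?I n''] in
      \<open>auto simp: P_def split_term_def\<close>)
  also have "\<dots> = finprod L ?t (splittings n' n'' A'' id as)"
  proof (rule L.finprod_bij[OF bij])
    fix s assume s: "s \<in> splittings n' n'' A'' id as"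
    obtain I' I'' bs where eq: "s = (I', I'', bs)" by (cases s)
    show "?t s \<in> carrier L"
      using splittings_symbols(1,2)[OF as s[unfolded eq]] bilinear_map_closed[OF bilinear]
        modular_symbol_closed[OF modular'] modular_symbol_closed[OF modular''] by (simp add: eq)
  qed
  finally show ?thesis .
qed

end

context dual_sequence
begin

lemma Delta_hom_and_symbols:
  shows "Delta n' n'' A'' A A' id \<pi> \<in> hom (symbol_module (n' + n'') A) (tensor (symbol_module n' A') (symbol_module_minus n'' A''))"
    and "as \<in> symbols (n' + n'') A \<Longrightarrow>
      Delta n' n'' A'' A A' id \<pi> (symbol (n' + n'') A as) =
      finprod (tensor (symbol_module n' A') (symbol_module_minus n'' A''))
        (\<lambda>(I', I'', bs). tens (symbol_module n' A') (symbol_module_minus n'' A'') (symbol n' A' (map \<pi> (nths as I'))) (symbol_minus n'' A'' bs))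
        (splittings n' n'' A'' id as)"
proof -
  interpret R': symbol_relations A' n' by (intro symbol_relations.intro comm_group_quotient)
  interpret R'': symbol_relations A'' n'' by (intro symbol_relations.intro comm_group_sub)
  interpret R: symbol_relations A "n' + n''" by (intro symbol_relations.intro A.comm_group_axioms)
  let ?M' = "symbol_module n' A'" and ?M'' = "symbol_module_minus n'' A''" and ?M = "symbol_module (n' + n'') A"
  interpret T: tensor_product ?M' ?M''
    by (intro tensor_product.intro R'.symbol_module_comm_group R''.symbol_module_minus_comm_group)
  interpret coproduct_data A A'' A' \<pi> ?M' ?M'' "tensor ?M' ?M''" n' n'' "symbol n' A'" "symbol_minus n'' A''"
    "tens ?M' ?M''"
    using R'.modular_symbol_symbol R''.modular_symbol_symbol_minus R''.odd_symbol_symbol_minus T.tens_bilinear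
    by unfold_locales simp_all
  define \<phi> where "\<phi> = (\<lambda>as. split_sum {..<length as} ((!) as))"
  obtain f where f: "f \<in> ext_hom ?M (tensor ?M' ?M'')" "\<And>as. as \<in> symbols (n' + n'') A \<Longrightarrow> f (symbol (n' + n'') A as) = \<phi> as"
    using R.M.presented_universal[OF T.T.comm_group_axioms R.modular_respects[OF T.T.comm_group_axioms
        modular_split_sum[folded \<phi>_def]]]
    unfolding symbol_module_def symbol_def by blast
  have "Delta n' n'' A'' A A' id \<pi> = f"
    unfolding Delta_def
  proof (rule the_equality)
    fix g assume g: "g \<in> ext_hom ?M (tensor ?M' ?M'') \<and>
      (\<forall>as\<in>symbols (n' + n'') A. g (symbol (n' + n'') A as) = finprod (tensor ?M' ?M'')
        (\<lambda>(I', I'', bs). tens ?M' ?M'' (symbol n' A' (map \<pi> (nths as I'))) (symbol_minus n'' A'' bs))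
        (splittings n' n'' A'' id as))"
    show "g = f"
    proof (rule ext_hom_eqI)
      show "g z = f z" if "z \<in> carrier ?M" for z
        using g f that split_sum_eq_splittings
        by (intro R.symbol_module_hom_eqI[OF T.T.is_group, of g f z]) (simp_all add: ext_homD \<phi>_def)
    qed (use g f in simp_all)
  qed (use f split_sum_eq_splittings in \<open>simp add: \<phi>_def\<close>)
  then show "Delta n' n'' A'' A A' id \<pi> \<in> hom ?M (tensor ?M' ?M'')"
    "as \<in> symbols (n' + n'') A \<Longrightarrow>
      Delta n' n'' A'' A A' id \<pi> (symbol (n' + n'') A as) =
      finprod (tensor ?M' ?M'')
        (\<lambda>(I', I'', bs). tens ?M' ?M'' (symbol n' A' (map \<pi> (nths as I'))) (symbol_minus n'' A'' bs))
        (splittings n' n'' A'' id as)"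
    using f split_sum_eq_splittings by (simp_all add: ext_homD \<phi>_def)
qed

end

section \<open>Roots of unity\<close>

lemma comm_group_root_group:
  assumes "N > 0" shows "comm_group (root_group N)"
proof (rule comm_groupI)
  fix x assume "x \<in> carrier (root_group N)"
  then have "x ^ N = 1" by (simp add: root_group_def)
  moreover from this have "x \<noteq> 0" using assms by (auto simp: power_0_left)
  ultimately show "\<exists>y\<in>carrier (root_group N). y \<otimes>\<^bsub>root_group N\<^esub> x = \<one>\<^bsub>root_group N\<^esub>"
    by (intro bexI[of _ "inverse x"]) (simp_all add: root_group_def power_inverse)
qed (auto simp: root_group_def power_mult_distrib)

lemma dual_sequence_root_group:
  assumes "M > 0" "l > 0"
  shows "dual_sequence (root_group (M * l)) (root_group l) (root_group M) (sigma l)"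
proof (intro dual_sequence.intro dual_sequence_axioms.intro)
  show "comm_group (root_group (M * l))"
    using assms by (intro comm_group_root_group) simp
  show "finite (carrier (root_group l))"
    using finite_nth_roots[OF assms(2)] by (simp add: root_group_def)
qed (rule short_exact_root_group[OF assms])

lemma symbol_relations_root_group: "N > 0 \<Longrightarrow> symbol_relations (root_group N)"
  by (intro symbol_relations.intro comm_group_root_group)

lemma direct_sum_symbol_modules: "direct_sum {0<..} (\<lambda>N. symbol_module n (root_group N))"
  by (intro direct_sum.intro symbol_relations.symbol_module_comm_group symbol_relations_root_group) simp

lemma direct_sum_symbol_modules_minus: "direct_sum {0<..} (\<lambda>N. symbol_module_minus n (root_group N))"
  by (intro direct_sum.intro symbol_relations.symbol_module_minus_comm_group symbol_relations_root_group) simp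

lemma QZ_incl_hom: "N > 0 \<Longrightarrow> QZ_incl n N \<in> hom (symbol_module n (root_group N)) (QZ_module n)"
  unfolding QZ_incl_def QZ_module_def by (rule direct_sum.sum_incl_hom[OF direct_sum_symbol_modules]) simp

lemma QZ_incl_minus_hom:
  "N > 0 \<Longrightarrow> QZ_incl_minus n N \<in> hom (symbol_module_minus n (root_group N)) (QZ_module_minus n)"
  unfolding QZ_incl_minus_def QZ_module_minus_def
  by (rule direct_sum.sum_incl_hom[OF direct_sum_symbol_modules_minus]) simp

lemma comm_group_QZ_module: "comm_group (QZ_module n)"
proof -
  interpret direct_sum "{0<..}" "\<lambda>N. symbol_module n (root_group N)" by (rule direct_sum_symbol_modules)
  show ?thesis unfolding QZ_module_def by (rule comm_group_axioms)
qed

lemma comm_group_QZ_module_minus: "comm_group (QZ_module_minus n)"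
proof -
  interpret direct_sum "{0<..}" "\<lambda>N. symbol_module_minus n (root_group N)"
    by (rule direct_sum_symbol_modules_minus)
  show ?thesis unfolding QZ_module_minus_def by (rule comm_group_axioms)
qed

lemma QZ_module_hom_eqI:
  assumes "group H" "f \<in> hom (QZ_module n) H" "g \<in> hom (QZ_module n) H"
    "\<And>N x. N > 0 \<Longrightarrow> x \<in> carrier (symbol_module n (root_group N)) \<Longrightarrow> f (QZ_incl n N x) = g (QZ_incl n N x)"
    "z \<in> carrier (QZ_module n)"
  shows "f z = g z"
  using direct_sum.sum_group_hom_eqI[OF direct_sum_symbol_modules assms(1), of f n g z] assms(2-5)
  by (simp add: QZ_module_def QZ_incl_def)

section \<open>The multiplication for roots of unity\<close>

text \<open>For each pair of levels \<open>M\<close>, \<open>l\<close> the product is a bilinear map on symbols of these levels, and such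
  a family of bilinear maps extends uniquely to the direct sums over all levels.\<close>

lemma ex1_induced_nabla: "\<exists>!f. induced_nabla n' n'' f"
proof -
  let ?Q' = "QZ_module n'" and ?Q'' = "QZ_module n''" and ?Q = "QZ_module (n' + n'')"
  let ?S = "\<lambda>n N. symbol_module n (root_group N)"
  interpret T: tensor_product ?Q' ?Q''
    by (intro tensor_product.intro comm_group_QZ_module)
  interpret Q: comm_group ?Q by (rule comm_group_QZ_module)
  define B where "B = (\<lambda>M l x y. QZ_incl (n' + n'') (M * l)
    (nabla n' n'' (root_group l) (root_group (M * l)) (root_group M) id (sigma l)
      (tens (?S n' M) (?S n'' l) x y)))"
  have B: "bilinear_map (?S n' M) (?S n'' l) ?Q (B M l)" if "M \<in> {0<..}" "l \<in> {0<..}" for M l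
  proof -
    have pos: "M > 0" "l > 0" "M * l > 0" using that by auto
    interpret T': tensor_product "?S n' M" "?S n'' l"
      by (intro tensor_product.intro symbol_relations.symbol_module_comm_group symbol_relations_root_group pos)
    interpret dual_sequence "root_group (M * l)" "root_group l" "root_group M" "sigma l"
      by (rule dual_sequence_root_group[OF pos(1,2)])
    show ?thesis
      unfolding B_def
      by (intro hom_bilinear_map[OF hom_bilinear_map[OF T'.tens_bilinear nabla_hom_and_symbols(1)]]
          QZ_incl_hom pos)
  qed
  have "\<exists>\<beta>. bilinear_map ?Q' ?Q'' ?Q \<beta> \<and>
    (\<forall>M\<in>{0<..}. \<forall>l\<in>{0<..}. \<forall>x\<in>carrier (?S n' M). \<forall>y\<in>carrier (?S n'' l).
      \<beta> (QZ_incl n' M x) (QZ_incl n'' l y) = B M l x y)"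
    using direct_sum_bilinear_universal[OF direct_sum_symbol_modules direct_sum_symbol_modules
        comm_group_QZ_module B]
    by (simp add: QZ_module_def QZ_incl_def)
  then obtain \<beta> where \<beta>: "bilinear_map ?Q' ?Q'' ?Q \<beta>"
    "\<forall>M\<in>{0<..}. \<forall>l\<in>{0<..}. \<forall>x\<in>carrier (?S n' M). \<forall>y\<in>carrier (?S n'' l).
      \<beta> (QZ_incl n' M x) (QZ_incl n'' l y) = B M l x y"
    by (elim exE conjE)
  obtain f where f: "f \<in> ext_hom (tensor ?Q' ?Q'') ?Q"
    "\<forall>x\<in>carrier ?Q'. \<forall>y\<in>carrier ?Q''. f (tens ?Q' ?Q'' x y) = \<beta> x y"
    by (rule bexE[OF T.tensor_universal[OF comm_group_QZ_module \<beta>(1)]])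
  show ?thesis
  proof (rule ex1I)
    show "induced_nabla n' n'' f"
      unfolding induced_nabla_def
    proof (intro conjI allI impI ballI)
      fix M l :: nat and x y assume "M > 0" "l > 0" "x \<in> carrier (?S n' M)" "y \<in> carrier (?S n'' l)"
      then show "f (tens ?Q' ?Q'' (QZ_incl n' M x) (QZ_incl n'' l y)) =
          QZ_incl (n' + n'') (M * l)
            (nabla n' n'' (root_group l) (root_group (M * l)) (root_group M) id (sigma l)
              (tens (?S n' M) (?S n'' l) x y))"
        using f(2) \<beta>(2) hom_in_carrier[OF QZ_incl_hom] by (simp add: B_def)
    qed (rule f(1))
    fix g assume g: "induced_nabla n' n'' g"
    have g_hom: "g \<in> hom (tensor ?Q' ?Q'') ?Q" and f_hom: "f \<in> hom (tensor ?Q' ?Q'') ?Q"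
      using g f by (simp_all add: induced_nabla_def ext_homD)
    have bil: "bilinear_map ?Q' ?Q'' ?Q (\<lambda>x y. h (tens ?Q' ?Q'' x y))"
      if "h \<in> hom (tensor ?Q' ?Q'') ?Q" for h
      by (rule hom_bilinear_map[OF T.tens_bilinear that])
    show "g = f"
    proof (rule ext_hom_eqI)
      show "g z = f z" if z: "z \<in> carrier (tensor ?Q' ?Q'')" for z
      proof (rule T.tensor_hom_eqI[OF Q.is_group g_hom f_hom _ z])
        fix x y assume x: "x \<in> carrier ?Q'" and y: "y \<in> carrier ?Q''"
        show "g (tens ?Q' ?Q'' x y) = f (tens ?Q' ?Q'' x y)"
        proof (rule QZ_module_hom_eqI[OF Q.is_group _ _ _ x])
          show "(\<lambda>x. g (tens ?Q' ?Q'' x y)) \<in> hom ?Q' ?Q" "(\<lambda>x. f (tens ?Q' ?Q'' x y)) \<in> hom ?Q' ?Q"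
            using bil[OF g_hom] bil[OF f_hom] y unfolding bilinear_map_def by blast+
          fix M x assume M: "M > 0" and x: "x \<in> carrier (?S n' M)"
          have x': "QZ_incl n' M x \<in> carrier ?Q'" using M x by (rule hom_in_carrier[OF QZ_incl_hom])
          show "g (tens ?Q' ?Q'' (QZ_incl n' M x) y) = f (tens ?Q' ?Q'' (QZ_incl n' M x) y)"
          proof (rule QZ_module_hom_eqI[OF Q.is_group _ _ _ y])
            show "(\<lambda>y. g (tens ?Q' ?Q'' (QZ_incl n' M x) y)) \<in> hom ?Q'' ?Q"
              "(\<lambda>y. f (tens ?Q' ?Q'' (QZ_incl n' M x) y)) \<in> hom ?Q'' ?Q"
              using bil[OF g_hom] bil[OF f_hom] x' unfolding bilinear_map_def by blast+
            fix l y assume l: "l > 0" and y: "y \<in> carrier (?S n'' l)"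
            have "g (tens ?Q' ?Q'' (QZ_incl n' M x) (QZ_incl n'' l y)) = B M l x y"
              using g M l x y by (simp add: induced_nabla_def B_def)
            also have "\<dots> = f (tens ?Q' ?Q'' (QZ_incl n' M x) (QZ_incl n'' l y))"
              using f(2) \<beta>(2) M l x y hom_in_carrier[OF QZ_incl_hom] by simp
            finally show "g (tens ?Q' ?Q'' (QZ_incl n' M x) (QZ_incl n'' l y)) =
                f (tens ?Q' ?Q'' (QZ_incl n' M x) (QZ_incl n'' l y))" .
          qed
        qed
      qed
    qed (use g f in \<open>simp_all add: induced_nabla_def\<close>)
  qed
qed

lemma induced_nabla_symbols:
  assumes "induced_nabla n' n'' f" "M > 0" "l > 0" "a \<in> symbols n' (root_group M)" "b \<in> symbols n'' (root_group l)"
  shows "f (tens (QZ_module n') (QZ_module n'')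
      (QZ_incl n' M (symbol n' (root_group M) a)) (QZ_incl n'' l (symbol n'' (root_group l) b))) =
    QZ_incl (n' + n'') (M * l) (rho_symbol (n' + n'') M l a b)"
proof -
  interpret dual_sequence "root_group (M * l)" "root_group l" "root_group M" "sigma l"
    by (rule dual_sequence_root_group[OF assms(2,3)])
  have "symbol n' (root_group M) a \<in> carrier (symbol_module n' (root_group M))"
    "symbol n'' (root_group l) b \<in> carrier (symbol_module n'' (root_group l))"
    using modular_symbol_closed[OF symbol_relations.modular_symbol_symbol[OF symbol_relations_root_group]] assms
    by blast+
  then show ?thesis
    using assms nabla_hom_and_symbols(2)[OF assms(4,5)]
    by (simp add: induced_nabla_def rho_symbol_def)
qed

section \<open>The comultiplication for roots of unity\<close>

lemma finite_degree_pairs: "finite (degree_pairs n)"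
  by (rule finite_subset[of _ "{..n} \<times> {..n}"]) (auto simp: degree_pairs_def)

lemma tensor_product_QZ: "tensor_product (QZ_module n') (QZ_module_minus n'')"
  by (intro tensor_product.intro comm_group_QZ_module comm_group_QZ_module_minus)

lemma comm_group_QZ_tensor: "comm_group (QZ_tensor p)"
proof (cases p)
  case (Pair n' n'')
  interpret tensor_product "QZ_module n'" "QZ_module_minus n''" by (rule tensor_product_QZ)
  show ?thesis by (simp add: Pair QZ_tensor_def T.comm_group_axioms)
qed

lemma direct_sum_QZ_tensor: "direct_sum (degree_pairs n) QZ_tensor"
  by (intro direct_sum.intro comm_group_QZ_tensor)

text \<open>The component of degree \<open>(n', n'')\<close> of the coproduct that comes from the sequence
  \<open>0 \<rightarrow> A\<^sub>l \<rightarrow> A\<^sub>N \<rightarrow> A\<^bsub>N/l\<^esub> \<rightarrow> 0\<close>.\<close>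

definition coproduct_at_level ::
  "nat \<Rightarrow> nat \<Rightarrow> nat \<Rightarrow> nat \<Rightarrow> _ \<Rightarrow> _" where
  "coproduct_at_level n' n'' N l x =
     tensor_map
       (symbol_module n' (root_group (N div l))) (symbol_module_minus n'' (root_group l))
       (QZ_module n') (QZ_module_minus n'')
       (QZ_incl n' (N div l)) (QZ_incl_minus n'' l)
       (Delta n' n'' (root_group l) (root_group N) (root_group (N div l)) id (sigma l) x)"

context
  fixes N l n' n'' :: nat
  assumes N: "N > 0" and l: "l dvd N"
begin

private lemma pos: "l > 0" "N div l > 0" "N div l * l = N"
  using N l by (auto simp: dvd_pos_nat div_greater_zero_iff dvd_imp_le)

interpretation S: dual_sequence "root_group N" "root_group l" "root_group (N div l)" "sigma l"
  using dual_sequence_root_group[OF pos(2,1)] by (simp add: pos)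

private lemmas tensor_map_incl = tensor_map_props[
    OF symbol_relations.symbol_module_comm_group[OF symbol_relations_root_group[OF pos(2)]]
       symbol_relations.symbol_module_minus_comm_group[OF symbol_relations_root_group[OF pos(1)]]
       comm_group_QZ_module comm_group_QZ_module_minus QZ_incl_hom[OF pos(2)] QZ_incl_minus_hom[OF pos(1)]]

lemma coproduct_at_level_hom:
  "coproduct_at_level n' n'' N l \<in> hom (symbol_module (n' + n'') (root_group N)) (QZ_tensor (n', n''))"
  using hom_compose[OF S.Delta_hom_and_symbols(1) tensor_map_incl(1)]
  by (simp add: coproduct_at_level_def[abs_def] comp_def QZ_tensor_def)

lemma splitting_term_closed:
  assumes "a \<in> symbols (n' + n'') (root_group N)" "(I', I'', bs) \<in> splittings n' n'' (root_group l) id a"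
  shows "tens (QZ_module n') (QZ_module_minus n'')
      (QZ_incl n' (N div l) (symbol n' (root_group (N div l)) (map (sigma l) (nths a I'))))
      (QZ_incl_minus n'' l (symbol_minus n'' (root_group l) bs)) \<in> carrier (QZ_tensor (n', n''))"
proof -
  interpret Q: tensor_product "QZ_module n'" "QZ_module_minus n''" by (rule tensor_product_QZ)
  note s = S.splittings_symbols[OF assms]
  show ?thesis
    unfolding QZ_tensor_def prod.case
    by (intro Q.tens_closed hom_in_carrier[OF QZ_incl_hom] hom_in_carrier[OF QZ_incl_minus_hom] pos
        modular_symbol_closed[OF symbol_relations.modular_symbol_symbol]
        modular_symbol_closed[OF symbol_relations.modular_symbol_symbol_minus] symbol_relations_root_group s)
qed

lemma coproduct_at_level_symbol:
  assumes a: "a \<in> symbols (n' + n'') (root_group N)"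
  shows "coproduct_at_level n' n'' N l (symbol (n' + n'') (root_group N) a) =
    finprod (QZ_tensor (n', n''))
      (\<lambda>(I', I'', bs). tens (QZ_module n') (QZ_module_minus n'')
        (QZ_incl n' (N div l) (symbol n' (root_group (N div l)) (map (sigma l) (nths a I'))))
        (QZ_incl_minus n'' l (symbol_minus n'' (root_group l) bs)))
      (splittings n' n'' (root_group l) id a)"
proof -
  let ?M' = "symbol_module n' (root_group (N div l))" and ?M'' = "symbol_module_minus n'' (root_group l)"
  interpret D: tensor_product ?M' ?M''
    by (intro tensor_product.intro symbol_relations.symbol_module_comm_group
        symbol_relations.symbol_module_minus_comm_group symbol_relations_root_group pos)
  interpret Q: comm_group "QZ_tensor (n', n'')" by (rule comm_group_QZ_tensor)
  let ?h = "tensor_map ?M' ?M'' (QZ_module n') (QZ_module_minus n'') (QZ_incl n' (N div l)) (QZ_incl_minus n'' l)"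
  let ?t = "\<lambda>(I', I'', bs). tens ?M' ?M'' (symbol n' (root_group (N div l)) (map (sigma l) (nths a I')))
      (symbol_minus n'' (root_group l) bs)"
  let ?q = "\<lambda>(I', I'', bs). tens (QZ_module n') (QZ_module_minus n'')
        (QZ_incl n' (N div l) (symbol n' (root_group (N div l)) (map (sigma l) (nths a I'))))
        (QZ_incl_minus n'' l (symbol_minus n'' (root_group l) bs))"
  have sym: "symbol n' (root_group (N div l)) (map (sigma l) (nths a I')) \<in> carrier ?M'"
    "symbol_minus n'' (root_group l) bs \<in> carrier ?M''"
    if "(I', I'', bs) \<in> splittings n' n'' (root_group l) id a" for I' I'' bs
    using S.splittings_symbols[OF a that] pos
      modular_symbol_closed[OF symbol_relations.modular_symbol_symbol[OF symbol_relations_root_group]]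
      modular_symbol_closed[OF symbol_relations.modular_symbol_symbol_minus[OF symbol_relations_root_group]]
    by blast+
  have h: "?h \<in> hom (tensor ?M' ?M'') (QZ_tensor (n', n''))"
    using tensor_map_incl(1) by (simp add: QZ_tensor_def)
  have "coproduct_at_level n' n'' N l (symbol (n' + n'') (root_group N) a) =
      ?h (finprod (tensor ?M' ?M'') ?t (splittings n' n'' (root_group l) id a))"
    using S.Delta_hom_and_symbols(2)[OF a] by (simp add: coproduct_at_level_def)
  also have "\<dots> = finprod (QZ_tensor (n', n'')) (\<lambda>s. ?h (?t s)) (splittings n' n'' (root_group l) id a)"
  proof (rule hom_finprod[OF D.T.comm_group_axioms Q.comm_group_axioms h])
    fix s assume "s \<in> splittings n' n'' (root_group l) id a"
    then show "?t s \<in> carrier (tensor ?M' ?M'')"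
      using sym by (cases s) (auto intro: D.tens_closed)
  qed
  also have "\<dots> = finprod (QZ_tensor (n', n'')) ?q (splittings n' n'' (root_group l) id a)"
  proof (rule Q.finprod_cong')
    fix s assume s: "s \<in> splittings n' n'' (root_group l) id a"
    obtain I' I'' bs where eq: "s = (I', I'', bs)" by (cases s)
    show "?h (?t s) = ?q s"
      using tensor_map_incl(2)[OF sym[OF s[unfolded eq]]] by (simp add: eq)
  qed (use splitting_term_closed[OF a] in auto)
  finally show ?thesis .
qed

end

lemma induced_Delta_iff:
  "induced_Delta n f \<longleftrightarrow> f \<in> ext_hom (QZ_module n) (QZ_tensor_sum n) \<and>
    (\<forall>N>0. \<forall>x\<in>carrier (symbol_module n (root_group N)). \<forall>(n', n'')\<in>degree_pairs n.
      f (QZ_incl n N x) (n', n'') =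
      (\<Otimes>\<^bsub>QZ_tensor (n', n'')\<^esub>l\<in>{l. l dvd N}. coproduct_at_level n' n'' N l x))"
  by (simp add: induced_Delta_def coproduct_at_level_def)

lemma induced_Delta_component:
  assumes "induced_Delta n f" "N > 0" "x \<in> carrier (symbol_module n (root_group N))"
    "(n', n'') \<in> degree_pairs n"
  shows "f (QZ_incl n N x) (n', n'') =
    (\<Otimes>\<^bsub>QZ_tensor (n', n'')\<^esub>l\<in>{l. l dvd N}. coproduct_at_level n' n'' N l x)"
  using assms unfolding induced_Delta_iff by blast

text \<open>Only finitely many \<open>l\<close> divide \<open>N\<close> and only finitely many degrees occur, so the prescribed components
  at level \<open>N\<close> make up a homomorphism \<open>E N\<close> into the direct sum of the tensor products.\<close>

lemma ex1_induced_Delta: "\<exists>!f. induced_Delta n f"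
proof -
  interpret D: direct_sum "degree_pairs n" QZ_tensor by (rule direct_sum_QZ_tensor)
  let ?S = "\<lambda>N. symbol_module n (root_group N)"
  define E where "E = (\<lambda>N x. \<lambda>p\<in>degree_pairs n.
    (\<Otimes>\<^bsub>QZ_tensor p\<^esub>l\<in>{l. l dvd N}. coproduct_at_level (fst p) (snd p) N l x))"
  have E: "E N \<in> hom (?S N) (QZ_tensor_sum n)" if "N \<in> {0<..}" for N
    unfolding E_def QZ_tensor_sum_def
  proof (intro hom_into_finite_sum_group finite_degree_pairs D.group_summand finprod_hom_in_hom comm_group_QZ_tensor)
    fix p l assume p: "p \<in> degree_pairs n" and l: "l \<in> {l. l dvd N}"
    then have n: "n = fst p + snd p" by (auto simp: degree_pairs_def)
    show "coproduct_at_level (fst p) (snd p) N l \<in> hom (?S N) (QZ_tensor p)"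
      using coproduct_at_level_hom[of N l "fst p" "snd p"] that l by (simp add: n)
  qed
  have "\<exists>f\<in>ext_hom (QZ_module n) (QZ_tensor_sum n).
      \<forall>N\<in>{0<..}. \<forall>x\<in>carrier (?S N). f (QZ_incl n N x) = E N x"
    using direct_sum.sum_group_universal[OF direct_sum_symbol_modules D.comm_group_axioms
        E[unfolded QZ_tensor_sum_def]]
    by (simp add: QZ_module_def QZ_incl_def QZ_tensor_sum_def)
  then obtain f where f: "f \<in> ext_hom (QZ_module n) (QZ_tensor_sum n)"
    "\<forall>N\<in>{0<..}. \<forall>x\<in>carrier (?S N). f (QZ_incl n N x) = E N x"
    by (elim bexE)
  show ?thesis
  proof (rule ex1I)
    show "induced_Delta n f"
      using f by (auto simp: induced_Delta_iff E_def)
    fix g assume g: "induced_Delta n g"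
    have homs: "g \<in> hom (QZ_module n) (QZ_tensor_sum n)" "f \<in> hom (QZ_module n) (QZ_tensor_sum n)"
      using g f by (simp_all add: induced_Delta_iff ext_homD)
    have "g z = f z" if "z \<in> carrier (QZ_module n)" for z
    proof (rule QZ_module_hom_eqI[OF D.is_group[folded QZ_tensor_sum_def] homs _ that])
      fix N x assume N: "N > 0" and x: "x \<in> carrier (?S N)"
      have incl: "QZ_incl n N x \<in> carrier (QZ_module n)"
        using N x by (rule hom_in_carrier[OF QZ_incl_hom])
      have "g (QZ_incl n N x) \<in> extensional (degree_pairs n)"
        using hom_in_carrier[OF homs(1) incl] by (simp add: QZ_tensor_sum_def D.carrier_iff PiE_def)
      moreover have "E N x \<in> extensional (degree_pairs n)" by (simp add: E_def)
      moreover have "g (QZ_incl n N x) p = E N x p" if "p \<in> degree_pairs n" for p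
        using induced_Delta_component[OF g N x, of "fst p" "snd p"] that by (simp add: E_def)
      ultimately have "g (QZ_incl n N x) = E N x" by (rule extensionalityI)
      then show "g (QZ_incl n N x) = f (QZ_incl n N x)" using f(2) N x by simp
    qed
    then show "g = f"
      using g f(1) by (intro ext_hom_eqI[of g "QZ_module n" "QZ_tensor_sum n" f]) (simp_all add: induced_Delta_iff)
  qed
qed

text \<open>Equality is checked in each degree \<open>(n', n'')\<close>.  On the right only the partitions with parts of
  sizes \<open>n'\<close> and \<open>n''\<close> contribute; together with their level \<open>l\<close> they correspond to the splittings
  for the various \<open>l\<close> on the left.\<close>

lemma induced_Delta_symbols:
  assumes f: "induced_Delta n f" and N: "N > 0" and a: "a \<in> symbols n (root_group N)"
  shows "f (QZ_incl n N (symbol n (root_group N) a)) =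
    finprod (QZ_tensor_sum n)
      (\<lambda>(l, I', I''). sum_incl (degree_pairs n) QZ_tensor (card I', card I'')
         (tens (QZ_module (card I')) (QZ_module_minus (card I''))
            (QZ_incl (card I') (N div l)
               (symbol (card I') (root_group (N div l)) (map (sigma l) (nths a I'))))
            (QZ_incl_minus (card I'') l
               (symbol_minus (card I'') (root_group l) (nths a I'')))))
      (QZ_splittings N a)"
proof -
  interpret D: direct_sum "degree_pairs n" QZ_tensor by (rule direct_sum_QZ_tensor)
  let ?x = "symbol n (root_group N) a"
  define t where "t = (\<lambda>(l, I', I''). tens (QZ_module (card I')) (QZ_module_minus (card I''))
    (QZ_incl (card I') (N div l) (symbol (card I') (root_group (N div l)) (map (sigma l) (nths a I'))))
    (QZ_incl_minus (card I'') l (symbol_minus (card I'') (root_group l) (nths a I''))))"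
  define deg where "deg = (\<lambda>(l :: nat, I' :: nat set, I'' :: nat set). (card I', card I''))"
  define F where "F = (\<lambda>s. sum_incl (degree_pairs n) QZ_tensor (deg s) (t s))"
  have length: "length a = n" using a by (simp add: symbols_iff)
  have splitting: "deg (l, I', I'') \<in> degree_pairs n" "l dvd N"
    "(I', I'', nths a I'') \<in> splittings (card I') (card I'') (root_group l) id a"
    "a \<in> symbols (card I' + card I'') (root_group N)"
    if "(l, I', I'') \<in> QZ_splittings N a" for l I' I''
  proof -
    have s: "l dvd N" "I' \<union> I'' = {..<n}" "I' \<inter> I'' = {}" "I' \<noteq> {}" "I'' \<noteq> {}"
      "nths a I'' \<in> symbols (card I'') (root_group l)"
      using that by (auto simp: QZ_splittings_def length)
    have fin: "finite I'" "finite I''" using s(2) by (metis finite_Un finite_lessThan)+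
    have "card I' + card I'' = n"
      using card_Un_disjoint[OF fin s(3)] s(2) by simp
    with s fin show "deg (l, I', I'') \<in> degree_pairs n" "l dvd N"
      "(I', I'', nths a I'') \<in> splittings (card I') (card I'') (root_group l) id a"
      "a \<in> symbols (card I' + card I'') (root_group N)"
      using a by (auto simp: deg_def degree_pairs_def splittings_def length Suc_le_eq card_gt_0_iff)
  qed
  have t_closed: "t s \<in> carrier (QZ_tensor (deg s))" if s: "s \<in> QZ_splittings N a" for s
  proof -
    obtain l I' I'' where eq: "s = (l, I', I'')" by (cases s)
    note * = splitting[OF s[unfolded eq]]
    show ?thesis
      using splitting_term_closed[OF N *(2) *(4) *(3)] by (simp add: t_def deg_def eq)
  qed
  have F_closed: "F s \<in> carrier (sum_group (degree_pairs n) QZ_tensor)" if "s \<in> QZ_splittings N a" for s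
    using that t_closed[OF that] splitting(1) unfolding F_def by (cases s) (auto intro!: D.sum_incl_closed)
  have x: "?x \<in> carrier (symbol_module n (root_group N))"
    using a by (rule modular_symbol_closed[OF symbol_relations.modular_symbol_symbol[OF symbol_relations_root_group[OF N]]])
  have f_hom: "f \<in> hom (QZ_module n) (QZ_tensor_sum n)"
    using f by (simp add: induced_Delta_iff ext_homD)
  have component: "f (QZ_incl n N ?x) (n', n'') = finprod (QZ_tensor_sum n) F (QZ_splittings N a) (n', n'')"
    if p: "(n', n'') \<in> degree_pairs n" for n' n''
  proof -
    have n: "n = n' + n''" "n' > 0" "n'' > 0" using p by (auto simp: degree_pairs_def)
    interpret Q: comm_group "QZ_tensor (n', n'')" by (rule comm_group_QZ_tensor)
    let ?L = "{l. l dvd N}" and ?s = "\<lambda>l. splittings n' n'' (root_group l) id a"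
    let ?q = "\<lambda>l (I', I'', bs). tens (QZ_module n') (QZ_module_minus n'')
        (QZ_incl n' (N div l) (symbol n' (root_group (N div l)) (map (sigma l) (nths a I'))))
        (QZ_incl_minus n'' l (symbol_minus n'' (root_group l) bs))"
    let ?Z = "{s \<in> QZ_splittings N a. deg s = (n', n'')}"
    have finL: "finite ?L" using N by (simp add: finite_divisors_nat)
    have q_closed: "?q l s \<in> carrier (QZ_tensor (n', n''))" if "l dvd N" "s \<in> ?s l" for l s
      using splitting_term_closed[OF N that(1), of a n' n''] a that(2) by (cases s) (simp add: n)
    have fin_s: "finite (?s l)" if "l dvd N" for l
    proof -
      have "l > 0" "N div l > 0" "N div l * l = N"
        using N that by (auto simp: dvd_pos_nat div_greater_zero_iff dvd_imp_le)
      then show ?thesis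
        using dual_sequence.finite_splittings[OF dual_sequence_root_group, of "N div l" l] by simp
    qed
    have bij: "bij_betw (\<lambda>(l, I', I''). (l, I', I'', nths a I'')) ?Z (Sigma ?L ?s)"
    proof (rule bij_betw_byWitness[where f' = "\<lambda>(l, I', I'', bs). (l, I', I'')"])
      show "(\<lambda>(l, I', I''). (l, I', I'', nths a I'')) ` ?Z \<subseteq> Sigma ?L ?s"
        using splitting by (auto simp: deg_def)
      show "(\<lambda>(l, I', I'', bs). (l, I', I'')) ` Sigma ?L ?s \<subseteq> ?Z"
        using n by (auto simp: splittings_def QZ_splittings_def deg_def)
    qed (auto simp: splittings_def)
    have "f (QZ_incl n N ?x) (n', n'') = (\<Otimes>\<^bsub>QZ_tensor (n', n'')\<^esub>l\<in>?L. coproduct_at_level n' n'' N l ?x)"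
      by (rule induced_Delta_component[OF f N x p])
    also have "\<dots> = (\<Otimes>\<^bsub>QZ_tensor (n', n'')\<^esub>l\<in>?L. finprod (QZ_tensor (n', n'')) (?q l) (?s l))"
      using coproduct_at_level_symbol[OF N, of _ a n' n''] a q_closed
      by (intro Q.finprod_cong') (auto simp: n(1) intro!: Q.finprod_closed)
    also have "\<dots> = (\<Otimes>\<^bsub>QZ_tensor (n', n'')\<^esub>z\<in>Sigma ?L ?s. ?q (fst z) (snd z))"
      using finL fin_s q_closed by (intro Q.finprod_Sigma[symmetric]) auto
    also have "\<dots> = (\<Otimes>\<^bsub>QZ_tensor (n', n'')\<^esub>s\<in>?Z.
        (\<lambda>z. ?q (fst z) (snd z)) ((\<lambda>(l, I', I''). (l, I', I'', nths a I'')) s))"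
      using q_closed by (intro Q.finprod_bij[OF bij, symmetric]) auto
    also have "\<dots> = finprod (QZ_tensor (n', n'')) t ?Z"
      using t_closed by (intro Q.finprod_cong') (auto simp: t_def deg_def)
    also have "\<dots> = (\<Otimes>\<^bsub>QZ_tensor (n', n'')\<^esub>s\<in>QZ_splittings N a. F s (n', n''))"
    proof (rule Q.finprod_mono_neutral_cong_left)
      have "Sigma ?L (\<lambda>l. Pow {..<n} \<times> Pow {..<n}) \<supseteq> QZ_splittings N a"
        by (auto simp: QZ_splittings_def length)
      then show "finite (QZ_splittings N a)"
        by (rule finite_subset) (use finL in auto)
      show "(\<lambda>s. F s (n', n'')) \<in> QZ_splittings N a \<rightarrow> carrier (QZ_tensor (n', n''))"
        using F_closed p by (auto simp: D.carrier_iff)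
    qed (use p splitting(1) in \<open>auto simp: F_def D.sum_incl_component\<close>)
    also have "\<dots> = finprod (QZ_tensor_sum n) F (QZ_splittings N a) (n', n'')"
      unfolding QZ_tensor_sum_def using D.finprod_component[OF p, of "QZ_splittings N a" F] F_closed by simp
    finally show ?thesis .
  qed
  have "f (QZ_incl n N ?x) = finprod (QZ_tensor_sum n) F (QZ_splittings N a)"
  proof (rule extensionalityI[of _ "degree_pairs n"])
    show "f (QZ_incl n N ?x) \<in> extensional (degree_pairs n)"
      using hom_in_carrier[OF f_hom hom_in_carrier[OF QZ_incl_hom[OF N] x]]
      by (simp add: QZ_tensor_sum_def D.carrier_iff PiE_def)
    have "finprod (QZ_tensor_sum n) F (QZ_splittings N a) \<in> carrier (QZ_tensor_sum n)"
      unfolding QZ_tensor_sum_def using F_closed by (intro D.finprod_closed) auto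
    then show "finprod (QZ_tensor_sum n) F (QZ_splittings N a) \<in> extensional (degree_pairs n)"
      by (simp add: QZ_tensor_sum_def D.carrier_iff PiE_def)
  qed (use component in auto)
  also have "F = (\<lambda>(l, I', I''). sum_incl (degree_pairs n) QZ_tensor (card I', card I'')
         (tens (QZ_module (card I')) (QZ_module_minus (card I''))
            (QZ_incl (card I') (N div l)
               (symbol (card I') (root_group (N div l)) (map (sigma l) (nths a I'))))
            (QZ_incl_minus (card I'') l
               (symbol_minus (card I'') (root_group l) (nths a I'')))))"
    by (auto simp: F_def deg_def t_def)
  finally show ?thesis .
qed

theorem lemma4p9:
  shows
    "(\<forall>n' n''. 1 \<le> n' \<longrightarrow> 1 \<le> n'' \<longrightarrow>
        (\<exists>!f. induced_nabla n' n'' f) \<and>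
        (\<forall>f. induced_nabla n' n'' f \<longrightarrow>
          (\<forall>M>0. \<forall>l>0. \<forall>a\<in>symbols n' (root_group M). \<forall>b\<in>symbols n'' (root_group l).
             f (tens (QZ_module n') (QZ_module n'')
                  (QZ_incl n' M (symbol n' (root_group M) a))
                  (QZ_incl n'' l (symbol n'' (root_group l) b))) =
             QZ_incl (n' + n'') (M * l) (rho_symbol (n' + n'') M l a b)))) \<and>
     (\<forall>n. 1 \<le> n \<longrightarrow>
        (\<exists>!f. induced_Delta n f) \<and>
        (\<forall>f. induced_Delta n f \<longrightarrow>
          (\<forall>N>0. \<forall>a\<in>symbols n (root_group N).
             f (QZ_incl n N (symbol n (root_group N) a)) =
             finprod (QZ_tensor_sum n)
               (\<lambda>(l, I', I''). sum_incl (degree_pairs n) QZ_tensor (card I', card I'')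
                  (tens (QZ_module (card I')) (QZ_module_minus (card I''))
                     (QZ_incl (card I') (N div l)
                        (symbol (card I') (root_group (N div l)) (map (sigma l) (nths a I'))))
                     (QZ_incl_minus (card I'') l
                        (symbol_minus (card I'') (root_group l) (nths a I'')))))
               (QZ_splittings N a))))"
proof (intro conjI allI impI ballI)
qed (rule ex1_induced_nabla ex1_induced_Delta induced_nabla_symbols induced_Delta_symbols; assumption)+

end
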